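(* Let $G=G_1\ast_A G_2$ be an amalgam of finite groups. There exists an algorithm which, given finitely many subgroup generators $h_1,\ldots,h_k\in G$ and a normal word $g\in G$, finds the minimal $n\ge1$ such that $g^n$ is a nontrivial power of $g$ (i.e. $g^n\neq1$ in $G$) and $g^n\in H=\langle h_1,\ldots,h_k\rangle$, or reports that no such $n$ exists.
   Context: $G=G_1\ast_A G_2$ is a free product with amalgamation, where $G_1=\langle X_1\mid R_1\rangle$ and $G_2=\langle X_2\mid R_2\rangle$ are finite groups given by finite presentations with $X_1^{\pm}\cap X_2^{\pm}=\emptyset$, $A$ is a group generated by $Y$ with monomorphisms $\phi_i:A\to G_i$ ($i=1,2$), and $G=\langle X_1\cup X_2\mid R_1,R_2,\ \phi_1(a)=\phi_2(a)\ (a\in Y)\rangle$. The amalgam (the finite groups $G_1,G_2,A$, their presentations, the monomorphisms) is fixed and known to the algorithm. Elements of $G$ are input as words in the letters $X^{\pm}$, where $X=X_1\cup X_2$. A word over $X^{\pm}$ is normal if it has a decomposition $g_1g_2\cdots g_n$ where each $g_j$ is a word over $X_1^{\pm}$ or over $X_2^{\pm}$ with $g_j\ne_G1$, consecutive $g_j,g_{j+1}$ are in different factors, and if $n\neq1$ then no $g_j$ lies in $A$. *)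

theory Defs
  imports "HOL-Algebra.Generated_Groups" "HOL-Library.Nat_Bijection"
begin

datatype recf =
    Zero
  | Succ
  | Proj nat
  | Comp recf "recf list"
  | PrimRec recf recf
  | Mu recf

text \<open>
  \<open>evals p xs y\<close>: on the input tuple \<open>xs\<close> the program \<open>p\<close> halts with output \<open>y\<close>. In the rule
  for \<open>Mu\<close> all values before the first zero must be defined, so divergence is respected.
\<close>

inductive evals :: "recf \<Rightarrow> nat list \<Rightarrow> nat \<Rightarrow> bool" where
  zero: "evals Zero xs 0"
| succ: "evals Succ [x] (Suc x)"
| proj: "i < length xs \<Longrightarrow> evals (Proj i) xs (xs ! i)"
| comp: "list_all2 (\<lambda>q y. evals q xs y) qs ys \<Longrightarrow> evals p ys z \<Longrightarrow> evals (Comp p qs) xs z"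
| prim_rec_0: "evals p xs y \<Longrightarrow> evals (PrimRec p q) (0 # xs) y"
| prim_rec_Suc: "evals (PrimRec p q) (n # xs) y \<Longrightarrow> evals q (n # y # xs) z
    \<Longrightarrow> evals (PrimRec p q) (Suc n # xs) z"
| mu: "evals p (n # xs) 0 \<Longrightarrow> (\<And>m. m < n \<Longrightarrow> \<exists>y. evals p (m # xs) (Suc y))
    \<Longrightarrow> evals (Mu p) xs n"

lemma evals_deterministic: "evals p xs y \<Longrightarrow> evals p xs z \<Longrightarrow> z = y"
proof (induction arbitrary: z rule: evals.induct)
  case (zero xs)
  then show ?case by (auto elim: evals.cases)
next
  case (succ x)
  then show ?case by (auto elim: evals.cases)
next
  case (proj i xs)
  from proj(2) show ?case by (auto elim: evals.cases)
next
  case (comp xs qs ys p z)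
  from comp.prems obtain ys' where
    a: "list_all2 (\<lambda>q y. evals q xs y) qs ys'" "evals p ys' z"
    by (auto elim: evals.cases)
  have "ys' = ys"
    using comp(1) a(1) by (auto simp: list_all2_conv_all_nth intro!: nth_equalityI)
  then show ?case using comp a by auto
next
  case (prim_rec_0 p xs y q)
  from prim_rec_0.prems show ?case
    by cases (use prim_rec_0.IH in auto)
next
  case (prim_rec_Suc p q n xs y z)
  from prim_rec_Suc.prems show ?case
    by cases (use prim_rec_Suc.IH in auto)
next
  case (mu p n xs z)
  from mu.prems show ?case
  proof cases
    case mu: mu
    show ?thesis
    proof (rule linorder_cases[of z n])
      assume "z < n"
      then show ?thesis using mu(1) \<open>\<And>m. m < n \<Longrightarrow> _\<close> by fastforce
    next
      assume "n < z"
      then show ?thesis using mu(2) \<open>\<And>z. evals p (n # xs) z \<Longrightarrow> z = 0\<close> by fastforce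
    qed
  qed
qed

text \<open>The letter \<open>(x, True)\<close> stands for \<open>x\<close> and \<open>(x, False)\<close> for the formal inverse of \<open>x\<close>.\<close>

type_synonym 'x word = "('x \<times> bool) list"

definition words :: "'x set \<Rightarrow> 'x word set" where
  "words X = lists (X \<times> UNIV)"

definition inv_word :: "'x word \<Rightarrow> 'x word" where
  "inv_word w = rev (map (\<lambda>(x, b). (x, \<not> b)) w)"

inductive pres_eq :: "'x set \<Rightarrow> 'x word set \<Rightarrow> 'x word \<Rightarrow> 'x word \<Rightarrow> bool"
  for X :: "'x set" and R :: "'x word set" where
  refl: "w \<in> words X \<Longrightarrow> pres_eq X R w w"
| sym: "pres_eq X R u v \<Longrightarrow> pres_eq X R v u"
| trans: "pres_eq X R u v \<Longrightarrow> pres_eq X R v w \<Longrightarrow> pres_eq X R u w"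
| cancel: "u \<in> words X \<Longrightarrow> v \<in> words X \<Longrightarrow> x \<in> X \<Longrightarrow>
    pres_eq X R (u @ [(x, b), (x, \<not> b)] @ v) (u @ v)"
| relator: "u \<in> words X \<Longrightarrow> v \<in> words X \<Longrightarrow> r \<in> R \<Longrightarrow>
    pres_eq X R (u @ r @ v) (u @ v)"

definition word_class :: "'x set \<Rightarrow> 'x word set \<Rightarrow> 'x word \<Rightarrow> 'x word set" where
  "word_class X R w = {v. pres_eq X R w v}"

definition presented_group :: "'x set \<Rightarrow> 'x word set \<Rightarrow> 'x word set monoid" where
  "presented_group X R =
     \<lparr>carrier = word_class X R ` words X,
      mult = (\<lambda>U V. \<Union>u\<in>U. \<Union>v\<in>V. word_class X R (u @ v)),
      one = word_class X R []\<rparr>"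

lemma words_append [simp]: "u @ v \<in> words X \<longleftrightarrow> u \<in> words X \<and> v \<in> words X"
  by (auto simp: words_def)

lemma words_Nil [simp]: "[] \<in> words X"
  by (simp add: words_def)

lemma words_Cons [simp]: "(x, b) # v \<in> words X \<longleftrightarrow> x \<in> X \<and> v \<in> words X"
  by (auto simp: words_def)

lemma inv_word_in_words [simp]: "w \<in> words X \<Longrightarrow> inv_word w \<in> words X"
  by (auto simp: words_def inv_word_def)

lemma pres_eq_words:
  assumes "R \<subseteq> words X" "pres_eq X R u v"
  shows "u \<in> words X \<and> v \<in> words X"
  using assms(2,1) by induction auto

lemma pres_eq_append_left:
  "pres_eq X R u v \<Longrightarrow> w \<in> words X \<Longrightarrow> pres_eq X R (w @ u) (w @ v)"
proof (induction rule: pres_eq.induct)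
  case (cancel u v x b)
  then show ?case using pres_eq.cancel[of "w @ u" X v x R b] by simp
next
  case (relator u v r)
  then show ?case using pres_eq.relator[of "w @ u" X v r R] by simp
qed (auto intro: pres_eq.intros)

lemma pres_eq_append_right:
  "pres_eq X R u v \<Longrightarrow> w \<in> words X \<Longrightarrow> pres_eq X R (u @ w) (v @ w)"
proof (induction rule: pres_eq.induct)
  case (cancel u v x b)
  then show ?case using pres_eq.cancel[of u X "v @ w" x R b] by simp
next
  case (relator u v r)
  then show ?case using pres_eq.relator[of u X "v @ w" r R] by simp
qed (auto intro: pres_eq.intros)

lemma pres_eq_append:
  assumes "R \<subseteq> words X" "pres_eq X R u u'" "pres_eq X R v v'"
  shows "pres_eq X R (u @ v) (u' @ v')"
  using assms pres_eq_append_left pres_eq_append_right pres_eq_words pres_eq.trans by metis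

lemma pres_eq_inv_word: "w \<in> words X \<Longrightarrow> pres_eq X R (inv_word w @ w) []"
proof (induction w)
  case Nil
  then show ?case by (simp add: inv_word_def pres_eq.refl)
next
  case (Cons l w)
  obtain x b where l: "l = (x, b)" by force
  have w: "x \<in> X" "w \<in> words X" using Cons.prems l by auto
  have "pres_eq X R (inv_word w @ [(x, \<not> b), (x, \<not> \<not> b)] @ w) (inv_word w @ w)"
    using w by (intro pres_eq.cancel) auto
  then show ?case using Cons.IH w l by (auto simp: inv_word_def intro: pres_eq.trans)
qed

lemma word_class_eq_iff:
  assumes "R \<subseteq> words X" "u \<in> words X" "v \<in> words X"
  shows "word_class X R u = word_class X R v \<longleftrightarrow> pres_eq X R u v"
  using assms unfolding word_class_def
  by (auto intro: pres_eq.intros)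

lemma mult_word_class:
  assumes "R \<subseteq> words X" "u \<in> words X" "v \<in> words X"
  shows "word_class X R u \<otimes>\<^bsub>presented_group X R\<^esub> word_class X R v = word_class X R (u @ v)"
proof -
  have eq: "word_class X R (u' @ v') = word_class X R (u @ v)"
    if "u' \<in> word_class X R u" "v' \<in> word_class X R v" for u' v'
  proof -
    have "pres_eq X R (u @ v) (u' @ v')"
      using that assms(1) by (auto simp: word_class_def intro: pres_eq_append)
    then show ?thesis
      using word_class_eq_iff[OF assms(1)] pres_eq_words[OF assms(1)] by metis
  qed
  have ne: "u \<in> word_class X R u" "v \<in> word_class X R v"
    using assms by (auto simp: word_class_def intro: pres_eq.refl)
  have "word_class X R u \<otimes>\<^bsub>presented_group X R\<^esub> word_class X R v
      = (\<Union>u'\<in>word_class X R u. \<Union>v'\<in>word_class X R v. word_class X R (u @ v))"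
    using eq by (simp add: presented_group_def)
  also have "\<dots> = word_class X R (u @ v)"
    using ne by auto
  finally show ?thesis .
qed

lemma group_presented_group:
  assumes "R \<subseteq> words X"
  shows "group (presented_group X R)"
proof (rule groupI)
  let ?G = "presented_group X R"
  have carr: "carrier ?G = word_class X R ` words X" and one: "\<one>\<^bsub>?G\<^esub> = word_class X R []"
    by (auto simp: presented_group_def)
  show "\<one>\<^bsub>?G\<^esub> \<in> carrier ?G" by (auto simp: carr one)
  show "x \<otimes>\<^bsub>?G\<^esub> y \<in> carrier ?G" if "x \<in> carrier ?G" "y \<in> carrier ?G" for x y
    using that by (auto simp: carr mult_word_class[OF assms])
  show "x \<otimes>\<^bsub>?G\<^esub> y \<otimes>\<^bsub>?G\<^esub> z = x \<otimes>\<^bsub>?G\<^esub> (y \<otimes>\<^bsub>?G\<^esub> z)"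
    if "x \<in> carrier ?G" "y \<in> carrier ?G" "z \<in> carrier ?G" for x y z
    using that by (auto simp: carr mult_word_class[OF assms])
  show "\<one>\<^bsub>?G\<^esub> \<otimes>\<^bsub>?G\<^esub> x = x" if "x \<in> carrier ?G" for x
    using that by (auto simp: carr one mult_word_class[OF assms])
  show "\<exists>y\<in>carrier ?G. y \<otimes>\<^bsub>?G\<^esub> x = \<one>\<^bsub>?G\<^esub>" if "x \<in> carrier ?G" for x
  proof -
    from that obtain w where w: "w \<in> words X" "x = word_class X R w" by (auto simp: carr)
    have "word_class X R (inv_word w) \<otimes>\<^bsub>?G\<^esub> x = \<one>\<^bsub>?G\<^esub>"
      using w assms pres_eq_inv_word[of w X R]
      by (simp add: mult_word_class one word_class_eq_iff)
    then show ?thesis using w by (auto simp: carr)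
  qed
qed

text \<open>
  The elements \<open>\<phi>1 a\<close> and \<open>\<phi>2 a\<close> of the two presented groups are classes of words. The equation
  \<open>\<phi>1 a = \<phi>2 a\<close> is imposed for all their representatives, which avoids a choice; modulo
  \<open>R1\<close> and \<open>R2\<close> it is the same as imposing it for one pair of representatives.
\<close>

definition amalgam_relators ::
  "'a set \<Rightarrow> ('a \<Rightarrow> 'x word set) \<Rightarrow> ('a \<Rightarrow> 'x word set) \<Rightarrow> 'x word set" where
  "amalgam_relators Y \<phi>1 \<phi>2 = {u @ inv_word v | a u v. a \<in> Y \<and> u \<in> \<phi>1 a \<and> v \<in> \<phi>2 a}"

text \<open>
  \<open>AG\<close> is the image of the amalgamated subgroup in \<open>G\<close>. The empty decomposition is allowed, so the
  empty word is normal.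
\<close>

definition normal_word ::
  "'x set \<Rightarrow> 'x set \<Rightarrow> 'x word set \<Rightarrow> 'x word set set \<Rightarrow> 'x word \<Rightarrow> bool" where
  "normal_word X1 X2 R AG w \<longleftrightarrow>
     (\<exists>gs. w = concat gs \<and>
        (\<forall>g\<in>set gs. (g \<in> words X1 \<or> g \<in> words X2) \<and>
           word_class (X1 \<union> X2) R g \<noteq> \<one>\<^bsub>presented_group (X1 \<union> X2) R\<^esub>) \<and>
        (\<forall>j. Suc j < length gs \<longrightarrow>
           gs ! j \<in> words X1 \<and> gs ! Suc j \<in> words X2 \<or>
           gs ! j \<in> words X2 \<and> gs ! Suc j \<in> words X1) \<and>
        (length gs \<noteq> 1 \<longrightarrow> (\<forall>g\<in>set gs. word_class (X1 \<union> X2) R g \<notin> AG)))"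

definition encode_word :: "('x \<Rightarrow> nat) \<Rightarrow> 'x word \<Rightarrow> nat" where
  "encode_word c w = list_encode (map (\<lambda>(x, b). prod_encode (c x, of_bool b)) w)"

definition encode_words :: "('x \<Rightarrow> nat) \<Rightarrow> 'x word list \<Rightarrow> nat" where
  "encode_words c ws = list_encode (map (encode_word c) ws)"

end

theory Submission
  imports Defs "HOL-Algebra.Multiplicative_Group"
begin

text \<open>
  Let $H$ be the subgroup generated by $h_1,\ldots,h_k$. Two facts about an amalgam $G$ of finite groups,
  both with explicit bounds, turn the problem into a terminating search.

  Membership. If $v \notin H$, a finite permutation action of $G$ has a point that is fixed by all $h_i$ and
  moved by $v$ (\<open>finite_separation\<close>). To find one, take the finite set $V$ of all cosets $Hpg$
  where $p$ is a prefix of $v$ or of some $h_i$ and $g$ lies in one of the factors. Each factor acts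
  on part of $V$ only. The partial actions become total after passing to $V \times F$, where $F$ is
  a finite $G$-set on which $A$ acts freely and whose size both factor orders divide: a free finite
  $A$-set whose size is divisible by the order of a factor is, as an $A$-set, a disjoint union of
  copies of that factor (\<open>extend_free_action\<close>). The subset $\{H\} \times F$ is then fixed by the
  $h_i$ and moved by $v$. The size of the action is bounded in terms of the input, so $v \in H$ holds
  if and only if no permutation table below a computable bound separates $v$ from $H$
  (\<open>power_member_iff\<close>). The case $H = 1$ is the word problem.

  Bounding the exponent. If some nontrivial power of $g$ lies in $H$, then one does whose exponent is
  below a computable bound (\<open>least_power_bound\<close>). When $g$ is conjugate into a factor, $g$ has
  finite order and the bound is clear. Otherwise $g = u c u^{-1}$ with $c$ cyclically reduced. If
  $u c^n u^{-1} \in H$, then writing this element in the generators of $H$ gives a path in the Cayley graph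
  from $u$ to $u c^n$ that stays in finitely many cosets $Hq$. By the tree structure of the amalgam this path
  has to pass through $u c^k A$ for all $k < n$ (\<open>power_in_path_hull\<close>), and the pigeonhole
  principle bounds the least such $n$. The tree structure enters through the normal form theorem: an
  alternating product of elements of the factors outside $A$ is nontrivial, proved by letting $G$ act
  on normal forms (\<open>fold_\<Omega>_red\<close>).

  All searches are bounded, so the procedure is a composition of functions that are easily seen to be
  recursive.
\<close>

section \<open>Computable functions\<close>

text \<open>
  Arguments are read from an environment \<open>nat \<Rightarrow> nat\<close>, whose first \<open>k\<close> values form the input
  tuple. With environments, composition and shifting of variables are function application, so that
  the closure properties below work as introduction rules.
\<close>

definition computable :: "nat \<Rightarrow> ((nat \<Rightarrow> nat) \<Rightarrow> nat) \<Rightarrow> bool" where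
  "computable k f \<longleftrightarrow> (\<exists>p. \<forall>e. evals p (map e [0..<k]) (f e))"

lemma computable_proj: "i < k \<Longrightarrow> computable k (\<lambda>e. e i)"
  unfolding computable_def
proof (intro exI allI)
  fix e :: "nat \<Rightarrow> nat"
  assume "i < k"
  then show "evals (Proj i) (map e [0..<k]) (e i)"
    using evals.proj[of i "map e [0..<k]"] by simp
qed

lemma computable_subst:
  assumes "computable m f" and "\<And>j. j < m \<Longrightarrow> computable k (g j)"
  shows "computable k (\<lambda>e. f (\<lambda>j. g j e))"
proof -
  obtain p where p: "\<And>e. evals p (map e [0..<m]) (f e)"
    using assms(1) unfolding computable_def by blast
  have "\<exists>q. \<forall>j<m. \<forall>e. evals (q j) (map e [0..<k]) (g j e)"
    using assms(2) unfolding computable_def by metis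
  then obtain q where q: "\<And>j e. j < m \<Longrightarrow> evals (q j) (map e [0..<k]) (g j e)" by blast
  have "evals (Comp p (map q [0..<m])) (map e [0..<k]) (f (\<lambda>j. g j e))" for e
    by (rule evals.comp[OF _ p]) (auto simp: list_all2_conv_all_nth q)
  then show ?thesis unfolding computable_def by blast
qed

lemma computable_1:
  assumes "computable 1 (\<lambda>e. F (e 0))" "computable k f"
  shows "computable k (\<lambda>e. F (f e))"
  using computable_subst[OF assms(1), of k "\<lambda>_. f"] assms(2) by simp

lemma computable_2:
  assumes "computable 2 (\<lambda>e. F (e 0) (e 1))" "computable k f" "computable k g"
  shows "computable k (\<lambda>e. F (f e) (g e))"
  using computable_subst[OF assms(1), of k "\<lambda>j. if j = 0 then f else g"] assms(2,3) by simp

lemma computable_3: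
  assumes "computable 3 (\<lambda>e. F (e 0) (e 1) (e 2))" "computable k f" "computable k g" "computable k h"
  shows "computable k (\<lambda>e. F (f e) (g e) (h e))"
  using computable_subst[OF assms(1), of k "\<lambda>j. if j = 0 then f else if j = 1 then g else h"] assms(2-)
  by simp

lemma computable_Suc: "computable k f \<Longrightarrow> computable k (\<lambda>e. Suc (f e))"
proof (rule computable_1[of Suc])
  show "computable 1 (\<lambda>e. Suc (e 0))"
    unfolding computable_def by (intro exI[of _ Succ]) (auto intro: evals.succ)
qed

lemma computable_const: "computable k (\<lambda>e. n)"
proof (induction n)
  case 0
  show ?case unfolding computable_def by (blast intro: evals.zero)
next
  case (Suc n)
  then show ?case by (rule computable_Suc)
qed

text \<open>
  \<^const>\<open>PrimRec\<close> calls its step program on the counter, the accumulator and then the parameters,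
  whence the shift of the environment by two.
\<close>

lemma computable_rec:
  assumes "computable k a" "computable k c"
    and "computable (Suc (Suc k)) (\<lambda>e. b (e 0) (e 1) (\<lambda>i. e (i + 2)))"
  shows "computable k (\<lambda>e. rec_nat (a e) (\<lambda>i y. b i y e) (c e))"
proof -
  obtain p where p: "\<And>e. evals p (map e [0..<k]) (a e)"
    using assms(1) unfolding computable_def by blast
  obtain q where q: "\<And>e. evals q (map e [0..<Suc (Suc k)]) (b (e 0) (e 1) (\<lambda>i. e (i + 2)))"
    using assms(3) unfolding computable_def by blast
  have q': "evals q (i # y # map e [0..<k]) (b i y e)" for i y e
    using q[of "case_nat i (case_nat y e)"]
    by (simp add: upt_conv_Cons map_Suc_upt[symmetric] comp_def del: upt_Suc)
  have *: "evals (PrimRec p q) (n # map e [0..<k]) (rec_nat (a e) (\<lambda>i y. b i y e) n)" for n e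
    by (induction n) (auto intro: evals.prim_rec_0 evals.prim_rec_Suc p q')
  have "computable (Suc k) (\<lambda>e. rec_nat (a (\<lambda>i. e (Suc i))) (\<lambda>i y. b i y (\<lambda>i. e (Suc i))) (e 0))"
    unfolding computable_def
  proof (intro exI allI)
    fix e
    show "evals (PrimRec p q) (map e [0..<Suc k])
        (rec_nat (a (\<lambda>i. e (Suc i))) (\<lambda>i y. b i y (\<lambda>i. e (Suc i))) (e 0))"
      using *[of "e 0" "\<lambda>i. e (Suc i)"]
      by (simp add: upt_conv_Cons map_Suc_upt[symmetric] comp_def del: upt_Suc)
  qed
  from computable_subst[OF this, of k "case_nat c (\<lambda>i e. e i)"] show ?thesis
    using assms(2) by (auto simp: computable_proj split: nat.splits)
qed

lemma computable_Least:
  assumes "computable (Suc k) (\<lambda>e. f (e 0) (\<lambda>i. e (Suc i)))" and "\<And>e. \<exists>n. f n e = 0"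
  shows "computable k (\<lambda>e. LEAST n. f n e = 0)"
proof -
  obtain p where p: "\<And>e. evals p (map e [0..<Suc k]) (f (e 0) (\<lambda>i. e (Suc i)))"
    using assms(1) unfolding computable_def by blast
  have p': "evals p (n # map e [0..<k]) (f n e)" for n e
    using p[of "case_nat n e"]
    by (simp add: upt_conv_Cons map_Suc_upt[symmetric] comp_def del: upt_Suc)
  have "evals (Mu p) (map e [0..<k]) (LEAST n. f n e = 0)" for e
  proof (rule evals.mu)
    show "evals p ((LEAST n. f n e = 0) # map e [0..<k]) 0"
      using p'[of "LEAST n. f n e = 0" e] LeastI_ex[OF assms(2)[of e]] by simp
    fix m assume "m < (LEAST n. f n e = 0)"
    then have "f m e \<noteq> 0" by (rule not_less_Least)
    then show "\<exists>y. evals p (m # map e [0..<k]) (Suc y)"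
      using p'[of m e] not0_implies_Suc by metis
  qed
  then show ?thesis unfolding computable_def by blast
qed

lemma computable_add: "computable k f \<Longrightarrow> computable k g \<Longrightarrow> computable k (\<lambda>e. f e + g e)"
proof -
  assume *: "computable k f" "computable k g"
  have "rec_nat a (\<lambda>i y. Suc y) n = a + n" for a n by (induction n) auto
  then show ?thesis
    using computable_rec[OF *, of "\<lambda>i y e. Suc y"] by (simp add: computable_Suc computable_proj)
qed

lemma computable_mult: "computable k f \<Longrightarrow> computable k g \<Longrightarrow> computable k (\<lambda>e. f e * g e)"
proof (rule computable_2[of "(*)"])
  have "rec_nat 0 (\<lambda>i y. y + a) n = a * n" for a n :: nat by (induction n) auto
  then show "computable 2 (\<lambda>e. e 0 * e 1)"
    using computable_rec[of 2 "\<lambda>_. 0" "\<lambda>e. e 1" "\<lambda>i y e. y + e 0"]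
    by (simp add: computable_add computable_proj computable_const)
qed

lemma computable_diff: "computable k f \<Longrightarrow> computable k g \<Longrightarrow> computable k (\<lambda>e. f e - g e)"
proof (rule computable_2[of "(-)"])
  have pred: "rec_nat 0 (\<lambda>i y. i) n = n - 1" for n :: nat by (cases n) auto
  have "computable 1 (\<lambda>e. e 0 - 1)"
    using computable_rec[of 1 "\<lambda>_. 0" "\<lambda>e. e 0" "\<lambda>i y e. i"] pred
    by (simp add: computable_proj computable_const)
  from computable_1[OF this, of 4 "\<lambda>e. e 1"]
  have step: "computable 4 (\<lambda>e. e 1 - 1)" by (simp add: computable_proj)
  have "rec_nat a (\<lambda>i y. y - 1) n = a - n" for a n :: nat by (induction n) auto
  then show "computable 2 (\<lambda>e. e 0 - e 1)"
    using computable_rec[of 2 "\<lambda>e. e 0" "\<lambda>e. e 1" "\<lambda>i y e. y - 1"] step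
    by (simp add: computable_proj eval_nat_numeral)
qed

lemma computable_power2: "computable k f \<Longrightarrow> computable k (\<lambda>e. 2 ^ f e)"
proof -
  assume *: "computable k f"
  have "rec_nat 1 (\<lambda>i y. 2 * y) n = (2::nat) ^ n" for n by (induction n) auto
  then show ?thesis
    using computable_rec[OF computable_const *, of "\<lambda>i y e. 2 * y" 1]
    by (simp add: computable_mult computable_const computable_proj)
qed

definition decidable :: "nat \<Rightarrow> ((nat \<Rightarrow> nat) \<Rightarrow> bool) \<Rightarrow> bool" where
  "decidable k P \<longleftrightarrow> computable k (\<lambda>e. of_bool (P e))"

lemma decidable_not: "decidable k P \<Longrightarrow> decidable k (\<lambda>e. \<not> P e)"
proof -
  assume "decidable k P"
  then have "computable k (\<lambda>e. 1 - of_bool (P e))"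
    unfolding decidable_def by (intro computable_diff computable_const)
  moreover have "(\<lambda>e. 1 - of_bool (P e)) = (\<lambda>e. of_bool (\<not> P e) :: nat)" by auto
  ultimately show ?thesis unfolding decidable_def by simp
qed

lemma decidable_conj: "decidable k P \<Longrightarrow> decidable k Q \<Longrightarrow> decidable k (\<lambda>e. P e \<and> Q e)"
proof -
  assume "decidable k P" "decidable k Q"
  then have "computable k (\<lambda>e. of_bool (P e) * of_bool (Q e))"
    unfolding decidable_def by (intro computable_mult)
  moreover have "(\<lambda>e. of_bool (P e) * of_bool (Q e)) = (\<lambda>e. of_bool (P e \<and> Q e) :: nat)" by auto
  ultimately show ?thesis unfolding decidable_def by simp
qed

lemma decidable_disj: "decidable k P \<Longrightarrow> decidable k Q \<Longrightarrow> decidable k (\<lambda>e. P e \<or> Q e)"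
  using decidable_not[OF decidable_conj[OF decidable_not decidable_not], of k P Q] by simp

lemma decidable_le:
  assumes "computable k f" "computable k g"
  shows "decidable k (\<lambda>e. f e \<le> g e)"
proof -
  have "computable k (\<lambda>e. 1 - (f e - g e))"
    using assms by (intro computable_diff computable_const)
  moreover have "(\<lambda>e. 1 - (f e - g e)) = (\<lambda>e. of_bool (f e \<le> g e))"
    by (auto simp: fun_eq_iff)
  ultimately show ?thesis unfolding decidable_def by simp
qed

lemma decidable_eq:
  assumes "computable k f" "computable k g"
  shows "decidable k (\<lambda>e. f e = g e)"
  using decidable_conj[OF decidable_le[OF assms] decidable_le[OF assms(2,1)]]
  by (simp add: eq_iff)

lemma computable_if:
  assumes "decidable k P" "computable k f" "computable k g"
  shows "computable k (\<lambda>e. if P e then f e else g e)"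
proof -
  have "computable k (\<lambda>e. of_bool (P e) * f e + of_bool (\<not> P e) * g e)"
    using assms decidable_not[OF assms(1)] unfolding decidable_def
    by (intro computable_add computable_mult)
  moreover have "(\<lambda>e. of_bool (P e) * f e + of_bool (\<not> P e) * g e) = (\<lambda>e. if P e then f e else g e)"
    by (auto simp: fun_eq_iff)
  ultimately show ?thesis by simp
qed

lemma decidable_ball_le:
  assumes "decidable (Suc k) (\<lambda>e. P (e 0) (\<lambda>i. e (Suc i)))" "computable k c"
  shows "decidable k (\<lambda>e. \<forall>i\<le>c e. P i e)"
proof -
  have "rec_nat 1 (\<lambda>i y. y * of_bool (P i e)) n = (of_bool (\<forall>i<n. P i e) :: nat)" for n e
    by (induction n) (auto simp: All_less_Suc)
  from this[of _ "Suc n" for n] have eq: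
    "rec_nat 1 (\<lambda>i y. y * of_bool (P i e)) (Suc n) = (of_bool (\<forall>i\<le>n. P i e) :: nat)" for n e
    by (simp only: less_Suc_eq_le)
  have "computable (Suc (Suc k)) (\<lambda>e. of_bool (P (e 0) (\<lambda>i. e (i + 2))))"
    using computable_subst[OF assms(1)[unfolded decidable_def],
        of "Suc (Suc k)" "case_nat (\<lambda>e. e 0) (\<lambda>i e. e (i + 2))"]
    by (auto simp: computable_proj split: nat.splits)
  then have "computable k (\<lambda>e. rec_nat 1 (\<lambda>i y. y * of_bool (P i e)) (Suc (c e)))"
    using assms(2)
    by (intro computable_rec computable_mult computable_const computable_Suc) (auto intro: computable_proj)
  then show ?thesis unfolding decidable_def eq .
qed

lemma decidable_ball_finite:
  assumes "finite I" "\<And>i. i \<in> I \<Longrightarrow> decidable k (P i)"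
  shows "decidable k (\<lambda>e. \<forall>i\<in>I. P i e)"
  using assms
proof (induction I)
  case empty
  show ?case using computable_const[of k 1] by (simp add: decidable_def)
next
  case (insert i I)
  then show ?case using decidable_conj[of k "P i" "\<lambda>e. \<forall>i\<in>I. P i e"] by simp
qed

lemmas computable_intros =
  computable_proj computable_const computable_Suc computable_add computable_mult computable_diff
  computable_power2 computable_if decidable_not decidable_conj decidable_disj decidable_le decidable_eq

section \<open>Coded lists and transition tables\<close>

lemma computable_triangle: "computable k f \<Longrightarrow> computable k (\<lambda>e. triangle (f e))"
proof -
  assume *: "computable k f"
  have "rec_nat 0 (\<lambda>i y. y + Suc i) n = triangle n" for n by (induction n) auto
  then show ?thesis
    using computable_rec[OF computable_const *, of "\<lambda>i y e. y + Suc i" 0]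
    by (simp add: computable_intros del: add_Suc_right)
qed

lemma computable_prod_encode:
  "computable k f \<Longrightarrow> computable k g \<Longrightarrow> computable k (\<lambda>e. prod_encode (f e, g e))"
  unfolding prod_encode_def by (simp add: computable_intros computable_triangle)

lemma triangle_mono: "m \<le> n \<Longrightarrow> triangle m \<le> triangle n"
  unfolding triangle_def by (intro div_le_mono mult_le_mono) auto

lemma prod_encode_mono: "a \<le> a' \<Longrightarrow> b \<le> b' \<Longrightarrow> prod_encode (a, b) \<le> prod_encode (a', b')"
  unfolding prod_encode_def by (auto intro!: add_mono triangle_mono)

text \<open>
  The number of the anti-diagonal of the pairing function on which \<open>z\<close> lies. The subtraction is
  truncated and vanishes when \<open>z\<close> comes before the next diagonal.
\<close>

definition diagonal :: "nat \<Rightarrow> nat" where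
  "diagonal z = (LEAST k. Suc z - triangle (Suc k) = 0)"

lemma diagonal_prod_encode: "diagonal (prod_encode (a, b)) = a + b"
  unfolding diagonal_def
proof (rule Least_equality)
  show "Suc (prod_encode (a, b)) - triangle (Suc (a + b)) = 0"
    by (simp add: prod_encode_def)
  fix k assume k: "Suc (prod_encode (a, b)) - triangle (Suc k) = 0"
  show "a + b \<le> k"
  proof (rule ccontr)
    assume "\<not> a + b \<le> k"
    then have "triangle (Suc k) \<le> triangle (a + b)" by (intro triangle_mono) simp
    with k show False by (simp add: prod_encode_def)
  qed
qed

lemma prod_decode_diagonal:
  "prod_decode z = (z - triangle (diagonal z), diagonal z - (z - triangle (diagonal z)))"
proof -
  obtain a b where z: "z = prod_encode (a, b)" using prod_decode_inverse[of z] by (metis surj_pair)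
  then have "diagonal z = a + b" "z = triangle (a + b) + a" "prod_decode z = (a, b)"
    by (simp_all add: diagonal_prod_encode, simp add: prod_encode_def)
  then show ?thesis by simp
qed

lemma computable_diagonal: "computable 1 (\<lambda>e. diagonal (e 0))"
  unfolding diagonal_def
proof (rule computable_Least)
  show "computable (Suc 1) (\<lambda>e. Suc (e (Suc 0)) - triangle (Suc (e 0)))"
    by (intro computable_intros computable_triangle) auto
  fix e :: "nat \<Rightarrow> nat"
  show "\<exists>n. Suc (e 0) - triangle (Suc n) = 0" by (rule exI[of _ "e 0"]) simp
qed

lemma computable_prod_decode:
  assumes "computable k f"
  shows "computable k (\<lambda>e. fst (prod_decode (f e)))" "computable k (\<lambda>e. snd (prod_decode (f e)))"
  unfolding prod_decode_diagonal fst_conv snd_conv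
  by (intro computable_intros computable_triangle computable_1[OF computable_diagonal] assms)+

text \<open>
  The number \<open>0\<close> codes the empty list, and head and tail of it are \<open>0\<close> again; reading an entry
  beyond the end of a list therefore gives \<open>0\<close>.
\<close>

definition code_hd :: "nat \<Rightarrow> nat" where "code_hd t = fst (prod_decode (t - 1))"
definition code_tl :: "nat \<Rightarrow> nat" where "code_tl t = snd (prod_decode (t - 1))"
definition code_drop :: "nat \<Rightarrow> nat \<Rightarrow> nat" where "code_drop i t = (code_tl ^^ i) t"
definition code_nth :: "nat \<Rightarrow> nat \<Rightarrow> nat" where "code_nth t i = code_hd (code_drop i t)"

lemma rec_nat_funpow: "rec_nat x (\<lambda>_. f) n = (f ^^ n) x"
  by (induction n) auto

lemma computable_code_hd: "computable k f \<Longrightarrow> computable k (\<lambda>e. code_hd (f e))"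
  unfolding code_hd_def by (intro computable_prod_decode computable_intros)

lemma computable_code_tl: "computable k f \<Longrightarrow> computable k (\<lambda>e. code_tl (f e))"
  unfolding code_tl_def by (intro computable_prod_decode computable_intros)

lemma computable_code_drop:
  "computable k f \<Longrightarrow> computable k g \<Longrightarrow> computable k (\<lambda>e. code_drop (f e) (g e))"
  unfolding code_drop_def rec_nat_funpow[symmetric]
  by (intro computable_rec computable_code_tl computable_intros) auto

lemma computable_code_nth:
  "computable k f \<Longrightarrow> computable k g \<Longrightarrow> computable k (\<lambda>e. code_nth (f e) (g e))"
  unfolding code_nth_def by (intro computable_code_hd computable_code_drop)

lemma code_tl_0: "code_tl 0 = 0"
  using prod_encode_inverse[of "(0, 0)"] by (simp add: code_tl_def prod_encode_def)

lemma code_hd_0: "code_hd 0 = 0"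
  using prod_encode_inverse[of "(0, 0)"] by (simp add: code_hd_def prod_encode_def)

lemma code_drop_list_encode: "code_drop i (list_encode xs) = list_encode (drop i xs)"
proof (induction i arbitrary: xs)
  case 0
  show ?case by (simp add: code_drop_def)
next
  case (Suc i)
  have "code_tl (list_encode xs) = list_encode (tl xs)"
    by (cases xs) (simp_all add: code_tl_0, simp add: code_tl_def)
  then show ?case
    using Suc[of "tl xs"] by (simp add: code_drop_def funpow_Suc_right drop_Suc del: funpow.simps)
qed

lemma list_encode_0_iff: "list_encode xs = 0 \<longleftrightarrow> xs = []"
  by (cases xs) auto

lemma code_hd_list_encode: "xs \<noteq> [] \<Longrightarrow> code_hd (list_encode xs) = hd xs"
  by (cases xs) (simp_all add: code_hd_def)

lemma code_nth_list_encode: "code_nth (list_encode xs) i = (if i < length xs then xs ! i else 0)"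
proof (cases "i < length xs")
  case True
  then show ?thesis
    by (simp add: code_nth_def code_drop_list_encode code_hd_list_encode hd_drop_conv_nth)
next
  case False
  then show ?thesis by (simp add: code_nth_def code_drop_list_encode code_hd_0)
qed

lemma length_le_list_encode: "length xs \<le> list_encode xs"
proof (induction xs)
  case (Cons x xs)
  then show ?case using le_prod_encode_2[of "list_encode xs" x] by simp
qed simp

lemma code_nth_beyond: "z \<le> i \<Longrightarrow> code_nth z i = 0"
  using code_nth_list_encode[of "list_decode z" i] length_le_list_encode[of "list_decode z"] by simp

text \<open>
  A number \<open>z\<close> is read as a transition table: its entry at the pair of a letter and a state is the
  successor of the new state. The entry \<open>0\<close>, which is also what is read beyond the end, leaves
  the state unchanged. So every number describes total functions, all of them the identity from \<open>z\<close> on,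
  and laws about all states need to be tested only on states up to \<open>z\<close>.
\<close>

definition table_step :: "nat \<Rightarrow> nat \<Rightarrow> nat \<Rightarrow> nat" where
  "table_step z l w =
     (if code_nth z (prod_encode (l, w)) = 0 then w else code_nth z (prod_encode (l, w)) - 1)"

text \<open>
  The number \<open>t\<close> codes a word. It bounds the length of the word, and rounds after the end of the word
  do nothing.
\<close>

definition table_run :: "nat \<Rightarrow> nat \<Rightarrow> nat \<Rightarrow> nat" where
  "table_run z t w =
     rec_nat w (\<lambda>i y. if code_drop i t = 0 then y else table_step z (code_hd (code_drop i t)) y) t"

lemma computable_table_step:
  "computable k f \<Longrightarrow> computable k g \<Longrightarrow> computable k h \<Longrightarrow> computable k (\<lambda>e. table_step (f e) (g e) (h e))"
  unfolding table_step_def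
  by (intro computable_intros computable_code_nth computable_prod_encode)

lemma computable_table_run:
  assumes "computable k f" "computable k g" "computable k h"
  shows "computable k (\<lambda>e. table_run (f e) (g e) (h e))"
proof (rule computable_3[OF _ assms])
  show "computable 3 (\<lambda>e. table_run (e 0) (e 1) (e 2))"
    unfolding table_run_def
    by (intro computable_rec computable_intros computable_code_hd computable_code_drop
        computable_table_step) simp_all
qed

lemma table_run_list_encode: "table_run z (list_encode ls) w = fold (table_step z) ls w"
proof -
  have "rec_nat w (\<lambda>i y. if code_drop i (list_encode ls) = 0 then y
      else table_step z (code_hd (code_drop i (list_encode ls))) y) n
    = fold (table_step z) (take n ls) w" for n
  proof (induction n)
    case (Suc n)
    then show ?case
      by (cases "n < length ls")
        (simp_all add: code_drop_list_encode list_encode_0_iff code_hd_list_encode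
          hd_drop_conv_nth take_Suc_conv_app_nth)
  qed simp
  then show ?thesis
    unfolding table_run_def using length_le_list_encode[of ls] by simp
qed

lemma table_step_beyond: "z \<le> w \<Longrightarrow> table_step z l w = w"
  using code_nth_beyond[of z "prod_encode (l, w)"] le_prod_encode_2[of w l]
  by (simp add: table_step_def)

text \<open>
  A certificate that the \<open>n\<close>-th power of the word coded by \<open>gc\<close> is not in the subgroup generated by
  the words listed in \<open>hc\<close>: the table describes an action of the group, because the pairs of inverse
  letters in \<open>L\<close> cancel and the relators in \<open>Rc\<close> act trivially, and in this action the state
  \<open>0\<close> is fixed by the generators and moved by the power. An index \<open>i\<close> beyond the length of the list
  reads \<open>0\<close>, the code of the empty word, which fixes everything.
\<close>

definition table_cert ::
  "(nat \<times> nat) set \<Rightarrow> nat set \<Rightarrow> nat \<Rightarrow> nat \<Rightarrow> nat \<Rightarrow> nat \<Rightarrow> bool" where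
  "table_cert L Rc z hc gc n \<longleftrightarrow>
     (\<forall>p\<in>L. \<forall>w\<le>z. table_step z (snd p) (table_step z (fst p) w) = w) \<and>
     (\<forall>r\<in>Rc. \<forall>w\<le>z. table_run z r w = w) \<and>
     (\<forall>i\<le>hc. table_run z (code_nth hc i) 0 = 0) \<and>
     (table_run z gc ^^ n) 0 \<noteq> 0"

lemma decidable_table_cert:
  assumes "finite L" "finite Rc"
  shows "decidable 4 (\<lambda>e. table_cert L Rc (e 0) (e 1) (e 2) (e 3))"
proof -
  have pow: "computable 4 (\<lambda>e. (table_run (e 0) (e 2) ^^ (e 3)) 0)"
    unfolding rec_nat_funpow[symmetric]
    by (intro computable_rec computable_table_run computable_intros) simp_all
  show ?thesis
    unfolding table_cert_def
    by (intro decidable_conj decidable_ball_finite decidable_ball_le decidable_eq decidable_not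
        computable_table_step computable_table_run computable_code_nth assms pow computable_intros) simp_all
qed

definition list_code_bound :: "nat \<Rightarrow> nat \<Rightarrow> nat" where
  "list_code_bound l m = list_encode (replicate l m)"

lemma list_encode_le_bound:
  assumes "length xs = l" "\<And>x. x \<in> set xs \<Longrightarrow> x \<le> m"
  shows "list_encode xs \<le> list_code_bound l m"
  using assms
proof (induction xs arbitrary: l)
  case (Cons x xs)
  then show ?case
    using prod_encode_mono[of x m "list_encode xs" "list_code_bound (length xs) m"]
    by (auto simp: list_code_bound_def)
qed simp

lemma computable_list_code_bound:
  assumes "computable k f" "computable k g"
  shows "computable k (\<lambda>e. list_code_bound (f e) (g e))"
proof (rule computable_2[OF _ assms])
  have "rec_nat 0 (\<lambda>i y. Suc (prod_encode (m, y))) l = list_code_bound l m" for l m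
    by (induction l) (simp_all add: list_code_bound_def)
  then show "computable 2 (\<lambda>e. list_code_bound (e 0) (e 1))"
    using computable_rec[of 2 "\<lambda>_. 0" "\<lambda>e. e 0" "\<lambda>i y e. Suc (prod_encode (e 1, y))"]
    by (simp add: computable_intros computable_prod_encode)
qed

section \<open>Reduced products of two subgroups\<close>

text \<open>
  The two factors are indexed by \<open>bool\<close>, so that each argument is made once for both.
\<close>

locale factor_pair = group G for G (structure) +
  fixes B :: "bool \<Rightarrow> 'a set"
  assumes subgroup_B: "subgroup (B i) G"
begin

lemma inv_mult_cancel [simp]:
  assumes "x \<in> carrier G" "y \<in> carrier G"
  shows "inv x \<otimes> (x \<otimes> y) = y" "x \<otimes> (inv x \<otimes> y) = y"
  using assms by (simp_all add: m_assoc[symmetric])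

lemma B_closed [simp]: "x \<in> B i \<Longrightarrow> x \<in> carrier G"
  using subgroup.subset[OF subgroup_B] by blast

lemma B_mult: "x \<in> B i \<Longrightarrow> y \<in> B i \<Longrightarrow> x \<otimes> y \<in> B i"
  by (rule subgroup.m_closed[OF subgroup_B])

lemma B_inv: "x \<in> B i \<Longrightarrow> inv x \<in> B i"
  by (rule subgroup.m_inv_closed[OF subgroup_B])

lemma B_one: "\<one> \<in> B i"
  by (rule subgroup.one_closed[OF subgroup_B])

lemma B_mult_right_iff: "x \<in> carrier G \<Longrightarrow> y \<in> B i \<Longrightarrow> x \<otimes> y \<in> B i \<longleftrightarrow> x \<in> B i"
proof
  assume *: "x \<in> carrier G" "y \<in> B i" "x \<otimes> y \<in> B i"
  have "x = (x \<otimes> y) \<otimes> inv y" using * by (simp add: m_assoc)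
  then show "x \<in> B i" using B_mult[OF *(3) B_inv[OF *(2)]] by simp
qed (simp add: B_mult)

lemma B_mult_left_iff: "x \<in> carrier G \<Longrightarrow> y \<in> B i \<Longrightarrow> y \<otimes> x \<in> B i \<longleftrightarrow> x \<in> B i"
proof
  assume *: "x \<in> carrier G" "y \<in> B i" "y \<otimes> x \<in> B i"
  have "x = inv y \<otimes> (y \<otimes> x)" using * by (simp add: m_assoc[symmetric])
  then show "x \<in> B i" using B_mult[OF B_inv[OF *(2)] *(3)] by simp
qed (simp add: B_mult)

lemma B_inv_iff: "x \<in> carrier G \<Longrightarrow> inv x \<in> B i \<longleftrightarrow> x \<in> B i"
  using B_inv[of x i] B_inv[of "inv x" i] by auto

definition common :: "'a set" where
  "common = B True \<inter> B False"

lemma common_closed [simp]: "x \<in> common \<Longrightarrow> x \<in> carrier G"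
  using B_closed by (auto simp: common_def)

lemma common_iff: "x \<in> common \<longleftrightarrow> x \<in> B i \<and> x \<in> B (\<not> i)"
  by (cases i) (auto simp: common_def)

text \<open>
  In \<open>red i j n x\<close> the element \<open>x\<close> is an alternating product of \<open>n\<close> factors, none of them in the
  intersection of the two subgroups, with first factor in \<open>B i\<close> and last factor in \<open>B j\<close>. The relation
  speaks about elements and not about factorizations because the latter are unique only up to elements of
  the intersection passing between neighbours.
\<close>

inductive red :: "bool \<Rightarrow> bool \<Rightarrow> nat \<Rightarrow> 'a \<Rightarrow> bool" where
  single: "g \<in> B i \<Longrightarrow> g \<notin> B (\<not> i) \<Longrightarrow> red i i 1 g"
| cons: "g \<in> B i \<Longrightarrow> g \<notin> B (\<not> i) \<Longrightarrow> red (\<not> i) j n x \<Longrightarrow> red i j (Suc n) (g \<otimes> x)"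

lemma red_closed: "red i j n x \<Longrightarrow> x \<in> carrier G"
  by (induction rule: red.induct) auto

lemma red_pos: "red i j n x \<Longrightarrow> 0 < n"
  by (induction rule: red.induct) auto

lemma red_append: "red i j n x \<Longrightarrow> red (\<not> j) k m y \<Longrightarrow> red i k (n + m) (x \<otimes> y)"
proof (induction rule: red.induct)
  case (single g i)
  then show ?case using red.cons by simp
next
  case (cons g i j n x)
  then have "red i k (Suc (n + m)) (g \<otimes> (x \<otimes> y))" by (intro red.cons)
  then show ?case using cons red_closed by (simp add: m_assoc)
qed

lemma red_snoc: "red i j n x \<Longrightarrow> g \<in> B (\<not> j) \<Longrightarrow> g \<notin> B j \<Longrightarrow> red i (\<not> j) (Suc n) (x \<otimes> g)"
  using red_append[of i j n x "\<not> j" 1 g] red.single[of g "\<not> j"] by simp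

lemma red_inv: "red i j n x \<Longrightarrow> red j i n (inv x)"
proof (induction rule: red.induct)
  case (single g i)
  then show ?case by (intro red.single) (simp_all add: B_inv_iff)
next
  case (cons g i j n x)
  have "red j i (Suc n) (inv x \<otimes> inv g)"
    using red_snoc[OF cons.IH, of "inv g"] cons.hyps by (simp add: B_inv_iff)
  then show ?case using cons red_closed by (simp add: inv_mult_group)
qed

lemma red_common_right: "red i j n x \<Longrightarrow> a \<in> common \<Longrightarrow> red i j n (x \<otimes> a)"
proof (induction rule: red.induct)
  case (single g i)
  then show ?case
    by (intro red.single) (simp_all add: common_iff[of _ i] B_mult_right_iff)
next
  case (cons g i j n x)
  then have "red i j (Suc n) (g \<otimes> (x \<otimes> a))" by (intro red.cons)
  moreover have "a \<in> carrier G" using cons.prems by (auto simp: common_def)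
  ultimately show ?case using cons red_closed by (simp add: m_assoc)
qed

lemma red_common_left: "red i j n x \<Longrightarrow> a \<in> common \<Longrightarrow> red i j n (a \<otimes> x)"
proof (induction rule: red.cases)
  case (single g i)
  then have "red i i 1 (a \<otimes> g)"
    by (intro red.single) (simp_all add: common_iff[of _ i] B_mult_left_iff)
  then show ?case using single by simp
next
  case (cons g i j n x)
  then have "red i j (Suc n) ((a \<otimes> g) \<otimes> x)"
    by (intro red.cons) (simp_all add: common_iff[of _ i] B_mult_left_iff)
  moreover have "a \<in> carrier G" using cons by (auto simp: common_def)
  ultimately show ?case using cons red_closed by (simp add: m_assoc)
qed

lemma red_last:
  "red i j n x \<Longrightarrow> (n = 1 \<and> i = j \<and> x \<in> B j \<and> x \<notin> B (\<not> j)) \<or>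
    (\<exists>y g m. n = Suc m \<and> red i (\<not> j) m y \<and> g \<in> B j \<and> g \<notin> B (\<not> j) \<and> x = y \<otimes> g)"
proof (induction rule: red.induct)
  case (single g i)
  then show ?case by simp
next
  case (cons g i j n x)
  from cons.IH show ?case
  proof (elim disjE conjE exE)
    assume "n = 1" "(\<not> i) = j" "x \<in> B j" "x \<notin> B (\<not> j)"
    moreover from this have "red i (\<not> j) 1 g" using red.single[of g i] cons.hyps by auto
    ultimately show ?thesis by auto
  next
    fix y g' m
    assume *: "n = Suc m" "red (\<not> i) (\<not> j) m y" "g' \<in> B j" "g' \<notin> B (\<not> j)" "x = y \<otimes> g'"
    have "red i (\<not> j) (Suc m) (g \<otimes> y)" using * cons.hyps by (intro red.cons)
    moreover have "g \<otimes> x = (g \<otimes> y) \<otimes> g'" using * cons.hyps red_closed by (simp add: m_assoc)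
    ultimately show ?thesis using * by blast
  qed
qed

text \<open>
  A factor on the right is absorbed into the last factor, cancels it, or becomes a new last factor; in each
  case the first factor stays on its side unless everything collapses into the intersection.
\<close>

lemma red_mult:
  assumes x: "red i j n x" and b: "b \<in> B k"
  shows "x \<otimes> b \<in> common \<or> (\<exists>j' n'. n' \<le> Suc n \<and> red i j' n' (x \<otimes> b))"
proof -
  consider "b \<in> common" | "b \<notin> common" "k = (\<not> j)" | "b \<notin> common" "k = j" by auto
  then show ?thesis
  proof cases
    case 1
    then have "red i j n (x \<otimes> b)" using red_common_right x by blast
    then show ?thesis using le_SucI by blast
  next
    case 2
    then have "red i (\<not> j) (Suc n) (x \<otimes> b)"
      using x b by (intro red_snoc) (auto simp: common_iff[of _ j])
    then show ?thesis by blast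
  next
    case 3
    from red_last[OF x] show ?thesis
    proof (elim disjE conjE exE)
      assume *: "n = 1" "i = j" "x \<in> B j" "x \<notin> B (\<not> j)"
      have "x \<otimes> b \<in> B i" using * b 3 B_mult by simp
      then have "x \<otimes> b \<in> common \<or> red i i 1 (x \<otimes> b)"
        by (auto intro: red.single[of _ i, simplified] simp: common_iff[of _ i])
      then show ?thesis using * by auto
    next
      fix y g m
      assume *: "n = Suc m" "red i (\<not> j) m y" "g \<in> B j" "g \<notin> B (\<not> j)" "x = y \<otimes> g"
      have gb: "g \<otimes> b \<in> B j" using * b 3 B_mult by simp
      have eq: "x \<otimes> b = y \<otimes> (g \<otimes> b)" using * b red_closed by (simp add: m_assoc)
      show ?thesis
      proof (cases "g \<otimes> b \<in> B (\<not> j)")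
        case True
        then have "red i (\<not> j) m (y \<otimes> (g \<otimes> b))"
          using gb * by (intro red_common_right) (auto simp: common_iff[of _ j])
        moreover have "m \<le> Suc n" using * by simp
        ultimately show ?thesis unfolding eq by blast
      next
        case False
        then have "red i j (Suc m) (y \<otimes> (g \<otimes> b))"
          using red_snoc[OF *(2), of "g \<otimes> b"] gb by simp
        moreover have "Suc m \<le> Suc n" using * by simp
        ultimately show ?thesis unfolding eq by blast
      qed
    qed
  qed
qed

inductive factor_prod :: "nat \<Rightarrow> 'a \<Rightarrow> bool" where
  one: "factor_prod 0 \<one>"
| snoc: "factor_prod l x \<Longrightarrow> b \<in> B k \<Longrightarrow> factor_prod (Suc l) (x \<otimes> b)"

lemma factor_prod_red:
  "factor_prod l x \<Longrightarrow> x \<in> common \<or> (\<exists>i j n. n \<le> l \<and> red i j n x)"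
proof (induction rule: factor_prod.induct)
  case one
  show ?case using B_one by (simp add: common_def)
next
  case (snoc l x b k)
  from snoc.IH show ?case
  proof (elim disjE exE conjE)
    assume x: "x \<in> common"
    have "x \<otimes> b \<in> B k" using x snoc by (intro B_mult) (auto simp: common_iff[of _ k])
    then have "x \<otimes> b \<in> common \<or> red k k 1 (x \<otimes> b)"
      by (auto intro: red.single[of _ k, simplified] simp: common_iff[of _ k])
    then show ?thesis by (metis One_nat_def Suc_le_mono zero_le)
  next
    fix i j n assume "n \<le> l" "red i j n x"
    then show ?thesis using red_mult[of i j n x b k] snoc by (meson Suc_le_mono le_trans)
  qed
qed

text \<open>
  Paths in the Cayley graph for \<open>B True \<union> B False\<close> that stay in \<open>K\<close>.
\<close>

inductive path :: "'a set \<Rightarrow> 'a \<Rightarrow> 'a \<Rightarrow> bool" for K where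
  refl: "x \<in> K \<Longrightarrow> path K x x"
| step: "path K x y \<Longrightarrow> z \<in> K \<Longrightarrow> inv y \<otimes> z \<in> B i \<Longrightarrow> path K x z"

lemma path_ends: "path K x y \<Longrightarrow> x \<in> K \<and> y \<in> K"
  by (induction rule: path.induct) auto

lemma path_mono: "path K x y \<Longrightarrow> K \<subseteq> K' \<Longrightarrow> path K' x y"
  by (induction rule: path.induct) (auto intro: path.intros)

lemma path_trans:
  assumes "path K x y" "path K y z"
  shows "path K x z"
  using assms(2,1) by (induction rule: path.induct) (auto intro: path.intros)

lemma path_sym: "path K x y \<Longrightarrow> K \<subseteq> carrier G \<Longrightarrow> path K y x"
proof (induction rule: path.induct)
  case (refl x)
  then show ?case by (intro path.refl)
next
  case (step x y z i)
  then have y: "y \<in> K" using path_ends by blast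
  have c: "y \<in> carrier G" "z \<in> carrier G" using y step by auto
  have "inv z \<otimes> y = inv (inv y \<otimes> z)" using c by (simp add: inv_mult_group)
  then have "inv z \<otimes> y \<in> B i" using step B_inv by simp
  then have "path K z y" using path.step[OF path.refl[OF step.hyps(2)] y] by blast
  then show ?case using step path_trans by blast
qed

lemma path_translate:
  assumes "g \<in> carrier G" "K \<subseteq> carrier G" "path K x y"
  shows "path ((\<lambda>k. g \<otimes> k) ` K) (g \<otimes> x) (g \<otimes> y)"
  using assms(3)
proof (induction rule: path.induct)
  case (refl x)
  then show ?case by (intro path.refl) auto
next
  case (step x y z i)
  then have c: "y \<in> carrier G" "z \<in> carrier G" using path_ends assms(2) by blast+
  then have "inv (g \<otimes> y) \<otimes> (g \<otimes> z) = inv y \<otimes> z"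
    using assms(1) by (simp add: inv_mult_group m_assoc)
  then show ?case using step by (auto intro: path.step)
qed

text \<open>
  If the first and the last factor come from the same subgroup, conjugation moves the last factor to the
  front, where it merges with the first one; the product gets shorter. This stops at a single factor or
  at a cyclically reduced product, whose first and last factors come from different subgroups. The set
  \<open>P\<close> collects the vertices of a path to the conjugating element, and its size enters the bound
  on the exponent.
\<close>

lemma conjugate_to_core:
  "red i j n x \<Longrightarrow> \<exists>u P. P \<subseteq> carrier G \<and> finite P \<and> card P \<le> Suc n \<and> path P \<one> u \<and>
     ((\<exists>k. inv u \<otimes> x \<otimes> u \<in> B k) \<or> (\<exists>k m. red k (\<not> k) m (inv u \<otimes> x \<otimes> u)))"
proof (induction n arbitrary: i j x rule: less_induct)
  case (less n)
  note x = less.prems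
  have xc: "x \<in> carrier G" using x red_closed by blast
  have triv: ?case if "(\<exists>k. x \<in> B k) \<or> (\<exists>k m. red k (\<not> k) m x)"
    using that xc by (intro exI[of _ \<one>] exI[of _ "{\<one>}"]) (auto intro: path.refl)
  show ?case
  proof (cases "i = j")
    case False
    then have "red i (\<not> i) n x" using x by (cases i; cases j) auto
    then show ?thesis using triv by blast
  next
    case ij: True
    from red_last[OF x] show ?thesis
    proof (elim disjE conjE exE)
      assume "x \<in> B j"
      then show ?thesis using triv by blast
    next
      fix y g m
      assume *: "n = Suc m" "red i (\<not> j) m y" "g \<in> B j" "g \<notin> B (\<not> j)" "x = y \<otimes> g"
      from *(2) show ?thesis
      proof (cases rule: red.cases)
        case single
        then show ?thesis using ij by auto
      next
        case (cons y1 n' y2)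
        have c: "g \<in> carrier G" "y1 \<in> carrier G" "y2 \<in> carrier G" "y \<in> carrier G"
          using * cons red_closed by auto
        define z where "z = g \<otimes> x \<otimes> inv g"
        have z: "z = (g \<otimes> y1) \<otimes> y2" using * cons c by (simp add: z_def m_assoc)
        have gy: "g \<otimes> y1 \<in> B i" using * cons ij B_mult by simp
        have step: "path {\<one>, inv g} \<one> (inv g)"
          using * c by (intro path.step[OF path.refl, of _ _ _ j]) (auto intro: B_inv)
        show ?thesis
        proof (cases "g \<otimes> y1 \<in> B (\<not> i)")
          case False
          then have "red i (\<not> j) m z" unfolding z using cons gy by (auto intro: red.cons)
          then have core: "red i (\<not> i) m (inv (inv g) \<otimes> x \<otimes> inv g)" using c ij by (simp add: z_def)
          have "card {\<one>, inv g} \<le> Suc n" using * cons by (simp add: card_insert_if)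
          with step core c show ?thesis
            by (intro exI[of _ "inv g"] exI[of _ "{\<one>, inv g}"]) auto
        next
          case True
          then have rz: "red (\<not> i) (\<not> j) n' z"
            unfolding z using cons gy red_common_left by (auto simp: common_iff[of _ i])
          have "n' < n" using * cons by simp
          from less.IH[OF this rz] obtain u P where u: "P \<subseteq> carrier G" "finite P" "card P \<le> Suc n'" "path P \<one> u"
            "(\<exists>k. inv u \<otimes> z \<otimes> u \<in> B k) \<or> (\<exists>k m. red k (\<not> k) m (inv u \<otimes> z \<otimes> u))"
            by (elim exE conjE) (rule that)
          have uc: "u \<in> carrier G" using u path_ends by blast
          define P' where "P' = insert \<one> ((\<lambda>k. inv g \<otimes> k) ` P)"
          have "path ((\<lambda>k. inv g \<otimes> k) ` P) (inv g \<otimes> \<one>) (inv g \<otimes> u)"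
            using u c by (intro path_translate) auto
          then have p1: "path P' (inv g) (inv g \<otimes> u)"
            using c by (auto simp: P'_def intro: path_mono)
          then have "inv g \<in> P'" using path_ends by blast
          then have "path P' \<one> (inv g)" using step by (auto simp: P'_def intro: path_mono)
          then have p: "path P' \<one> (inv g \<otimes> u)" using p1 path_trans by blast
          have "card P' \<le> Suc (card P)"
            unfolding P'_def using u(2) by (simp add: card_insert_if card_image_le le_SucI)
          then have "card P' \<le> Suc n" using u(3) \<open>n' < n\<close> by linarith
          moreover have "inv (inv g \<otimes> u) \<otimes> x \<otimes> (inv g \<otimes> u) = inv u \<otimes> z \<otimes> u"
            using c uc xc by (simp add: z_def inv_mult_group m_assoc)
          moreover have "P' \<subseteq> carrier G" "finite P'" using u c by (auto simp: P'_def)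
          ultimately show ?thesis using p u(5) by metis
        qed
      qed
    qed
  qed
qed

lemma red_power:
  assumes "red i (\<not> i) m c" "0 < (k::nat)"
  shows "\<exists>m'. red i (\<not> i) m' (c [^] k)"
  using assms(2)
proof (induction k)
  case (Suc k)
  show ?case
  proof (cases "k = 0")
    case True
    then show ?thesis using assms(1) red_closed by auto
  next
    case False
    then obtain m' where "red i (\<not> i) m' (c [^] k)" using Suc by auto
    then show ?thesis using red_append[OF _ , of i "\<not> i"] assms(1) by fastforce
  qed
qed simp

end

section \<open>Powers in subgroups of amalgams\<close>

text \<open>
  The added property is the normal form theorem. It says that the subgroup generated by the two factors
  is their free product with amalgamated intersection.
\<close>

locale free_factor_pair = factor_pair +
  assumes red_ne_one: "red i j n x \<Longrightarrow> x \<noteq> \<one>"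
begin

definition starts :: "bool \<Rightarrow> 'a \<Rightarrow> bool" where
  "starts i x \<longleftrightarrow> (\<exists>j n. red i j n x)"

text \<open>
  Two reduced products for the same element that start on different sides would combine, one of them
  inverted, to a reduced product for the neutral element.
\<close>

lemma starts_unique: "starts i x \<Longrightarrow> \<not> starts (\<not> i) x"
proof
  assume "starts i x" "starts (\<not> i) x"
  then obtain j n k m where x: "red i j n x" "red (\<not> i) k m x" by (auto simp: starts_def)
  have "red j k (n + m) (inv x \<otimes> x)" using red_append[OF red_inv[OF x(1)] x(2)] .
  then show False using red_ne_one x red_closed by fastforce
qed

text \<open>
  Elements that start in \<open>B True\<close> and elements that start in \<open>B False\<close> correspond to the two halves of
  the Bass-Serre tree on both sides of the edge given by \<^const>\<open>common\<close>. One step of a path does not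
  change the side unless it lands in \<^const>\<open>common\<close>.
\<close>

lemma path_separated:
  assumes "path K x y" "K \<subseteq> carrier G" "starts i x" "starts (\<not> i) y"
  shows "\<exists>a\<in>common. a \<in> K"
proof (rule ccontr)
  assume no: "\<not> ?thesis"
  have "starts i y" using assms(1,3)
  proof (induction rule: path.induct)
    case (step x y z k)
    have yz: "y \<in> carrier G" "z \<in> carrier G" using path_ends step.hyps assms(2) by blast+
    then have z: "z = y \<otimes> (inv y \<otimes> z)" by simp
    from step obtain j n where "red i j n y" by (auto simp: starts_def)
    from red_mult[OF this step.hyps(3)] have "z \<in> common \<or> starts i z"
      unfolding z[symmetric] starts_def by blast
    then show ?case using no step.hyps by blast
  qed
  then show False using starts_unique assms(4) by blast
qed

text \<open>
  Translate the path by \<open>inv (u \<otimes> c [^] k)\<close>. It now runs from a negative to a positive power of \<open>c\<close>.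
  As \<open>c\<close> is cyclically reduced, these start on different sides, so the translated path meets the
  intersection.
\<close>

lemma power_in_path_hull:
  assumes c: "red i (\<not> i) m c" and u: "u \<in> carrier G" and K: "K \<subseteq> carrier G"
    and p: "path K u (u \<otimes> c [^] (n::nat))" and k: "k < n"
  shows "\<exists>a\<in>common. u \<otimes> c [^] k \<otimes> a \<in> K"
proof (cases "k = 0")
  case True
  then show ?thesis
    using path_ends[OF p] u c red_closed B_one by (intro bexI[of _ \<one>]) (auto simp: common_def)
next
  case False
  have cc: "c \<in> carrier G" using c red_closed by blast
  define t where "t = inv (c [^] k) \<otimes> inv u"
  have t: "t \<in> carrier G" using cc u by (simp add: t_def)
  have "path ((\<lambda>x. t \<otimes> x) ` K) (t \<otimes> u) (t \<otimes> (u \<otimes> c [^] n))"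
    using path_translate[OF t K p] .
  moreover have "t \<otimes> u = inv (c [^] k)" using cc u by (simp add: t_def m_assoc)
  moreover have "c [^] n = c [^] k \<otimes> c [^] (n - k)" using cc k by (simp add: nat_pow_mult)
  then have "t \<otimes> (u \<otimes> c [^] n) = c [^] (n - k)"
    using cc u by (simp add: t_def m_assoc)
  moreover have "starts i (c [^] (n - k))"
    using red_power[OF c, of "n - k"] k by (auto simp: starts_def)
  moreover have "starts (\<not> i) (inv (c [^] k))"
    using red_power[OF c, of k] red_inv False by (fastforce simp: starts_def)
  moreover have "(\<lambda>x. t \<otimes> x) ` K \<subseteq> carrier G" using t K by auto
  ultimately obtain a where a: "a \<in> common" "a \<in> (\<lambda>x. t \<otimes> x) ` K"
    using path_separated[of _ _ _ "\<not> i"] by (metis (full_types))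
  then obtain x where x: "x \<in> K" "a = t \<otimes> x" by blast
  have "u \<otimes> c [^] k \<otimes> a = x"
    using x K cc u by (auto simp: t_def m_assoc subset_iff)
  then show ?thesis using a x by blast
qed

text \<open>
  Every \<open>u \<otimes> c [^] k\<close> with \<open>k < n\<close> lies in a coset \<open>H #> (q \<otimes> inv a)\<close> with \<open>q\<close> in \<open>Q\<close> and \<open>a\<close> in
  the intersection. If two exponents had the same pair \<open>(q, a)\<close>, the conjugated power of \<open>c\<close> for their
  difference would lie in \<open>H\<close>, against minimality.
\<close>

lemma hyperbolic_power_bound:
  assumes H: "subgroup H G" and Q: "finite Q" "Q \<subseteq> carrier G"
    and fin: "finite common"
    and c: "red i (\<not> i) m c" and u: "u \<in> carrier G"
    and p: "path (H <#> Q) u (u \<otimes> c [^] (n::nat))"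
    and min: "\<And>k. 0 < k \<Longrightarrow> k < n \<Longrightarrow> u \<otimes> c [^] (k::nat) \<otimes> inv u \<notin> H"
  shows "n \<le> card Q * card common"
proof -
  have cc: "c \<in> carrier G" using c red_closed by blast
  have HG: "H \<subseteq> carrier G" using H subgroup.subset by blast
  have K: "H <#> Q \<subseteq> carrier G" using set_mult_closed[OF HG Q(2)] .
  have "\<exists>q a. q \<in> Q \<and> a \<in> common \<and> u \<otimes> c [^] k \<otimes> a \<otimes> inv q \<in> H" if k: "k < n" for k
  proof -
    obtain a where a: "a \<in> common" "u \<otimes> c [^] k \<otimes> a \<in> H <#> Q"
      using power_in_path_hull[OF c u K p k] by blast
    then obtain h q where hq: "h \<in> H" "q \<in> Q" "u \<otimes> c [^] k \<otimes> a = h \<otimes> q"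
      by (auto simp: set_mult_def)
    then have "u \<otimes> c [^] k \<otimes> a \<otimes> inv q = h" using HG Q by (auto simp: m_assoc subset_iff)
    then show ?thesis using a hq by blast
  qed
  then obtain q a where qa: "\<And>k. k < n \<Longrightarrow> q k \<in> Q" "\<And>k. k < n \<Longrightarrow> a k \<in> common"
    "\<And>k. k < n \<Longrightarrow> u \<otimes> c [^] k \<otimes> a k \<otimes> inv (q k) \<in> H" by metis
  have "inj_on (\<lambda>k. (q k, a k)) {..<n}"
  proof (rule linorder_inj_onI)
    fix k l assume kl: "k < l" "k \<in> {..<n}" "l \<in> {..<n}"
    show "(q k, a k) \<noteq> (q l, a l)"
    proof
      assume eq: "(q k, a k) = (q l, a l)"
      have aq: "a l \<in> carrier G" "q l \<in> carrier G"
        using qa[of l] kl Q by auto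
      have "(u \<otimes> c [^] l \<otimes> a l \<otimes> inv (q l)) \<otimes> inv (u \<otimes> c [^] k \<otimes> a k \<otimes> inv (q k)) \<in> H"
        using kl by (intro subgroup.m_closed[OF H qa(3) subgroup.m_inv_closed[OF H qa(3)]]) auto
      also have "(u \<otimes> c [^] l \<otimes> a l \<otimes> inv (q l)) \<otimes> inv (u \<otimes> c [^] k \<otimes> a k \<otimes> inv (q k))
          = u \<otimes> (c [^] l \<otimes> inv (c [^] k)) \<otimes> inv u"
        using aq eq u cc by (simp add: inv_mult_group m_assoc)
      also have "c [^] l = c [^] (l - k) \<otimes> c [^] k" using cc kl by (simp add: nat_pow_mult)
      then have "c [^] l \<otimes> inv (c [^] k) = c [^] (l - k)" using cc by (simp add: m_assoc)
      finally have "u \<otimes> c [^] (l - k) \<otimes> inv u \<in> H" .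
      moreover have "0 < l - k" "l - k < n" using kl by auto
      ultimately show False using min by blast
    qed
  qed auto
  then have "card {..<n} \<le> card (Q \<times> common)"
    using qa Q fin by (intro card_inj_on_le) auto
  then show ?thesis by (simp add: card_cartesian_product)
qed

lemma conj_pow:
  assumes "u \<in> carrier G" "g \<in> carrier G"
  shows "(inv u \<otimes> g \<otimes> u) [^] (n::nat) = inv u \<otimes> g [^] n \<otimes> u"
proof (induction n)
  case 0
  then show ?case using assms by simp
next
  case (Suc n)
  then show ?case using assms by (simp add: m_assoc)
qed

lemma B_card_pow: "x \<in> B k \<Longrightarrow> finite (B k) \<Longrightarrow> x [^] card (B k) = \<one>"
proof -
  assume x: "x \<in> B k" and fin: "finite (B k)"
  interpret S: group "G\<lparr>carrier := B k\<rparr>" using subgroup.subgroup_is_group[OF subgroup_B] is_group by blast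
  have "x [^]\<^bsub>G\<lparr>carrier := B k\<rparr>\<^esub> order (G\<lparr>carrier := B k\<rparr>) = \<one>\<^bsub>G\<lparr>carrier := B k\<rparr>\<^esub>"
    using x by (intro S.pow_order_eq_1) simp
  then show ?thesis by (simp add: nat_pow_consistent[symmetric] order_def)
qed

text \<open>
  The hypothesis on paths says that \<open>H <#> Q\<close> contains a path from \<open>\<one>\<close> to each element of \<open>H\<close>. The
  path from \<open>\<one>\<close> to a power of \<open>g\<close> in \<open>H\<close> is extended at both ends by the path to the conjugating element
  \<open>u\<close>; this stays in finitely many cosets of \<open>H\<close> because the second extension is the first one
  translated by an element of \<open>H\<close>.
\<close>

theorem least_power_bound:
  assumes H: "subgroup H G" and Q: "finite Q" "Q \<subseteq> carrier G"
    and conn: "\<And>h. h \<in> H \<Longrightarrow> path (H <#> Q) \<one> h"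
    and fin: "\<And>i. finite (B i)" and g: "factor_prod l g"
    and n: "0 < n" "g [^] (n::nat) \<in> H" "g [^] n \<noteq> \<one>"
  shows "\<exists>m. 0 < m \<and> m \<le> (card Q + Suc l) * (card (B True) + card (B False)) \<and>
    g [^] m \<in> H \<and> g [^] m \<noteq> \<one>"
proof -
  have HG: "H \<subseteq> carrier G" using H subgroup.subset by blast
  have gc: "g \<in> carrier G" using g by (induction rule: factor_prod.induct) auto
  obtain u P where u: "P \<subseteq> carrier G" "finite P" "card P \<le> Suc l" "path P \<one> u"
    and core: "(\<exists>k. inv u \<otimes> g \<otimes> u \<in> B k) \<or> (\<exists>k m. red k (\<not> k) m (inv u \<otimes> g \<otimes> u))"
    using factor_prod_red[OF g]
  proof (elim disjE exE conjE)
    assume "g \<in> common"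
    then show thesis using that[of "{\<one>}" \<one>] gc by (auto simp: common_def intro: path.refl)
  next
    fix i j k assume "k \<le> l" "red i j k g"
    from conjugate_to_core[OF this(2)] this(1) show thesis by (meson that Suc_le_mono le_trans)
  qed
  have uc: "u \<in> carrier G" using u path_ends by blast
  define c where "c = inv u \<otimes> g \<otimes> u"
  have cc: "c \<in> carrier G" using uc gc by (simp add: c_def)
  have gk: "g [^] k = u \<otimes> c [^] k \<otimes> inv u" for k :: nat
  proof -
    have "c [^] k = inv u \<otimes> g [^] k \<otimes> u" unfolding c_def by (rule conj_pow[OF uc gc])
    then show ?thesis using uc gc by (simp add: m_assoc)
  qed
  from core[folded c_def] show ?thesis
  proof (elim disjE exE)
    fix k assume ck: "c \<in> B k"
    define N where "N = card (B k)"
    have N: "0 < N" unfolding N_def using fin B_one by (metis card_gt_0_iff empty_iff)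
    have "c [^] N = \<one>" unfolding N_def using ck fin by (rule B_card_pow)
    then have gN: "g [^] N = \<one>" using gk uc by simp
    have "g [^] n = g [^] (N * (n div N) + n mod N)" by simp
    also have "\<dots> = (g [^] N) [^] (n div N) \<otimes> g [^] (n mod N)"
      using gc by (simp only: nat_pow_mult[symmetric] nat_pow_pow)
    finally have gn: "g [^] n = g [^] (n mod N)" using gN gc by simp
    have "0 < n mod N" using gn n by (metis gr0I nat_pow_0)
    moreover have "n mod N \<le> N" using N by (simp add: less_imp_le)
    moreover have "N \<le> card (B True) + card (B False)" by (cases k) (simp_all add: N_def)
    then have "N \<le> (card Q + Suc l) * (card (B True) + card (B False))" by (simp add: trans_le_add1 trans_le_add2)
    ultimately show ?thesis using n gn by (metis le_trans)
  next
    fix k m assume c: "red k (\<not> k) m c"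
    have ex: "\<exists>n. 0 < n \<and> g [^] (n::nat) \<in> H" using n by blast
    define d where "d = (LEAST n. 0 < n \<and> g [^] (n::nat) \<in> H)"
    have d: "0 < d" "g [^] d \<in> H" using LeastI_ex[OF ex] by (auto simp: d_def)
    have min: "g [^] j \<notin> H" if "0 < j" "j < d" for j :: nat
      using not_less_Least[of j "\<lambda>n. 0 < n \<and> g [^] n \<in> H"] that by (auto simp: d_def)
    define Q' where "Q' = Q \<union> P"
    have Q': "finite Q'" "Q' \<subseteq> carrier G" using Q u by (auto simp: Q'_def)
    have KG: "H <#> Q' \<subseteq> carrier G" using set_mult_closed[OF HG Q'(2)] .
    have HP: "h \<otimes> x \<in> H <#> Q'" if "h \<in> H" "x \<in> P" for h x
      using that by (auto simp: Q'_def set_mult_def)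
    have "x \<in> H <#> Q'" if "x \<in> P" for x
      using HP[OF subgroup.one_closed[OF H] that] that u(1) by auto
    then have sub: "H <#> Q \<subseteq> H <#> Q'" "P \<subseteq> H <#> Q'" "(\<lambda>x. g [^] d \<otimes> x) ` P \<subseteq> H <#> Q'"
      using HP d by (auto simp: Q'_def set_mult_def)
    have p1: "path (H <#> Q') u \<one>"
      using path_sym[OF path_mono[OF u(4) sub(2)] KG] .
    have p2: "path (H <#> Q') \<one> (g [^] d)"
      using path_mono[OF conn[OF d(2)] sub(1)] .
    have "path (H <#> Q') (g [^] d \<otimes> \<one>) (g [^] d \<otimes> u)"
      using path_mono[OF path_translate[OF _ u(1,4)] sub(3)] gc by simp
    moreover have "g [^] d \<otimes> u = u \<otimes> c [^] d" using gk uc cc by (simp add: m_assoc)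
    ultimately have p3: "path (H <#> Q') (g [^] d) (u \<otimes> c [^] d)" using gc by simp
    have fc: "finite common" using fin by (simp add: common_def)
    have "d \<le> card Q' * card common"
      using hyperbolic_power_bound[OF H Q' fc c uc path_trans[OF p1 path_trans[OF p2 p3]]] min gk
      by auto
    moreover have "card Q' \<le> card Q + Suc l"
      using card_Un_le[of Q P] u(3) by (simp add: Q'_def)
    moreover have "card common \<le> card (B True) + card (B False)"
      unfolding common_def using card_mono[OF fin[of True], of "B True \<inter> B False"] by auto
    ultimately have "d \<le> (card Q + Suc l) * (card (B True) + card (B False))"
      by (meson le_trans mult_le_mono)
    moreover have "g [^] d \<noteq> \<one>"
    proof
      assume "g [^] d = \<one>"
      then have "c [^] d = \<one>" using conj_pow[OF uc gc, of d] uc by (simp add: c_def)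
      then show False using red_power[OF c d(1)] red_ne_one by blast
    qed
    ultimately show ?thesis using d by blast
  qed
qed

end

section \<open>Group actions and extensions of free actions\<close>

text \<open>
  Actions are on the right because a word acts letter by letter from its left end, as in \<^const>\<open>fold\<close>.
\<close>

definition right_action :: "('g, 'm) monoid_scheme \<Rightarrow> 'w set \<Rightarrow> ('w \<Rightarrow> 'g \<Rightarrow> 'w) \<Rightarrow> bool" where
  "right_action K W act \<longleftrightarrow>
     (\<forall>w\<in>W. act w \<one>\<^bsub>K\<^esub> = w \<and>
       (\<forall>g\<in>carrier K. act w g \<in> W \<and> (\<forall>h\<in>carrier K. act (act w g) h = act w (g \<otimes>\<^bsub>K\<^esub> h))))"

definition free_on :: "('g, 'm) monoid_scheme \<Rightarrow> 'w set \<Rightarrow> ('w \<Rightarrow> 'g \<Rightarrow> 'w) \<Rightarrow> bool" where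
  "free_on K W act \<longleftrightarrow> (\<forall>w\<in>W. \<forall>g\<in>carrier K. act w g = w \<longrightarrow> g = \<one>\<^bsub>K\<^esub>)"

lemma right_actionD:
  assumes "right_action K W act" "w \<in> W"
  shows "act w \<one>\<^bsub>K\<^esub> = w"
    and "g \<in> carrier K \<Longrightarrow> act w g \<in> W"
    and "g \<in> carrier K \<Longrightarrow> h \<in> carrier K \<Longrightarrow> act (act w g) h = act w (g \<otimes>\<^bsub>K\<^esub> h)"
  using assms by (auto simp: right_action_def)

lemma right_action_inv:
  assumes "group K" "right_action K W act" "w \<in> W" "g \<in> carrier K"
  shows "act (act w g) (inv\<^bsub>K\<^esub> g) = w" "act (act w (inv\<^bsub>K\<^esub> g)) g = w"
  using assms right_actionD[OF assms(2,3)] by (simp_all add: group.r_inv group.l_inv group.inv_closed)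

lemma free_on_inj:
  assumes "group K" "right_action K W act" "free_on K W act" "w \<in> W"
  shows "inj_on (act w) (carrier K)"
proof (rule inj_onI)
  interpret group K by fact
  fix g h assume gh: "g \<in> carrier K" "h \<in> carrier K" "act w g = act w h"
  have "act w (g \<otimes>\<^bsub>K\<^esub> inv\<^bsub>K\<^esub> h) = act (act w g) (inv\<^bsub>K\<^esub> h)"
    using right_actionD(3)[OF assms(2,4) gh(1) inv_closed[OF gh(2)]] ..
  also have "\<dots> = w" using right_action_inv(1)[OF assms(1,2,4)] gh by simp
  finally have "g \<otimes>\<^bsub>K\<^esub> inv\<^bsub>K\<^esub> h = \<one>\<^bsub>K\<^esub>" using assms(3,4) gh by (simp add: free_on_def)
  then show "g = h" using gh by (metis inv_closed inv_equality inv_inv)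
qed

lemma right_action_subset:
  assumes "right_action K W act" "U \<subseteq> W" "\<And>w g. w \<in> U \<Longrightarrow> g \<in> carrier K \<Longrightarrow> act w g \<in> U"
  shows "right_action K U act"
  using assms unfolding right_action_def by blast

lemma free_on_subset: "free_on K W act \<Longrightarrow> U \<subseteq> W \<Longrightarrow> free_on K U act"
  unfolding free_on_def by blast

lemma invariant_complement:
  assumes K: "group K" and act: "right_action K W act" and "U \<subseteq> W"
    and U: "\<And>w g. w \<in> U \<Longrightarrow> g \<in> carrier K \<Longrightarrow> act w g \<in> U"
    and w: "w \<in> W - U" and g: "g \<in> carrier K"
  shows "act w g \<in> W - U"
proof -
  have "act w g \<notin> U"
  proof
    assume "act w g \<in> U"
    then have "act (act w g) (inv\<^bsub>K\<^esub> g) \<in> U" using U K g by (simp add: group.inv_closed)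
    then show False using right_action_inv(1)[OF K act _ g] w by simp
  qed
  then show ?thesis using act w g by (simp add: right_action_def)
qed

lemma orbit_invariant:
  assumes "group K" "right_action K W act" "w \<in> W" "x \<in> act w ` carrier K" "g \<in> carrier K"
  shows "act x g \<in> act w ` carrier K"
proof -
  interpret group K by fact
  show ?thesis using assms right_actionD(3)[OF assms(2,3)] by auto
qed

text \<open>
  Every orbit of a free action is a copy of the group. One orbit on each side is matched, and the
  complements are matched by induction.
\<close>

lemma free_actions_isomorphic:
  assumes K: "group K"
    and act1: "right_action K T act1" "free_on K T act1" "finite T"
    and act2: "right_action K Q act2" "free_on K Q act2" "finite Q"
    and "card T = card Q"
  shows "\<exists>f. bij_betw f T Q \<and> (\<forall>t\<in>T. \<forall>g\<in>carrier K. f (act1 t g) = act2 (f t) g)"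
  using act1 act2 \<open>card T = card Q\<close>
proof (induction "card T" arbitrary: T Q rule: less_induct)
  case less
  interpret group K by fact
  show ?case
  proof (cases "T = {}")
    case True
    then show ?thesis using less.prems by (auto simp: bij_betw_def)
  next
    case False
    then have "card T \<noteq> 0" using less.prems(3) by simp
    then have "Q \<noteq> {}" using less.prems(7) by auto
    with False obtain t q where t: "t \<in> T" and q: "q \<in> Q" by blast
    define O1 where "O1 = act1 t ` carrier K"
    define O2 where "O2 = act2 q ` carrier K"
    have inj1: "inj_on (act1 t) (carrier K)" and inj2: "inj_on (act2 q) (carrier K)"
      using free_on_inj[OF K less.prems(1,2) t] free_on_inj[OF K less.prems(4,5) q] .
    have sub: "O1 \<subseteq> T" "O2 \<subseteq> Q"
      using less.prems t q by (auto simp: O1_def O2_def right_action_def)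
    have card: "card O1 = card O2" using inj1 inj2 by (simp add: O1_def O2_def card_image)
    have tO: "t \<in> O1"
      using right_actionD(1)[OF less.prems(1) t] unfolding O1_def by (metis imageI one_closed)
    have inv1: "x \<in> O1 \<Longrightarrow> g \<in> carrier K \<Longrightarrow> act1 x g \<in> O1" for x g
      unfolding O1_def by (rule orbit_invariant[OF K less.prems(1) t])
    have inv2: "x \<in> O2 \<Longrightarrow> g \<in> carrier K \<Longrightarrow> act2 x g \<in> O2" for x g
      unfolding O2_def by (rule orbit_invariant[OF K less.prems(4) q])
    have c1: "x \<in> T - O1 \<Longrightarrow> g \<in> carrier K \<Longrightarrow> act1 x g \<in> T - O1" for x g
      by (rule invariant_complement[OF K less.prems(1) sub(1) inv1])
    have c2: "x \<in> Q - O2 \<Longrightarrow> g \<in> carrier K \<Longrightarrow> act2 x g \<in> Q - O2" for x g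
      by (rule invariant_complement[OF K less.prems(4) sub(2) inv2])
    have fin: "finite (T - O1)" "finite (Q - O2)" using less.prems by auto
    have lt: "card (T - O1) < card T"
      using less.prems t tO by (intro psubset_card_mono) auto
    have ceq: "card (T - O1) = card (Q - O2)"
      using less.prems sub card by (simp add: card_Diff_subset finite_subset)
    obtain f' where f': "bij_betw f' (T - O1) (Q - O2)"
      "\<And>x g. x \<in> T - O1 \<Longrightarrow> g \<in> carrier K \<Longrightarrow> f' (act1 x g) = act2 (f' x) g"
      using less.hyps[OF lt right_action_subset[OF less.prems(1) Diff_subset c1]
          free_on_subset[OF less.prems(2) Diff_subset] fin(1)
          right_action_subset[OF less.prems(4) Diff_subset c2]
          free_on_subset[OF less.prems(5) Diff_subset] fin(2) ceq] by blast
    define f where "f x = (if x \<in> O1 then act2 q (inv_into (carrier K) (act1 t) x) else f' x)" for x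
    have fO: "f (act1 t g) = act2 q g" if "g \<in> carrier K" for g
      using that inj1 by (simp add: f_def O1_def)
    have im: "f ` O1 = O2" unfolding O1_def O2_def image_image using fO by (rule image_cong[OF HOL.refl])
    have "inj_on f O1"
      by (rule eq_card_imp_inj_on) (simp_all add: im card finite_subset[OF sub(1) less.prems(3)])
    with im have "bij_betw f O1 O2" by (simp add: bij_betw_def)
    moreover have "bij_betw f (T - O1) (Q - O2)"
      by (rule iffD2[OF bij_betw_cong f'(1)]) (simp add: f_def)
    ultimately have "bij_betw f (O1 \<union> (T - O1)) (O2 \<union> (Q - O2))"
      by (rule bij_betw_combine) auto
    then have "bij_betw f T Q" using sub by (simp add: Un_absorb1)
    moreover have "f (act1 x g) = act2 (f x) g" if "x \<in> T" "g \<in> carrier K" for x g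
    proof (cases "x \<in> O1")
      case True
      then obtain h where h: "h \<in> carrier K" "x = act1 t h" by (auto simp: O1_def)
      then show ?thesis
        using fO that right_actionD(3)[OF less.prems(1) t] right_actionD(3)[OF less.prems(4) q] by simp
    next
      case False
      then show ?thesis using f'(2)[of x g] c1[of x g] that by (simp add: f_def)
    qed
    ultimately show ?thesis by blast
  qed
qed

lemma right_action_transport:
  assumes "right_action K Q act" "bij_betw f T Q"
  shows "right_action K T (\<lambda>t g. inv_into T f (act (f t) g))"
proof -
  have f: "f t \<in> Q" "inv_into T f (f t) = t" if "t \<in> T" for t
    using assms(2) that by (auto simp: bij_betw_def)
  have i: "inv_into T f y \<in> T" "f (inv_into T f y) = y" if "y \<in> Q" for y
    using assms(2) that by (auto simp: bij_betw_def inv_into_into f_inv_into_f)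
  show ?thesis
    using assms(1) f i unfolding right_action_def by simp
qed

text \<open>
  As a set with an action of \<open>A\<close>, the set \<open>T\<close> is isomorphic to a disjoint union of copies of \<open>K\<close>, since
  \<open>A\<close> acts freely on both and the sizes agree. The action of \<open>K\<close> on its copies is carried over to \<open>T\<close>.
\<close>

lemma extend_free_action:
  assumes A: "group A" and K: "group K" and \<phi>: "\<phi> \<in> mon A K" and fin: "finite (carrier K)"
    and act: "right_action A T act" "free_on A T act" "finite T"
    and dvd: "card (carrier K) dvd card T"
  shows "\<exists>act'. right_action K T act' \<and> (\<forall>t\<in>T. \<forall>a\<in>carrier A. act' t (\<phi> a) = act t a)"
proof -
  interpret K: group K by fact
  interpret A: group A by fact
  have hom: "\<phi> \<in> hom A K" and inj: "inj_on \<phi> (carrier A)" using \<phi> by (auto simp: mon_def)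
  have \<phi>c: "\<phi> a \<in> carrier K" if "a \<in> carrier A" for a using hom that by (auto simp: hom_def)
  have \<phi>m: "\<phi> (a \<otimes>\<^bsub>A\<^esub> b) = \<phi> a \<otimes>\<^bsub>K\<^esub> \<phi> b" if "a \<in> carrier A" "b \<in> carrier A" for a b
    using hom that by (auto simp: hom_def)
  have \<phi>1: "\<phi> \<one>\<^bsub>A\<^esub> = \<one>\<^bsub>K\<^esub>" using hom_one[OF hom A K] .
  obtain n where n: "card T = card (carrier K) * n" using dvd by (elim dvdE)
  define Q where "Q = {..<n} \<times> carrier K"
  define act2 where "act2 p k = (fst p :: nat, snd p \<otimes>\<^bsub>K\<^esub> k)" for p k
  have act2: "right_action K Q act2"
    by (auto simp: right_action_def Q_def act2_def K.m_assoc)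
  have act2A: "right_action A Q (\<lambda>p a. act2 p (\<phi> a))"
    using act2 \<phi>c \<phi>m \<phi>1 by (simp add: right_action_def)
  have "free_on A Q (\<lambda>p a. act2 p (\<phi> a))"
    unfolding free_on_def
  proof (intro ballI impI)
    fix p a assume p: "p \<in> Q" "a \<in> carrier A" "act2 p (\<phi> a) = p"
    then have "snd p \<otimes>\<^bsub>K\<^esub> \<phi> a = snd p" "snd p \<in> carrier K"
      by (auto simp: act2_def Q_def prod_eq_iff)
    then have "\<phi> a = \<phi> \<one>\<^bsub>A\<^esub>" using \<phi>c p \<phi>1 K.r_cancel_one by simp
    then show "a = \<one>\<^bsub>A\<^esub>" using inj p by (auto dest: inj_onD)
  qed
  moreover have "finite Q" "card T = card Q" using fin n by (auto simp: Q_def)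
  ultimately obtain f where f: "bij_betw f T Q"
    "\<And>t a. t \<in> T \<Longrightarrow> a \<in> carrier A \<Longrightarrow> f (act t a) = act2 (f t) (\<phi> a)"
    using free_actions_isomorphic[OF A act act2A] by blast
  show ?thesis
  proof (intro exI[of _ "\<lambda>t g. inv_into T f (act2 (f t) g)"] conjI ballI)
    show "right_action K T (\<lambda>t g. inv_into T f (act2 (f t) g))"
      by (rule right_action_transport[OF act2 f(1)])
    fix t a assume ta: "t \<in> T" "a \<in> carrier A"
    then have "act t a \<in> T" using act(1) by (simp add: right_action_def)
    then show "inv_into T f (act2 (f t) (\<phi> a)) = act t a"
      using f(1) f(2)[OF ta, symmetric] by (simp add: bij_betw_def)
  qed
qed

definition perm_rep :: "'x set \<Rightarrow> 'x word set \<Rightarrow> 'w set \<Rightarrow> ('x \<times> bool \<Rightarrow> 'w \<Rightarrow> 'w) \<Rightarrow> bool" where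
  "perm_rep X R W s \<longleftrightarrow>
     (\<forall>x\<in>X. \<forall>b. \<forall>w\<in>W. s (x, b) w \<in> W \<and> s (x, \<not> b) (s (x, b) w) = w) \<and>
     (\<forall>r\<in>R. \<forall>w\<in>W. fold s r w = w)"

lemma perm_rep_closed: "perm_rep X R W s \<Longrightarrow> u \<in> words X \<Longrightarrow> w \<in> W \<Longrightarrow> fold s u w \<in> W"
  by (induction u arbitrary: w) (auto simp: perm_rep_def)

lemma perm_rep_pres_eq:
  assumes "perm_rep X R W s" "R \<subseteq> words X" "pres_eq X R u v" "w \<in> W"
  shows "fold s u w = fold s v w"
  using assms(3,4)
proof (induction arbitrary: w rule: pres_eq.induct)
  case (cancel u v x b)
  have "fold s u w \<in> W" using perm_rep_closed[OF assms(1) cancel.hyps(1) cancel.prems] .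
  then show ?case using assms(1) cancel.hyps by (simp add: perm_rep_def)
next
  case (relator u v r)
  have "fold s u w \<in> W" using perm_rep_closed[OF assms(1) relator.hyps(1) relator.prems] .
  then show ?case using assms(1) relator.hyps by (simp add: perm_rep_def)
next
  case (trans u v x)
  then show ?case by metis
qed simp_all

lemma perm_rep_inv_word:
  assumes "perm_rep X R W s" "R \<subseteq> words X" "u \<in> words X" "w \<in> W"
  shows "fold s (inv_word u) (fold s u w) = w" "fold s u (fold s (inv_word u) w) = w"
proof -
  have ii: "inv_word (inv_word u) = u" by (induction u) (auto simp: inv_word_def)
  have "pres_eq X R (inv_word u @ u) []" "pres_eq X R (u @ inv_word u) []"
    using pres_eq_inv_word[of u X R] pres_eq_inv_word[of "inv_word u" X R] assms(3) ii by auto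
  then show "fold s (inv_word u) (fold s u w) = w" "fold s u (fold s (inv_word u) w) = w"
    using perm_rep_pres_eq[OF assms(1,2) _ assms(4)] by fastforce+
qed

section \<open>Amalgams of presented finite groups\<close>

locale finite_amalgam =
  fixes X :: "bool \<Rightarrow> 'x set" and S :: "bool \<Rightarrow> 'x word set"
    and A :: "('a, 'm) monoid_scheme" and Y :: "'a set"
    and \<phi> :: "bool \<Rightarrow> 'a \<Rightarrow> 'x word set"
  assumes disjoint: "X True \<inter> X False = {}"
    and S_words: "\<And>i. S i \<subseteq> words (X i)"
    and finite_factor: "\<And>i. finite (carrier (presented_group (X i) (S i)))"
    and group_A: "group A"
    and Y_subset: "Y \<subseteq> carrier A" and generate_Y: "generate A Y = carrier A"
    and \<phi>_mon: "\<And>i. \<phi> i \<in> mon A (presented_group (X i) (S i))"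
begin

abbreviation K :: "bool \<Rightarrow> 'x word set monoid" where
  "K i \<equiv> presented_group (X i) (S i)"

abbreviation cls :: "bool \<Rightarrow> 'x word \<Rightarrow> 'x word set" where
  "cls i \<equiv> word_class (X i) (S i)"

definition gens :: "'x set" where
  "gens = X True \<union> X False"

definition rels :: "'x word set" where
  "rels = S True \<union> S False \<union> amalgam_relators Y (\<phi> True) (\<phi> False)"

abbreviation G :: "'x word set monoid" where
  "G \<equiv> presented_group gens rels"

abbreviation el :: "'x word \<Rightarrow> 'x word set" where
  "el \<equiv> word_class gens rels"

sublocale factor: group "K i" for i
  by (rule group_presented_group[OF S_words])

sublocale A: group A
  by (rule group_A)

lemma words_gens: "u \<in> words (X i) \<Longrightarrow> u \<in> words gens"
  by (cases i) (auto simp: gens_def words_def)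

lemma side_unique: "x \<in> X i \<Longrightarrow> x \<in> X True \<longleftrightarrow> i"
  using disjoint by (cases i) auto

lemma letter_side: "x \<in> gens \<Longrightarrow> x \<in> X (x \<in> X True)"
  by (cases "x \<in> X True") (auto simp: gens_def)

lemma \<phi>_closed: "a \<in> carrier A \<Longrightarrow> \<phi> i a \<in> carrier (K i)"
  using \<phi>_mon[of i] by (auto simp: mon_def hom_def)

lemma \<phi>_mult: "a \<in> carrier A \<Longrightarrow> b \<in> carrier A \<Longrightarrow> \<phi> i (a \<otimes>\<^bsub>A\<^esub> b) = \<phi> i a \<otimes>\<^bsub>K i\<^esub> \<phi> i b"
  using \<phi>_mon[of i] by (auto simp: mon_def hom_def)

lemma \<phi>_one: "\<phi> i \<one>\<^bsub>A\<^esub> = \<one>\<^bsub>K i\<^esub>"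
  using \<phi>_mon[of i] hom_one[OF _ group_A factor.is_group] by (auto simp: mon_def)

lemma \<phi>_inj: "inj_on (\<phi> i) (carrier A)"
  using \<phi>_mon[of i] by (auto simp: mon_def)

lemma carrier_K: "carrier (K i) = cls i ` words (X i)"
  by (simp add: presented_group_def)

lemma one_K: "\<one>\<^bsub>K i\<^esub> = cls i []"
  by (simp add: presented_group_def)

lemma carrier_G: "carrier G = el ` words gens"
  by (simp add: presented_group_def)

lemma one_G: "\<one>\<^bsub>G\<^esub> = el []"
  by (simp add: presented_group_def)

lemma cls_self: "u \<in> words (X i) \<Longrightarrow> u \<in> cls i u"
  by (simp add: word_class_def pres_eq.refl)

lemma in_cls:
  assumes "C \<in> carrier (K i)" "u \<in> C"
  shows "u \<in> words (X i)" "C = cls i u"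
proof -
  obtain v where v: "v \<in> words (X i)" "C = cls i v" using assms(1) carrier_K by auto
  then have *: "pres_eq (X i) (S i) v u" using assms(2) by (simp add: word_class_def)
  then show u: "u \<in> words (X i)" using pres_eq_words[OF S_words] by blast
  show "C = cls i u" using * v u word_class_eq_iff[OF S_words] by blast
qed

lemma cls_mult:
  "u \<in> words (X i) \<Longrightarrow> v \<in> words (X i) \<Longrightarrow> cls i u \<otimes>\<^bsub>K i\<^esub> cls i v = cls i (u @ v)"
  by (rule mult_word_class[OF S_words])

lemma rels_words: "rels \<subseteq> words gens"
proof -
  have "u @ inv_word v \<in> words gens" if "a \<in> Y" "u \<in> \<phi> True a" "v \<in> \<phi> False a" for a u v
  proof -
    have "a \<in> carrier A" using that Y_subset by blast
    then have "u \<in> words (X True)" "v \<in> words (X False)"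
      using that in_cls(1)[OF \<phi>_closed] by blast+
    then show ?thesis using words_gens by simp
  qed
  moreover have "S i \<subseteq> words gens" for i using S_words words_gens by blast
  ultimately show ?thesis by (auto simp: rels_def amalgam_relators_def)
qed

sublocale amalgam: group G
  by (rule group_presented_group[OF rels_words])

lemma el_mult: "u \<in> words gens \<Longrightarrow> v \<in> words gens \<Longrightarrow> el u \<otimes>\<^bsub>G\<^esub> el v = el (u @ v)"
  by (rule mult_word_class[OF rels_words])

lemma el_closed: "u \<in> words gens \<Longrightarrow> el u \<in> carrier G"
  by (simp add: carrier_G)

lemma factor_pres_eq: "pres_eq (X i) (S i) u v \<Longrightarrow> pres_eq gens rels u v"
proof (induction rule: pres_eq.induct)
  case (cancel u v x b)
  then show ?case using words_gens pres_eq.cancel[of u gens v x rels b] by (cases i) (auto simp: gens_def)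
next
  case (relator u v r)
  then have "r \<in> rels" by (cases i) (auto simp: rels_def)
  then show ?case using relator words_gens by (intro pres_eq.relator) auto
next
  case (trans u v w)
  then show ?case using pres_eq.trans by blast
qed (auto intro: pres_eq.refl pres_eq.sym words_gens)

lemma el_cong:
  assumes "u \<in> words (X i)" "v \<in> words (X i)" "cls i u = cls i v"
  shows "el u = el v"
  using assms factor_pres_eq word_class_eq_iff[OF S_words] word_class_eq_iff[OF rels_words] words_gens
  by metis

text \<open>
  The canonical homomorphism of a factor to the amalgam.
\<close>

definition \<iota> :: "bool \<Rightarrow> 'x word set \<Rightarrow> 'x word set" where
  "\<iota> i C = el (SOME u. u \<in> C)"

lemma \<iota>_cls: "u \<in> words (X i) \<Longrightarrow> \<iota> i (cls i u) = el u"
proof -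
  assume u: "u \<in> words (X i)"
  define v where "v = (SOME v. v \<in> cls i u)"
  have "v \<in> cls i u" unfolding v_def using cls_self[OF u] by (rule someI)
  moreover have "cls i u \<in> carrier (K i)" using u by (simp add: carrier_K)
  ultimately have "v \<in> words (X i)" "cls i u = cls i v" using in_cls by blast+
  then have "el v = el u" using el_cong u by blast
  then show "\<iota> i (cls i u) = el u" by (simp only: \<iota>_def v_def)
qed

lemma \<iota>_hom: "\<iota> i \<in> hom (K i) G"
proof (rule homI)
  fix C assume "C \<in> carrier (K i)"
  then show "\<iota> i C \<in> carrier G" by (auto simp: carrier_K \<iota>_cls el_closed words_gens)
next
  fix C D assume "C \<in> carrier (K i)" "D \<in> carrier (K i)"
  then obtain u v where "u \<in> words (X i)" "C = cls i u" "v \<in> words (X i)" "D = cls i v"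
    by (auto simp: carrier_K)
  then show "\<iota> i (C \<otimes>\<^bsub>K i\<^esub> D) = \<iota> i C \<otimes>\<^bsub>G\<^esub> \<iota> i D"
    by (simp add: cls_mult \<iota>_cls el_mult words_gens)
qed

lemma \<iota>_closed: "C \<in> carrier (K i) \<Longrightarrow> \<iota> i C \<in> carrier G"
  using \<iota>_hom by (auto simp: hom_def)

lemma \<iota>_mult: "C \<in> carrier (K i) \<Longrightarrow> D \<in> carrier (K i) \<Longrightarrow> \<iota> i (C \<otimes>\<^bsub>K i\<^esub> D) = \<iota> i C \<otimes>\<^bsub>G\<^esub> \<iota> i D"
  using \<iota>_hom by (auto simp: hom_def)

lemma \<iota>_one: "\<iota> i \<one>\<^bsub>K i\<^esub> = \<one>\<^bsub>G\<^esub>"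
  by (simp add: one_K one_G \<iota>_cls)

lemma \<iota>\<phi>_hom: "\<iota> i \<circ> \<phi> i \<in> hom A G"
  using \<phi>_closed \<phi>_mult \<iota>_closed \<iota>_mult by (auto simp: hom_def)

text \<open>
  The relators identify the two images for \<open>Y\<close> only; two homomorphisms that agree on generators are
  equal.
\<close>

lemma \<iota>\<phi>_agree:
  assumes "a \<in> carrier A"
  shows "\<iota> True (\<phi> True a) = \<iota> False (\<phi> False a)"
proof -
  interpret h: group_hom A G "\<iota> i \<circ> \<phi> i" for i
    using \<iota>\<phi>_hom by (simp add: group_hom_def group_hom_axioms_def group_A amalgam.is_group)
  have base: "\<iota> True (\<phi> True a) = \<iota> False (\<phi> False a)" if a: "a \<in> Y" for a
  proof -
    have aA: "a \<in> carrier A" using a Y_subset by blast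
    obtain u v where uv: "u \<in> words (X True)" "\<phi> True a = cls True u"
      "v \<in> words (X False)" "\<phi> False a = cls False v"
      using \<phi>_closed[OF aA] carrier_K by (metis imageE)
    have "u @ inv_word v \<in> rels"
      using a uv cls_self unfolding rels_def amalgam_relators_def by blast
    then have "pres_eq gens rels ([] @ (u @ inv_word v) @ v) ([] @ v)"
      using uv words_gens by (intro pres_eq.relator) auto
    moreover have "pres_eq gens rels (u @ (inv_word v @ v)) (u @ [])"
      using uv words_gens by (intro pres_eq_append_left pres_eq_inv_word) auto
    ultimately have "pres_eq gens rels u v" by (auto intro: pres_eq.intros)
    then show ?thesis using uv words_gens word_class_eq_iff[OF rels_words] by (simp add: \<iota>_cls)
  qed
  have "a \<in> generate A Y" using assms generate_Y by simp
  then have "(\<iota> True \<circ> \<phi> True) a = (\<iota> False \<circ> \<phi> False) a"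
  proof (induction rule: generate.induct)
    case one
    show ?case by (simp only: h.hom_one)
  next
    case (incl a)
    then show ?case using base by simp
  next
    case (inv a)
    then have "a \<in> carrier A" using Y_subset by blast
    then show ?case using base[OF inv] by (simp only: h.hom_inv) simp
  next
    case (eng a b)
    then have "a \<in> carrier A" "b \<in> carrier A" using generate_Y by blast+
    then show ?case using eng.IH by (simp only: h.hom_mult)
  qed
  then show ?thesis by simp
qed

definition letter_step :: "(bool \<Rightarrow> 'w \<Rightarrow> 'x word set \<Rightarrow> 'w) \<Rightarrow> 'x \<times> bool \<Rightarrow> 'w \<Rightarrow> 'w" where
  "letter_step act l w = act (fst l \<in> X True) w (cls (fst l \<in> X True) [l])"

lemma fold_letter_step:
  assumes act: "right_action (K i) W (act i)"
  shows "u \<in> words (X i) \<Longrightarrow> w \<in> W \<Longrightarrow> fold (letter_step act) u w = act i w (cls i u)"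
proof (induction u arbitrary: w)
  case Nil
  then show ?case using right_actionD(1)[OF act] by (simp add: one_K)
next
  case (Cons l u)
  obtain x b where l: "l = (x, b)" by force
  have x: "x \<in> X i" "u \<in> words (X i)" using Cons.prems l by auto
  then have "[l] \<in> words (X i)" using l by simp
  then have c: "cls i [l] \<in> carrier (K i)" "cls i u \<in> carrier (K i)" using x carrier_K by auto
  have "letter_step act l w = act i w (cls i [l])"
    using side_unique[OF x(1)] l by (simp add: letter_step_def)
  then have "fold (letter_step act) (l # u) w = act i (act i w (cls i [l])) (cls i u)"
    using Cons.IH[OF x(2)] right_actionD(2)[OF act Cons.prems(2) c(1)] by simp
  also have "\<dots> = act i w (cls i [l] \<otimes>\<^bsub>K i\<^esub> cls i u)"
    by (rule right_actionD(3)[OF act Cons.prems(2) c])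
  also have "cls i [l] \<otimes>\<^bsub>K i\<^esub> cls i u = cls i (l # u)"
    using cls_mult[of "[l]" i u] \<open>[l] \<in> words (X i)\<close> x by simp
  finally show ?case .
qed

text \<open>
  This is the universal property of the amalgam for actions: actions of the factors that agree on \<open>A\<close>
  combine to an action of the amalgam.
\<close>

lemma perm_rep_letter_step:
  assumes act: "\<And>i. right_action (K i) W (act i)"
    and agree: "\<And>w a. w \<in> W \<Longrightarrow> a \<in> carrier A \<Longrightarrow> act True w (\<phi> True a) = act False w (\<phi> False a)"
  shows "perm_rep gens rels W (letter_step act)"
  unfolding perm_rep_def
proof (intro conjI ballI allI)
  note run = fold_letter_step[where act = act, OF act]
  note cls_in = carrier_K[THEN equalityD2, THEN subsetD, OF imageI]
  fix x b w assume x: "x \<in> gens" and w: "w \<in> W"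
  define i where "i = (x \<in> X True)"
  have xi: "x \<in> X i" using letter_side[OF x] by (simp add: i_def)
  have run1: "letter_step act (x, b) w = act i w (cls i [(x, b)])"
    using run[of "[(x, b)]" i w] xi w by simp
  show "letter_step act (x, b) w \<in> W"
    unfolding run1 using xi by (intro right_actionD(2)[OF act w] cls_in) simp
  have "pres_eq (X i) (S i) ([] @ [(x, b), (x, \<not> b)] @ []) ([] @ [])"
    using xi by (intro pres_eq.cancel) auto
  then have "cls i [(x, b), (x, \<not> b)] = \<one>\<^bsub>K i\<^esub>"
    using word_class_eq_iff[OF S_words] xi by (simp add: one_K)
  then show "letter_step act (x, \<not> b) (letter_step act (x, b) w) = w"
    using run[of "[(x, b), (x, \<not> b)]" i w] xi w right_actionD(1)[OF act w, of i] by simp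
next
  note run = fold_letter_step[where act = act, OF act]
  fix r w assume r: "r \<in> rels" and w: "w \<in> W"
  have factor: "fold (letter_step act) r w = w" if "r \<in> S i" for i
  proof -
    have rw: "r \<in> words (X i)" using that S_words by blast
    have "pres_eq (X i) (S i) ([] @ r @ []) ([] @ [])" using that by (intro pres_eq.relator) auto
    then have "cls i r = \<one>\<^bsub>K i\<^esub>" using word_class_eq_iff[OF S_words] rw by (simp add: one_K)
    then show ?thesis using run[OF rw w] right_actionD(1)[OF act w] by simp
  qed
  show "fold (letter_step act) r w = w"
  proof (cases "r \<in> S True \<union> S False")
    case True
    then show ?thesis using factor by blast
  next
    case False
    then obtain a u v where auv: "a \<in> Y" "u \<in> \<phi> True a" "v \<in> \<phi> False a" "r = u @ inv_word v"
      using r by (auto simp: rels_def amalgam_relators_def)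
    have a: "a \<in> carrier A" using auv Y_subset by blast
    have u: "u \<in> words (X True)" "\<phi> True a = cls True u"
      and v: "v \<in> words (X False)" "\<phi> False a = cls False v"
      using in_cls[OF \<phi>_closed[OF a]] auv by blast+
    define w' where "w' = act True w (\<phi> True a)"
    have "fold (letter_step act) u w = w'" using run[OF u(1) w] u by (simp add: w'_def)
    moreover have "fold (letter_step act) v w = w'"
      using run[OF v(1) w] v agree[OF w a] by (simp add: w'_def)
    moreover have "fold (letter_step act) (inv_word v) w' = w"
    proof -
      have vv: "cls False v \<in> carrier (K False)" "cls False (inv_word v) \<in> carrier (K False)"
        using v carrier_K by auto
      have w': "w' = act False w (cls False v)" using v agree[OF w a] by (simp add: w'_def)
      then have "w' \<in> W" using right_actionD(2)[OF act w vv(1)] by simp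
      then have "fold (letter_step act) (inv_word v) w' = act False w' (cls False (inv_word v))"
        using run v by simp
      also have "\<dots> = act False w (cls False v \<otimes>\<^bsub>K False\<^esub> cls False (inv_word v))"
        unfolding w' by (rule right_actionD(3)[OF act w vv])
      also have "cls False v \<otimes>\<^bsub>K False\<^esub> cls False (inv_word v) = cls False (v @ inv_word v)"
        using v by (intro cls_mult) auto
      also have "inv_word (inv_word v) = v" by (induction v) (auto simp: inv_word_def)
      then have "cls False (v @ inv_word v) = \<one>\<^bsub>K False\<^esub>"
        using pres_eq_inv_word[of "inv_word v" "X False" "S False"] v word_class_eq_iff[OF S_words]
        by (simp add: one_K)
      finally show ?thesis using right_actionD(1)[OF act w] by simp
    qed
    ultimately show ?thesis using auv by simp
  qed
qed

text \<open>
  Let one factor act on the product of both factors by multiplication in its own coordinate. The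
  resulting action of \<open>A\<close> is free, and the other factor has an action that extends it because its order
  divides the size of the product.
\<close>

lemma ex_finite_A_free_action:
  "\<exists>(F :: ('x word set \<times> 'x word set) set) act. finite F \<and> F \<noteq> {} \<and>
     card F = card (carrier (K True)) * card (carrier (K False)) \<and>
     (\<forall>i. right_action (K i) F (act i)) \<and>
     (\<forall>w\<in>F. \<forall>a\<in>carrier A. act True w (\<phi> True a) = act False w (\<phi> False a)) \<and>
     (\<forall>i. free_on A F (\<lambda>w a. act i w (\<phi> i a)))"
proof -
  define F where "F = carrier (K True) \<times> carrier (K False)"
  define act0 where "act0 p g = (fst p, snd p \<otimes>\<^bsub>K False\<^esub> g)"
    for p :: "'x word set \<times> 'x word set" and g
  have F: "finite F" "card F = card (carrier (K True)) * card (carrier (K False))"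
    using finite_factor by (auto simp: F_def card_cartesian_product)
  have ne: "F \<noteq> {}" using factor.one_closed by (auto simp: F_def)
  have act0: "right_action (K False) F act0"
    by (auto simp: right_action_def F_def act0_def factor.m_assoc)
  have act0A: "right_action A F (\<lambda>p a. act0 p (\<phi> False a))"
    using act0 \<phi>_closed[of _ False] \<phi>_mult[of _ _ False] \<phi>_one[of False] by (simp add: right_action_def)
  have free: "free_on A F (\<lambda>p a. act0 p (\<phi> False a))"
    unfolding free_on_def
  proof (intro ballI impI)
    fix p a assume p: "p \<in> F" "a \<in> carrier A" "act0 p (\<phi> False a) = p"
    then have "snd p \<otimes>\<^bsub>K False\<^esub> \<phi> False a = snd p" "snd p \<in> carrier (K False)"
      by (auto simp: act0_def F_def prod_eq_iff)
    then have "\<phi> False a = \<phi> False \<one>\<^bsub>A\<^esub>" using \<phi>_closed p \<phi>_one factor.r_cancel_one by simp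
    then show "a = \<one>\<^bsub>A\<^esub>" using \<phi>_inj p by (auto dest: inj_onD)
  qed
  have "card (carrier (K True)) dvd card F" using F(2) by simp
  from extend_free_action[OF group_A factor.is_group \<phi>_mon finite_factor act0A free F(1) this]
  obtain act1 where act1: "right_action (K True) F act1"
    "\<And>t a. t \<in> F \<Longrightarrow> a \<in> carrier A \<Longrightarrow> act1 t (\<phi> True a) = act0 t (\<phi> False a)" by blast
  have "free_on A F (\<lambda>p a. act1 p (\<phi> True a))"
    using free act1(2) by (simp add: free_on_def)
  then show ?thesis
    using F ne act0 act1 free
    by (intro exI[of _ F] exI[of _ "\<lambda>i. if i then act1 else act0"]) simp
qed

end

section \<open>Separating subgroups by finite actions\<close>

lemma right_action_Un:
  assumes "right_action K U act1" "right_action K T act2" "U \<inter> T = {}"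
  shows "right_action K (U \<union> T) (\<lambda>w. if w \<in> U then act1 w else act2 w)"
  using assms unfolding right_action_def by (auto simp: disjoint_iff)

lemma fold_image: "fold (\<lambda>l U. s l ` U) u U = fold s u ` U"
  by (induction u arbitrary: U) (simp_all add: image_image)

text \<open>
  Passing to sets of states turns an invariant set into a fixed point.
\<close>

lemma perm_rep_Pow:
  assumes "perm_rep X R W s"
  shows "perm_rep X R (Pow W) (\<lambda>l U. s l ` U)"
  unfolding perm_rep_def
proof (intro conjI ballI allI)
  fix x b U assume x: "x \<in> X" and U: "U \<in> Pow W"
  then have *: "s (x, b) w \<in> W" "s (x, \<not> b) (s (x, b) w) = w" if "w \<in> U" for w
    using assms that by (auto simp: perm_rep_def)
  show "s (x, b) ` U \<in> Pow W" using * by auto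
  show "s (x, \<not> b) ` s (x, b) ` U = U" using * by (simp add: image_image)
next
  fix r U assume "r \<in> R" "U \<in> Pow W"
  then have "fold s r w = w" if "w \<in> U" for w using assms that by (auto simp: perm_rep_def)
  then show "fold (\<lambda>l U. s l ` U) r U = U" by (simp add: fold_image)
qed

lemma card_prefixes:
  "card (\<Union>w\<in>set ws. (\<lambda>i. take i w) ` {..length w}) \<le> sum_list (map (\<lambda>w. Suc (length w)) ws)"
proof (induction ws)
  case (Cons w ws)
  let ?P = "\<lambda>w. (\<lambda>i. take i w) ` {..length w}"
  have "card (?P w \<union> (\<Union>w\<in>set ws. ?P w)) \<le> card (?P w) + card (\<Union>w\<in>set ws. ?P w)"
    by (rule card_Un_le)
  also have "card (?P w) \<le> card {..length w}" by (rule card_image_le) simp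
  finally show ?case using Cons by simp
qed simp

context finite_amalgam
begin

text \<open>
  The generators trace finitely many cosets of \<open>H\<close>. Each factor acts on the cosets that it reaches from
  these, but not on the ones that only the other factor reaches. In the product with a finite set on which
  \<open>A\<close> acts freely, the missing part of the action is supplied by extending the action of \<open>A\<close>. Since the
  traced cosets all lie where both factors act as in \<open>G\<close>, the word \<open>v\<close> moves the fibre over \<open>H\<close> and
  the generators do not. Sets of states serve as the points of the final action, which accounts for the
  power of two.
\<close>

theorem finite_separation:
  fixes hs v
  defines "H \<equiv> generate G (el ` set hs)"
  assumes hs: "set hs \<subseteq> words gens" and v: "v \<in> words gens" and notin: "el v \<notin> H"
  shows "\<exists>(W :: ('x word set set \<times> 'x word set \<times> 'x word set) set set) s w0 N.
    finite W \<and> card W = 2 ^ N \<and>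
    N \<le> (sum_list (map (\<lambda>w. Suc (length w)) (v # hs)) *
      (card (carrier (K True)) + card (carrier (K False)))) *
      (card (carrier (K True)) * card (carrier (K False))) \<and>
    perm_rep gens rels W s \<and> w0 \<in> W \<and> (\<forall>h\<in>set hs. fold s h w0 = w0) \<and> fold s v w0 \<noteq> w0"
proof -
  define k where "k i = card (carrier (K i))" for i
  have elG: "el ` set hs \<subseteq> carrier G" using hs el_closed by auto
  have H: "subgroup H G" unfolding H_def by (rule amalgam.generate_is_subgroup[OF elG])
  then have HG: "H \<subseteq> carrier G" by (rule subgroup.subset)
  define P where "P = (\<Union>w\<in>set (v # hs). (\<lambda>i. take i w) ` {..length w})"
  have P_words: "p \<in> words gens" if "p \<in> P" for p
  proof -
    obtain w i where w: "w \<in> set (v # hs)" "p = take i w" using \<open>p \<in> P\<close> by (auto simp: P_def)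
    then have "take i w @ drop i w \<in> words gens" using hs v by auto
    then show ?thesis using w by (simp only: words_append)
  qed
  have finP: "finite P" by (simp add: P_def)
  have cardP: "card P \<le> sum_list (map (\<lambda>w. Suc (length w)) (v # hs))"
    unfolding P_def by (rule card_prefixes)
  \<comment> \<open>the cosets traced by prefixes of the words\<close>
  define V0 where "V0 = (\<lambda>p. H #>\<^bsub>G\<^esub> el p) ` P"
  have V0G: "C \<subseteq> carrier G" if "C \<in> V0" for C
    using that P_words el_closed amalgam.r_coset_subset_G[OF HG] by (auto simp: V0_def)
  have finV0: "finite V0" and cardV0: "card V0 \<le> card P"
    using finP by (simp_all add: V0_def card_image_le)
  \<comment> \<open>the cosets on which the factor \<open>i\<close> acts\<close>
  define Vi where "Vi i = (\<lambda>(C, g). C #>\<^bsub>G\<^esub> \<iota> i g) ` (V0 \<times> carrier (K i))" for i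
  have finVi: "finite (Vi i)" for i using finV0 finite_factor by (simp add: Vi_def)
  have cardVi: "card (Vi i) \<le> card P * k i" for i
  proof -
    have "card (Vi i) \<le> card (V0 \<times> carrier (K i))"
      unfolding Vi_def using finV0 finite_factor by (intro card_image_le) simp
    also have "\<dots> \<le> card P * k i" using cardV0 by (simp add: card_cartesian_product k_def)
    finally show ?thesis .
  qed
  have ViE: "\<exists>D g. D \<in> V0 \<and> g \<in> carrier (K i) \<and> C = D #>\<^bsub>G\<^esub> \<iota> i g" if "C \<in> Vi i" for C i
    using that by (auto simp: Vi_def)
  have ViI: "D #>\<^bsub>G\<^esub> \<iota> i g \<in> Vi i" if "D \<in> V0" "g \<in> carrier (K i)" for D g i
    using that by (auto simp: Vi_def)
  have ViG: "C \<subseteq> carrier G" if C: "C \<in> Vi i" for C i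
  proof -
    obtain D g where "D \<in> V0" "g \<in> carrier (K i)" "C = D #>\<^bsub>G\<^esub> \<iota> i g" using ViE[OF C] by blast
    then show ?thesis using amalgam.r_coset_subset_G[OF V0G \<iota>_closed] by simp
  qed
  have V0_Vi: "C \<in> Vi i" if "C \<in> V0" for C i
  proof -
    have "C = C #>\<^bsub>G\<^esub> \<iota> i \<one>\<^bsub>K i\<^esub>" using V0G[OF that] by (simp add: \<iota>_one amalgam.coset_mult_one)
    then show ?thesis using ViI[OF that factor.one_closed, of i] by simp
  qed
  have mult: "(C #>\<^bsub>G\<^esub> \<iota> i g) #>\<^bsub>G\<^esub> \<iota> i h = C #>\<^bsub>G\<^esub> \<iota> i (g \<otimes>\<^bsub>K i\<^esub> h)"
    if "C \<subseteq> carrier G" "g \<in> carrier (K i)" "h \<in> carrier (K i)" for C i g h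
    using that by (simp add: amalgam.coset_mult_assoc \<iota>_closed \<iota>_mult)
  have Vi_closed: "C #>\<^bsub>G\<^esub> \<iota> i g \<in> Vi i" if C: "C \<in> Vi i" and g: "g \<in> carrier (K i)" for C i g
  proof -
    obtain D h where D: "D \<in> V0" "h \<in> carrier (K i)" "C = D #>\<^bsub>G\<^esub> \<iota> i h" using ViE[OF C] by blast
    then have "C #>\<^bsub>G\<^esub> \<iota> i g = D #>\<^bsub>G\<^esub> \<iota> i (h \<otimes>\<^bsub>K i\<^esub> g)" using mult V0G g by simp
    then show ?thesis using ViI[OF D(1) factor.m_closed[OF D(2) g]] by simp
  qed
  define V where "V = Vi True \<union> Vi False"
  have VG: "C \<subseteq> carrier G" if "C \<in> V" for C using that ViG by (auto simp: V_def)
  have Vi_V: "Vi i \<subseteq> V" for i by (cases i) (auto simp: V_def)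
  have ViF: "Vi i \<times> F \<subseteq> V \<times> F" for i and F :: "('x word set \<times> 'x word set) set"
    using Vi_V by (intro Sigma_mono) auto
  have finV: "finite V" using finVi by (simp add: V_def)
  have cardV: "card V \<le> card P * (k True + k False)"
    using card_Un_le[of "Vi True" "Vi False"] cardVi[of True] cardVi[of False]
    by (simp add: V_def distrib_left)

  obtain F :: "('x word set \<times> 'x word set) set" and actF where
    F: "finite F" "F \<noteq> {}" "card F = k True * k False"
    and actF: "\<And>i. right_action (K i) F (actF i)"
    and agreeF: "\<And>w a. w \<in> F \<Longrightarrow> a \<in> carrier A \<Longrightarrow> actF True w (\<phi> True a) = actF False w (\<phi> False a)"
    and freeF: "\<And>i. free_on A F (\<lambda>w a. actF i w (\<phi> i a))"
    using ex_finite_A_free_action unfolding k_def by blast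
  define act1 where "act1 i w g = (fst w #>\<^bsub>G\<^esub> \<iota> i g, actF i (snd w) g)"
    for i and w :: "'x word set set \<times> 'x word set \<times> 'x word set" and g
  have act1: "right_action (K i) (Vi i \<times> F) (act1 i)" for i
    unfolding right_action_def act1_def
    using Vi_closed[of _ i] ViG[of _ i] mult[of _ _ i] right_actionD[OF actF[of i]]
    by (auto simp: \<iota>_one amalgam.coset_mult_one)
  define actA where "actA w a = act1 True w (\<phi> True a)" for w a
  have actA: "actA w a = act1 i w (\<phi> i a)" if "w \<in> V \<times> F" "a \<in> carrier A" for w a i
    using that agreeF \<iota>\<phi>_agree by (cases i) (auto simp: actA_def act1_def)
  have actA_Vi: "actA w a \<in> Vi i \<times> F" if w: "w \<in> Vi i \<times> F" "a \<in> carrier A" for w a i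
  proof -
    have "w \<in> V \<times> F" using w Vi_V by auto
    then show ?thesis
      using actA[of w a i] right_actionD(2)[OF act1 w(1) \<phi>_closed[OF w(2)]] w(2) by simp
  qed
  have right_A: "right_action A (V \<times> F) actA"
    unfolding right_action_def
  proof (intro ballI conjI)
    fix w assume w: "w \<in> V \<times> F"
    then obtain i where i: "w \<in> Vi i \<times> F" by (auto simp: V_def)
    show "actA w \<one>\<^bsub>A\<^esub> = w"
      using actA[OF w A.one_closed, of i] right_actionD(1)[OF act1 i] by (simp add: \<phi>_one)
    fix a assume a: "a \<in> carrier A"
    show wa: "actA w a \<in> V \<times> F" using subsetD[OF ViF actA_Vi[OF i a]] .
    fix b assume b: "b \<in> carrier A"
    have "actA (actA w a) b = act1 i (act1 i w (\<phi> i a)) (\<phi> i b)"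
      using actA[OF w a, of i] actA[OF wa b, of i] by simp
    also have "\<dots> = act1 i w (\<phi> i (a \<otimes>\<^bsub>A\<^esub> b))"
      using right_actionD(3)[OF act1 i \<phi>_closed[OF a] \<phi>_closed[OF b]] by (simp add: \<phi>_mult a b)
    also have "\<dots> = actA w (a \<otimes>\<^bsub>A\<^esub> b)" using actA[OF w, of "a \<otimes>\<^bsub>A\<^esub> b" i] a b by simp
    finally show "actA (actA w a) b = actA w (a \<otimes>\<^bsub>A\<^esub> b)" .
  qed
  have free_A: "free_on A (V \<times> F) actA"
    using freeF[of True] unfolding free_on_def actA_def act1_def by (auto simp: prod_eq_iff)
  \<comment> \<open>off \<open>Vi i\<close> the action of the factor is made up; its order divides the size of \<open>F\<close>\<close>
  have "\<exists>act'. right_action (K i) ((V - Vi i) \<times> F) act' \<and>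
      (\<forall>t\<in>(V - Vi i) \<times> F. \<forall>a\<in>carrier A. act' t (\<phi> i a) = actA t a)" for i
  proof (rule extend_free_action[OF group_A factor.is_group \<phi>_mon finite_factor])
    have eq: "(V - Vi i) \<times> F = V \<times> F - Vi i \<times> F" by auto
    show "right_action A ((V - Vi i) \<times> F) actA"
      unfolding eq
    proof (rule right_action_subset[OF right_A])
      fix w a assume "w \<in> V \<times> F - Vi i \<times> F" "a \<in> carrier A"
      then show "actA w a \<in> V \<times> F - Vi i \<times> F"
        by - (rule invariant_complement[OF group_A right_A ViF actA_Vi])
    qed auto
    show "free_on A ((V - Vi i) \<times> F) actA" by (rule free_on_subset[OF free_A]) auto
    show "finite ((V - Vi i) \<times> F)" using finV F by simp
    show "card (carrier (K i)) dvd card ((V - Vi i) \<times> F)"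
      using F(3) by (cases i) (auto simp: card_cartesian_product k_def)
  qed
  then obtain act2 where act2: "\<And>i. right_action (K i) ((V - Vi i) \<times> F) (act2 i)"
    "\<And>i t a. t \<in> (V - Vi i) \<times> F \<Longrightarrow> a \<in> carrier A \<Longrightarrow> act2 i t (\<phi> i a) = actA t a" by metis
  define act where "act i w = (if w \<in> Vi i \<times> F then act1 i w else act2 i w)" for i w
  have act: "right_action (K i) (V \<times> F) (act i)" for i
  proof -
    have "V \<times> F = Vi i \<times> F \<union> (V - Vi i) \<times> F" using Vi_V by auto
    then show ?thesis
      using right_action_Un[OF act1[of i] act2(1)[of i]] unfolding act_def by auto
  qed
  have act_A: "act i w (\<phi> i a) = actA w a" if "w \<in> V \<times> F" "a \<in> carrier A" for i w a
    using that actA[OF that, of i] act2(2)[of w i a] by (auto simp: act_def)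
  define s where "s = letter_step act"
  have s: "perm_rep gens rels (V \<times> F) s"
    unfolding s_def using act act_A by (intro perm_rep_letter_step) simp_all

  \<comment> \<open>the letters of the words act on the traced cosets by right multiplication\<close>
  have trace: "\<exists>f'\<in>F. fold s (take j w) (H, f) = (H #>\<^bsub>G\<^esub> el (take j w), f')"
    if w: "w \<in> set (v # hs)" and f: "f \<in> F" and "j \<le> length w" for w f j
    using \<open>j \<le> length w\<close>
  proof (induction j)
    case 0
    then show ?case using f HG amalgam.coset_mult_one[of H] by (simp add: one_G)
  next
    case (Suc j)
    then obtain f' where f': "f' \<in> F" "fold s (take j w) (H, f) = (H #>\<^bsub>G\<^esub> el (take j w), f')" by auto
    obtain x b where l: "w ! j = (x, b)" by force
    have tk: "take (Suc j) w = take j w @ [(x, b)]"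
      using Suc.prems l by (simp add: take_Suc_conv_app_nth)
    have "take (Suc j) w \<in> P" "take j w \<in> P" using w Suc.prems unfolding P_def by force+
    then have tw: "take j w \<in> words gens" "x \<in> gens" and V0: "H #>\<^bsub>G\<^esub> el (take j w) \<in> V0"
      using P_words[of "take (Suc j) w"] tk by (auto simp: V0_def)
    define i where "i = (x \<in> X True)"
    have xi: "x \<in> X i" using letter_side[OF tw(2)] by (simp add: i_def)
    then have xw: "[(x, b)] \<in> words (X i)" by simp
    have "fold s (take (Suc j) w) (H, f) = s (x, b) (H #>\<^bsub>G\<^esub> el (take j w), f')"
      using f' tk by simp
    also have "\<dots> = act1 i (H #>\<^bsub>G\<^esub> el (take j w), f') (cls i [(x, b)])"
      using V0_Vi[OF V0] f' by (simp add: s_def letter_step_def act_def i_def)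
    also have "\<dots> = (H #>\<^bsub>G\<^esub> el (take j w) #>\<^bsub>G\<^esub> el [(x, b)], actF i f' (cls i [(x, b)]))"
      by (simp add: act1_def \<iota>_cls[OF xw])
    also have "H #>\<^bsub>G\<^esub> el (take j w) #>\<^bsub>G\<^esub> el [(x, b)] = H #>\<^bsub>G\<^esub> el (take (Suc j) w)"
      using tw HG by (simp add: amalgam.coset_mult_assoc el_closed el_mult tk)
    finally have "fold s (take (Suc j) w) (H, f) =
      (H #>\<^bsub>G\<^esub> el (take (Suc j) w), actF i f' (cls i [(x, b)]))" .
    moreover have "actF i f' (cls i [(x, b)]) \<in> F"
      using right_actionD(2)[OF actF f'(1)] xw carrier_K by blast
    ultimately show ?case by blast
  qed
  have trace': "\<exists>f'\<in>F. fold s w (H, f) = (H #>\<^bsub>G\<^esub> el w, f')" if "w \<in> set (v # hs)" "f \<in> F" for w f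
    using trace[OF that, of "length w"] by simp

  have HV: "H \<in> V"
  proof -
    have "[] \<in> P" by (force simp: P_def)
    then have "H #>\<^bsub>G\<^esub> el [] \<in> V0" by (simp add: V0_def)
    then show ?thesis using V0_Vi Vi_V HG amalgam.coset_mult_one by (fastforce simp: one_G[symmetric])
  qed
  define w0 where "w0 = {H} \<times> F"
  have w0: "w0 \<subseteq> V \<times> F" using HV by (auto simp: w0_def)
  have fix_h: "fold s h ` w0 = w0" if h: "h \<in> set hs" for h
  proof (rule endo_inj_surj)
    show "finite w0" using F by (simp add: w0_def)
    have "el h \<in> H" unfolding H_def using h by (intro generate.incl) auto
    then have Hh: "H #>\<^bsub>G\<^esub> el h = H"
      using amalgam.coset_join2[OF _ H] HG by blast
    show "fold s h ` w0 \<subseteq> w0"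
    proof (rule image_subsetI)
      fix w assume "w \<in> w0"
      then obtain f where "f \<in> F" "w = (H, f)" by (auto simp: w0_def)
      then show "fold s h w \<in> w0" using trace'[of h f] h Hh by (auto simp: w0_def)
    qed
    have "h \<in> words gens" using h hs by blast
    then show "inj_on (fold s h) w0"
      using perm_rep_inv_word(1)[OF s rels_words] w0 by (intro inj_on_inverseI[of _ "fold s (inv_word h)"]) auto
  qed
  have move_v: "fold s v ` w0 \<noteq> w0"
  proof
    assume eq: "fold s v ` w0 = w0"
    obtain f where f: "f \<in> F" using F by blast
    then obtain f' where "fold s v (H, f) = (H #>\<^bsub>G\<^esub> el v, f')" using trace'[of v f] by auto
    moreover have "fold s v (H, f) \<in> w0" using eq f by (auto simp: w0_def)
    ultimately have "H #>\<^bsub>G\<^esub> el v = H" by (simp add: w0_def)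
    then have "el v \<in> H" using amalgam.coset_join1[OF _ el_closed[OF v] H] by blast
    then show False using notin by simp
  qed
  have "card (V \<times> F) \<le> (sum_list (map (\<lambda>w. Suc (length w)) (v # hs)) * (k True + k False)) * (k True * k False)"
    unfolding card_cartesian_product F(3)
    using le_trans[OF cardV mult_le_mono1[OF cardP]] by (intro mult_le_mono1)
  then show ?thesis
    using perm_rep_Pow[OF s] w0 fix_h move_v finV F(1) unfolding k_def
    by (intro exI[of _ "Pow (V \<times> F)"] exI[of _ "\<lambda>l U. s l ` U"] exI[of _ w0] exI[of _ "card (V \<times> F)"])
      (simp add: fold_image card_Pow)
qed

end

section \<open>The normal form theorem\<close>

context finite_amalgam
begin

definition B :: "bool \<Rightarrow> 'x word set set" where
  "B i = \<iota> i ` carrier (K i)"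

lemma B_eq: "B i = el ` words (X i)"
  by (auto simp: B_def carrier_K \<iota>_cls image_image)

lemma \<iota>_group_hom: "group_hom (K i) G (\<iota> i)"
  using \<iota>_hom by (simp add: group_hom_def group_hom_axioms_def factor.is_group amalgam.is_group)

lemma subgroup_B: "subgroup (B i) G"
  unfolding B_def by (rule group_hom.img_is_subgroup[OF \<iota>_group_hom])

sublocale factors: factor_pair G B
  by (intro factor_pair.intro factor_pair_axioms.intro amalgam.is_group subgroup_B)

lemma finite_B: "finite (B i)"
  using finite_factor by (simp add: B_def)

lemma card_B_le: "card (B i) \<le> card (carrier (K i))"
  unfolding B_def by (rule card_image_le[OF finite_factor])

lemma \<iota>\<phi>_common:
  assumes "a \<in> carrier A"
  shows "\<iota> i (\<phi> i a) \<in> B (\<not> i)"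
proof -
  have "\<iota> i (\<phi> i a) = \<iota> (\<not> i) (\<phi> (\<not> i) a)" using \<iota>\<phi>_agree[OF assms] by (cases i) auto
  then show ?thesis using \<phi>_closed[OF assms] by (auto simp: B_def)
qed

text \<open>
  Chosen representatives of the left cosets of \<open>A\<close> in the factors; by \<open>\<alpha>\<close> below, every element is uniquely
  a representative times the image of an element of \<open>A\<close>.
\<close>

definition \<rho> :: "bool \<Rightarrow> 'x word set \<Rightarrow> 'x word set" where
  "\<rho> i k = (SOME x. \<exists>a\<in>carrier A. x = k \<otimes>\<^bsub>K i\<^esub> \<phi> i a)"

lemma \<rho>_ex:
  assumes "k \<in> carrier (K i)"
  shows "\<exists>a\<in>carrier A. \<rho> i k = k \<otimes>\<^bsub>K i\<^esub> \<phi> i a"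
proof -
  have "\<exists>x. \<exists>a\<in>carrier A. x = k \<otimes>\<^bsub>K i\<^esub> \<phi> i a" using A.one_closed by auto
  then show ?thesis unfolding \<rho>_def by (rule someI_ex)
qed

lemma \<rho>_closed: "k \<in> carrier (K i) \<Longrightarrow> \<rho> i k \<in> carrier (K i)"
  using \<rho>_ex[of k i] \<phi>_closed by auto

lemma \<phi>_inv: "a \<in> carrier A \<Longrightarrow> \<phi> i (inv\<^bsub>A\<^esub> a) = inv\<^bsub>K i\<^esub> (\<phi> i a)"
  using \<phi>_mult[of "inv\<^bsub>A\<^esub> a" a i] \<phi>_closed \<phi>_one
  by (intro factor.inv_equality[symmetric]) auto

lemma \<rho>_coset:
  assumes "k \<in> carrier (K i)" "a \<in> carrier A"
  shows "\<rho> i (k \<otimes>\<^bsub>K i\<^esub> \<phi> i a) = \<rho> i k"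
proof -
  have "(\<exists>b\<in>carrier A. x = (k \<otimes>\<^bsub>K i\<^esub> \<phi> i a) \<otimes>\<^bsub>K i\<^esub> \<phi> i b) \<longleftrightarrow> (\<exists>b\<in>carrier A. x = k \<otimes>\<^bsub>K i\<^esub> \<phi> i b)" for x
  proof
    assume "\<exists>b\<in>carrier A. x = (k \<otimes>\<^bsub>K i\<^esub> \<phi> i a) \<otimes>\<^bsub>K i\<^esub> \<phi> i b"
    then obtain b where b: "b \<in> carrier A" "x = (k \<otimes>\<^bsub>K i\<^esub> \<phi> i a) \<otimes>\<^bsub>K i\<^esub> \<phi> i b" by blast
    then have "x = k \<otimes>\<^bsub>K i\<^esub> \<phi> i (a \<otimes>\<^bsub>A\<^esub> b)"
      using assms \<phi>_closed by (simp add: \<phi>_mult factor.m_assoc)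
    then show "\<exists>b\<in>carrier A. x = k \<otimes>\<^bsub>K i\<^esub> \<phi> i b" using assms b A.m_closed by blast
  next
    assume "\<exists>b\<in>carrier A. x = k \<otimes>\<^bsub>K i\<^esub> \<phi> i b"
    then obtain b where b: "b \<in> carrier A" "x = k \<otimes>\<^bsub>K i\<^esub> \<phi> i b" by blast
    have "a \<otimes>\<^bsub>A\<^esub> (inv\<^bsub>A\<^esub> a \<otimes>\<^bsub>A\<^esub> b) = b" using assms b by (simp add: A.m_assoc[symmetric])
    then have "\<phi> i a \<otimes>\<^bsub>K i\<^esub> \<phi> i (inv\<^bsub>A\<^esub> a \<otimes>\<^bsub>A\<^esub> b) = \<phi> i b"
      using \<phi>_mult[of a "inv\<^bsub>A\<^esub> a \<otimes>\<^bsub>A\<^esub> b" i] assms b by simp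
    then have "x = (k \<otimes>\<^bsub>K i\<^esub> \<phi> i a) \<otimes>\<^bsub>K i\<^esub> \<phi> i (inv\<^bsub>A\<^esub> a \<otimes>\<^bsub>A\<^esub> b)"
      using assms b \<phi>_closed by (simp add: factor.m_assoc)
    then show "\<exists>b\<in>carrier A. x = (k \<otimes>\<^bsub>K i\<^esub> \<phi> i a) \<otimes>\<^bsub>K i\<^esub> \<phi> i b" using assms b by blast
  qed
  then show ?thesis unfolding \<rho>_def by presburger
qed

lemma \<phi>_image_coset:
  assumes "k \<in> carrier (K i)" "a \<in> carrier A"
  shows "k \<otimes>\<^bsub>K i\<^esub> \<phi> i a \<in> \<phi> i ` carrier A \<longleftrightarrow> k \<in> \<phi> i ` carrier A"
proof
  assume "k \<otimes>\<^bsub>K i\<^esub> \<phi> i a \<in> \<phi> i ` carrier A"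
  then obtain b where b: "b \<in> carrier A" "k \<otimes>\<^bsub>K i\<^esub> \<phi> i a = \<phi> i b" by blast
  have "k = (k \<otimes>\<^bsub>K i\<^esub> \<phi> i a) \<otimes>\<^bsub>K i\<^esub> inv\<^bsub>K i\<^esub> (\<phi> i a)"
    using assms \<phi>_closed by (simp add: factor.m_assoc)
  also have "\<dots> = \<phi> i (b \<otimes>\<^bsub>A\<^esub> inv\<^bsub>A\<^esub> a)" using assms b by (simp add: \<phi>_mult \<phi>_inv)
  finally show "k \<in> \<phi> i ` carrier A" using assms b by blast
next
  assume "k \<in> \<phi> i ` carrier A"
  then obtain b where "b \<in> carrier A" "k = \<phi> i b" by blast
  then show "k \<otimes>\<^bsub>K i\<^esub> \<phi> i a \<in> \<phi> i ` carrier A"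
    using assms \<phi>_mult[of b a i, symmetric] by auto
qed

definition \<alpha> :: "bool \<Rightarrow> 'x word set \<Rightarrow> 'a" where
  "\<alpha> i k = (SOME a. a \<in> carrier A \<and> k = \<rho> i k \<otimes>\<^bsub>K i\<^esub> \<phi> i a)"

lemma \<alpha>:
  assumes "k \<in> carrier (K i)"
  shows "\<alpha> i k \<in> carrier A" "\<rho> i k \<otimes>\<^bsub>K i\<^esub> \<phi> i (\<alpha> i k) = k"
proof -
  obtain a where a: "a \<in> carrier A" "\<rho> i k = k \<otimes>\<^bsub>K i\<^esub> \<phi> i a" using \<rho>_ex[OF assms] by blast
  have "inv\<^bsub>A\<^esub> a \<in> carrier A \<and> k = \<rho> i k \<otimes>\<^bsub>K i\<^esub> \<phi> i (inv\<^bsub>A\<^esub> a)"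
    using a assms \<phi>_closed by (simp add: \<phi>_inv factor.m_assoc)
  then have "\<alpha> i k \<in> carrier A \<and> k = \<rho> i k \<otimes>\<^bsub>K i\<^esub> \<phi> i (\<alpha> i k)" unfolding \<alpha>_def by (rule someI)
  then show "\<alpha> i k \<in> carrier A" "\<rho> i k \<otimes>\<^bsub>K i\<^esub> \<phi> i (\<alpha> i k) = k" by auto
qed

lemma \<rho>_idem: "k \<in> carrier (K i) \<Longrightarrow> \<rho> i (\<rho> i k) = \<rho> i k"
  using \<rho>_ex[of k i] \<rho>_coset[of k i] by auto

lemma \<rho>_image: "k \<in> carrier (K i) \<Longrightarrow> \<rho> i k \<in> \<phi> i ` carrier A \<longleftrightarrow> k \<in> \<phi> i ` carrier A"
  using \<rho>_ex[of k i] \<phi>_image_coset[of k i] by metis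

lemma \<alpha>_rep:
  assumes "s \<in> carrier (K i)" "\<rho> i s = s" "a \<in> carrier A"
  shows "\<alpha> i (s \<otimes>\<^bsub>K i\<^esub> \<phi> i a) = a"
proof -
  let ?k = "s \<otimes>\<^bsub>K i\<^esub> \<phi> i a"
  have k: "?k \<in> carrier (K i)" using assms \<phi>_closed by simp
  have "\<rho> i ?k = s" using \<rho>_coset[OF assms(1,3)] assms(2) by simp
  then have "s \<otimes>\<^bsub>K i\<^esub> \<phi> i (\<alpha> i ?k) = s \<otimes>\<^bsub>K i\<^esub> \<phi> i a" using \<alpha>(2)[OF k] by simp
  then have "\<phi> i (\<alpha> i ?k) = \<phi> i a" using assms \<phi>_closed \<alpha>(1)[OF k] by simp
  then show ?thesis using \<phi>_inj \<alpha>(1)[OF k] assms(3) by (auto dest: inj_onD)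
qed

fun topped :: "bool \<Rightarrow> (bool \<times> 'x word set) list \<Rightarrow> bool" where
  "topped i [] = False"
| "topped i ((j, s) # st) = (i = j)"

fun valid :: "(bool \<times> 'x word set) list \<Rightarrow> bool" where
  "valid [] = True"
| "valid ((i, s) # st) = (s \<in> carrier (K i) \<and> s \<notin> \<phi> i ` carrier A \<and> \<rho> i s = s \<and>
     \<not> topped i st \<and> valid st)"

text \<open>
  Normal forms: the product of a stack of coset representatives, alternately from the two factors and
  none of them in \<open>A\<close>, followed by one element of \<open>A\<close>. The top of the stack is the rightmost
  representative, next to the element of \<open>A\<close>.
\<close>

definition \<Omega> :: "((bool \<times> 'x word set) list \<times> 'a) set" where
  "\<Omega> = {(st, a). valid st \<and> a \<in> carrier A}"

text \<open>
  Splitting off the rightmost factor from \<open>i\<close> identifies \<open>\<Omega>\<close> with the pairs of a stack that does not end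
  in factor \<open>i\<close> and an arbitrary element of that factor, and the factor acts on these pairs by
  multiplication. Merging and cancellation of syllables become ordinary multiplication in this way, and
  both factors induce on \<open>\<Omega>\<close> the same action of \<open>A\<close>.
\<close>

definition \<Omega>' :: "bool \<Rightarrow> ((bool \<times> 'x word set) list \<times> 'x word set) set" where
  "\<Omega>' i = {(st, k). valid st \<and> \<not> topped i st \<and> k \<in> carrier (K i)}"

definition unpack :: "bool \<Rightarrow> (bool \<times> 'x word set) list \<times> 'a \<Rightarrow> (bool \<times> 'x word set) list \<times> 'x word set" where
  "unpack i w = (if topped i (fst w) then (tl (fst w), snd (hd (fst w)) \<otimes>\<^bsub>K i\<^esub> \<phi> i (snd w))
     else (fst w, \<phi> i (snd w)))"

definition pack :: "bool \<Rightarrow> (bool \<times> 'x word set) list \<times> 'x word set \<Rightarrow> (bool \<times> 'x word set) list \<times> 'a" where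
  "pack i p = (if snd p \<in> \<phi> i ` carrier A then (fst p, inv_into (carrier A) (\<phi> i) (snd p))
     else ((i, \<rho> i (snd p)) # fst p, \<alpha> i (snd p)))"

lemma topped_cases: "topped i st \<Longrightarrow> \<exists>s st'. st = (i, s) # st'"
  by (cases st) auto

lemma pack_unpack: "w \<in> \<Omega> \<Longrightarrow> pack i (unpack i w) = w \<and> unpack i w \<in> \<Omega>' i"
proof -
  assume "w \<in> \<Omega>"
  then obtain st a where w: "w = (st, a)" "valid st" "a \<in> carrier A" by (auto simp: \<Omega>_def)
  show ?thesis
  proof (cases "topped i st")
    case True
    then obtain s st' where st: "st = (i, s) # st'" using topped_cases by blast
    then show ?thesis
      using w \<phi>_closed by (simp add: pack_def unpack_def \<Omega>'_def \<phi>_image_coset \<rho>_coset \<alpha>_rep)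
  next
    case False
    then show ?thesis
      using w \<phi>_closed \<phi>_inj by (simp add: pack_def unpack_def \<Omega>'_def)
  qed
qed

lemma unpack_pack: "p \<in> \<Omega>' i \<Longrightarrow> unpack i (pack i p) = p \<and> pack i p \<in> \<Omega>"
proof -
  assume "p \<in> \<Omega>' i"
  then obtain st k where p: "p = (st, k)" "valid st" "\<not> topped i st" "k \<in> carrier (K i)"
    by (auto simp: \<Omega>'_def)
  show ?thesis
  proof (cases "k \<in> \<phi> i ` carrier A")
    case True
    then show ?thesis
      using p by (auto simp: pack_def unpack_def \<Omega>_def f_inv_into_f inv_into_into)
  next
    case False
    then show ?thesis
      using p by (simp add: pack_def unpack_def \<Omega>_def \<alpha> \<rho>_closed \<rho>_idem \<rho>_image)
  qed
qed

lemma bij_unpack: "bij_betw (unpack i) \<Omega> (\<Omega>' i)"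
  by (rule bij_betw_byWitness[of _ "pack i"]) (use pack_unpack unpack_pack in auto)

lemma inv_unpack: "p \<in> \<Omega>' i \<Longrightarrow> inv_into \<Omega> (unpack i) p = pack i p"
  using unpack_pack[of p i] bij_unpack[of i] by (metis bij_betw_def inv_into_f_f)

definition \<Omega>act :: "bool \<Rightarrow> (bool \<times> 'x word set) list \<times> 'a \<Rightarrow> 'x word set \<Rightarrow> (bool \<times> 'x word set) list \<times> 'a" where
  "\<Omega>act i w g = inv_into \<Omega> (unpack i) (fst (unpack i w), snd (unpack i w) \<otimes>\<^bsub>K i\<^esub> g)"

lemma right_action_\<Omega>: "right_action (K i) \<Omega> (\<Omega>act i)"
proof -
  have "right_action (K i) (\<Omega>' i) (\<lambda>p g. (fst p, snd p \<otimes>\<^bsub>K i\<^esub> g))"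
    by (auto simp: right_action_def \<Omega>'_def factor.m_assoc)
  from right_action_transport[OF this bij_unpack] show ?thesis unfolding \<Omega>act_def .
qed

lemma \<Omega>act_A:
  assumes "w \<in> \<Omega>" "a \<in> carrier A"
  shows "\<Omega>act i w (\<phi> i a) = (fst w, snd w \<otimes>\<^bsub>A\<^esub> a)"
proof -
  obtain st b where w: "w = (st, b)" "valid st" "b \<in> carrier A" using assms by (auto simp: \<Omega>_def)
  have in\<Omega>: "(st, b \<otimes>\<^bsub>A\<^esub> a) \<in> \<Omega>" using w assms by (simp add: \<Omega>_def)
  have "unpack i (st, b \<otimes>\<^bsub>A\<^esub> a) = (fst (unpack i w), snd (unpack i w) \<otimes>\<^bsub>K i\<^esub> \<phi> i a)"
  proof (cases "topped i st")
    case True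
    then obtain s st' where st: "st = (i, s) # st'" using topped_cases by blast
    then show ?thesis
      using w assms \<phi>_closed by (simp add: unpack_def \<phi>_mult factor.m_assoc)
  next
    case False
    then show ?thesis using w assms by (simp add: unpack_def \<phi>_mult)
  qed
  then show ?thesis
    using inv_into_f_f[OF bij_betw_imp_inj_on[OF bij_unpack] in\<Omega>, of i] w by (simp add: \<Omega>act_def)
qed

lemma \<Omega>act_push:
  assumes "(st, a) \<in> \<Omega>" "\<not> topped i st" "k \<in> carrier (K i)" "k \<notin> \<phi> i ` carrier A"
  shows "\<exists>s b. \<Omega>act i (st, a) k = ((i, s) # st, b)"
proof -
  have a: "valid st" "a \<in> carrier A" using assms by (auto simp: \<Omega>_def)
  let ?k = "\<phi> i a \<otimes>\<^bsub>K i\<^esub> k"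
  have k: "?k \<in> carrier (K i)" using a assms \<phi>_closed by simp
  have "?k \<notin> \<phi> i ` carrier A"
  proof
    assume "?k \<in> \<phi> i ` carrier A"
    then obtain b where b: "b \<in> carrier A" "?k = \<phi> i b" by blast
    have "k = inv\<^bsub>K i\<^esub> (\<phi> i a) \<otimes>\<^bsub>K i\<^esub> ?k"
      using a assms \<phi>_closed by (simp add: factor.m_assoc[symmetric])
    also have "\<dots> = \<phi> i (inv\<^bsub>A\<^esub> a \<otimes>\<^bsub>A\<^esub> b)" using a b by (simp add: \<phi>_mult \<phi>_inv)
    finally show False using a b assms(4) by blast
  qed
  moreover have "(st, ?k) \<in> \<Omega>' i" using a assms k by (simp add: \<Omega>'_def)
  ultimately show ?thesis
    using inv_unpack[of "(st, ?k)" i] assms(2) by (simp add: \<Omega>act_def unpack_def pack_def)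
qed

lemma perm_rep_\<Omega>: "perm_rep gens rels \<Omega> (letter_step \<Omega>act)"
  using right_action_\<Omega> \<Omega>act_A by (intro perm_rep_letter_step) simp_all

text \<open>
  Every factor of a reduced product pushes one entry, since it lies outside \<open>A\<close> and comes from the factor
  that is not on top.
\<close>

lemma fold_\<Omega>_red:
  "factors.red i j n x \<Longrightarrow> u \<in> words gens \<Longrightarrow> el u = x \<Longrightarrow> (st, a) \<in> \<Omega> \<Longrightarrow> \<not> topped i st \<Longrightarrow>
    length (fst (fold (letter_step \<Omega>act) u (st, a))) = length st + n"
proof (induction arbitrary: u st a rule: factors.red.induct)
  note same = perm_rep_pres_eq[OF perm_rep_\<Omega> rels_words]
  have push: "\<exists>v s b. v \<in> words (X i) \<and> g = el v \<and> fold (letter_step \<Omega>act) v (st, a) = ((i, s) # st, b)"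
    if g: "g \<in> B i" "g \<notin> B (\<not> i)" and st: "(st, a) \<in> \<Omega>" "\<not> topped i st" for g i st a
  proof -
    obtain v where v: "v \<in> words (X i)" "g = el v" using g by (auto simp: B_eq)
    have k: "cls i v \<in> carrier (K i)" using v carrier_K by auto
    have "cls i v \<notin> \<phi> i ` carrier A" using g v \<iota>\<phi>_common[of _ i] \<iota>_cls by force
    from \<Omega>act_push[OF st k this] show ?thesis
      using fold_letter_step[where act = \<Omega>act and i = i, OF right_action_\<Omega> v(1) st(1)] v by auto
  qed
  {
    case (single g i)
    obtain v s b where v: "v \<in> words (X i)" "g = el v"
      "fold (letter_step \<Omega>act) v (st, a) = ((i, s) # st, b)"
      using push[OF single.hyps single.prems(3,4)] by blast
    have "pres_eq gens rels u v"
      using v single.prems(1,2) word_class_eq_iff[OF rels_words] words_gens by blast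
    from same[OF this single.prems(3)] v(3) show ?case by simp
  next
    case (cons g i j n x)
    obtain v s b where v: "v \<in> words (X i)" "g = el v"
      "fold (letter_step \<Omega>act) v (st, a) = ((i, s) # st, b)"
      using push[OF cons.hyps(1,2) cons.prems(3,4)] by blast
    have "x \<in> carrier G" using cons.hyps(3) factors.red_closed by blast
    then obtain u' where u': "u' \<in> words gens" "el u' = x" by (auto simp: carrier_G)
    have vX: "v \<in> words gens" using words_gens[OF v(1)] .
    have "el u = el (v @ u')" using cons.prems(2) v u' vX by (simp add: el_mult[symmetric])
    then have "pres_eq gens rels u (v @ u')"
      using cons.prems(1) vX u' word_class_eq_iff[OF rels_words] by simp
    from same[OF this cons.prems(3)]
    have *: "fold (letter_step \<Omega>act) u (st, a) = fold (letter_step \<Omega>act) u' ((i, s) # st, b)"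
      using v(3) by simp
    have "((i, s) # st, b) \<in> \<Omega>"
      using perm_rep_closed[OF perm_rep_\<Omega> words_gens[OF v(1)] cons.prems(3)] v(3) by simp
    from cons.IH[OF u' this] show ?case unfolding * by simp
  }
qed

sublocale free_factors: free_factor_pair G B
proof
  fix i j n x
  assume red: "factors.red i j n x"
  show "x \<noteq> \<one>\<^bsub>G\<^esub>"
  proof
    assume "x = \<one>\<^bsub>G\<^esub>"
    moreover have "([], \<one>\<^bsub>A\<^esub>) \<in> \<Omega>" by (simp add: \<Omega>_def)
    ultimately have "n = 0" using fold_\<Omega>_red[OF red, of "[]" "[]" "\<one>\<^bsub>A\<^esub>"] by (simp add: one_G)
    then show False using factors.red_pos[OF red] by simp
  qed
qed

end

section \<open>Bounding the least power by word lengths\<close>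

context finite_amalgam
begin

lemma el_inv: "u \<in> words gens \<Longrightarrow> inv\<^bsub>G\<^esub> (el u) = el (inv_word u)"
proof (rule amalgam.inv_equality)
  assume u: "u \<in> words gens"
  have "pres_eq gens rels (inv_word u @ u) []" by (rule pres_eq_inv_word[OF u])
  then show "el (inv_word u) \<otimes>\<^bsub>G\<^esub> el u = \<one>\<^bsub>G\<^esub>"
    using u word_class_eq_iff[OF rels_words] by (simp add: el_mult one_G)
qed (simp_all add: el_closed)

lemma words_power: "u \<in> words X' \<Longrightarrow> concat (replicate n u) \<in> words X'"
  by (induction n) auto

lemma el_power: "u \<in> words gens \<Longrightarrow> el u [^]\<^bsub>G\<^esub> n = el (concat (replicate n u))"
proof (induction n)
  case 0
  show ?case by (simp add: one_G)
next
  case (Suc n)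
  have "concat (replicate n u) @ u = u @ concat (replicate n u)" by (induction n) auto
  then show ?case using Suc by (simp add: el_mult words_power)
qed

lemma fold_power: "fold s (concat (replicate n u)) = fold s u ^^ n"
  by (induction n) (simp_all add: funpow_Suc_right del: funpow.simps)

lemma factor_prod_el: "u \<in> words gens \<Longrightarrow> factors.factor_prod (length u) (el u)"
proof (induction u rule: rev_induct)
  case Nil
  show ?case using factors.factor_prod.one by (simp add: one_G)
next
  case (snoc l u)
  obtain x b where l: "l = (x, b)" by force
  have x: "u \<in> words gens" "x \<in> gens" using snoc.prems l by auto
  have "el [l] \<in> B (x \<in> X True)" using letter_side[OF x(2)] l by (auto simp: B_eq)
  from factors.factor_prod.snoc[OF snoc.IH[OF x(1)] this] show ?case
    using x l by (simp add: el_mult)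
qed

text \<open>
  The prefixes of a generator form a path to it. Paths for inverses and products arise by translation with
  elements of \<open>H\<close>, which maps \<open>H <#> P\<close> to itself.
\<close>

lemma subgroup_path:
  fixes hs
  defines "H \<equiv> generate G (el ` set hs)"
    and "P \<equiv> insert \<one>\<^bsub>G\<^esub> (el ` (\<Union>w\<in>set hs. (\<lambda>i. take i w) ` {..length w}))"
  assumes hs: "set hs \<subseteq> words gens"
  shows "P \<subseteq> carrier G"
    and "\<And>h. h \<in> H \<Longrightarrow> factors.path (H <#>\<^bsub>G\<^esub> P) \<one>\<^bsub>G\<^esub> h"
proof -
  have pre: "take j w \<in> words gens" if "w \<in> set hs" for j w
  proof -
    have "take j w @ drop j w \<in> words gens" using that hs by auto
    then show ?thesis by (simp only: words_append)
  qed
  show PG: "P \<subseteq> carrier G" using pre el_closed by (auto simp: P_def)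
  have elG: "el ` set hs \<subseteq> carrier G" using hs el_closed by auto
  have H: "subgroup H G" unfolding H_def by (rule amalgam.generate_is_subgroup[OF elG])
  then have HG: "H \<subseteq> carrier G" by (rule subgroup.subset)
  define L where "L = H <#>\<^bsub>G\<^esub> P"
  have LG: "L \<subseteq> carrier G" unfolding L_def by (rule amalgam.set_mult_closed[OF HG PG])
  have HP: "h \<otimes>\<^bsub>G\<^esub> p \<in> L" if "h \<in> H" "p \<in> P" for h p
    using that by (auto simp: L_def set_mult_def)
  have PL: "p \<in> L" if "p \<in> P" for p
    using HP[OF subgroup.one_closed[OF H] that] that PG by auto
  have tr: "(\<lambda>k. h \<otimes>\<^bsub>G\<^esub> k) ` L \<subseteq> L" if h: "h \<in> H" for h
  proof (rule image_subsetI)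
    fix k assume "k \<in> L"
    then obtain h' p where k: "h' \<in> H" "p \<in> P" "k = h' \<otimes>\<^bsub>G\<^esub> p" by (auto simp: L_def set_mult_def)
    have "h \<otimes>\<^bsub>G\<^esub> k = (h \<otimes>\<^bsub>G\<^esub> h') \<otimes>\<^bsub>G\<^esub> p"
      using k h HG PG by (auto simp: amalgam.m_assoc subset_iff)
    then show "h \<otimes>\<^bsub>G\<^esub> k \<in> L" using HP[OF subgroup.m_closed[OF H h k(1)] k(2)] by simp
  qed
  have shift: "factors.path L (h \<otimes>\<^bsub>G\<^esub> x) (h \<otimes>\<^bsub>G\<^esub> y)" if "h \<in> H" "factors.path L x y" for h x y
    using factors.path_mono[OF factors.path_translate[OF _ LG that(2)] tr[OF that(1)]] that(1) HG by blast
  have gen: "factors.path L \<one>\<^bsub>G\<^esub> (el (take j w))" if w: "w \<in> set hs" and "j \<le> length w" for w j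
    using \<open>j \<le> length w\<close>
  proof (induction j)
    case 0
    have "\<one>\<^bsub>G\<^esub> \<in> L" using PL by (simp add: P_def)
    then show ?case using factors.path.refl by (simp add: one_G)
  next
    case (Suc j)
    obtain x b where l: "w ! j = (x, b)" by force
    have tk: "take (Suc j) w = take j w @ [(x, b)]"
      using Suc.prems l by (simp add: take_Suc_conv_app_nth)
    have tw: "take j w \<in> words gens" "x \<in> gens" using pre[OF w, of j] pre[OF w, of "Suc j"] tk by auto
    have "el (take (Suc j) w) \<in> P" using w Suc.prems unfolding P_def by blast
    then have inL: "el (take (Suc j) w) \<in> L" by (rule PL)
    have lx: "[(x, b)] \<in> words (X (x \<in> X True))" using letter_side[OF tw(2)] by simp
    have "el (take (Suc j) w) = el (take j w) \<otimes>\<^bsub>G\<^esub> el [(x, b)]" using tk tw by (simp add: el_mult)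
    then have "inv\<^bsub>G\<^esub> (el (take j w)) \<otimes>\<^bsub>G\<^esub> el (take (Suc j) w) = el [(x, b)]"
      using tw by (simp add: el_closed)
    also have "\<dots> \<in> B (x \<in> X True)" using lx unfolding B_eq by (rule imageI)
    finally show ?case using factors.path.step[OF Suc.IH inL] Suc.prems by simp
  qed
  have "factors.path L \<one>\<^bsub>G\<^esub> h" if "h \<in> H" for h
    using that unfolding H_def
  proof (induction rule: generate.induct)
    case one
    show ?case using factors.path.refl PL by (simp add: P_def)
  next
    case (incl h)
    then obtain w where "w \<in> set hs" "h = el w" by blast
    then show ?case using gen[of w "length w"] by simp
  next
    case (inv h)
    then obtain w where w: "w \<in> set hs" "h = el w" by blast
    have hG: "h \<in> carrier G" using inv elG by blast
    have iH: "inv\<^bsub>G\<^esub> h \<in> H" unfolding H_def using inv by (rule generate.inv)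
    have "factors.path L h \<one>\<^bsub>G\<^esub>"
      using gen[of w "length w"] w factors.path_sym[OF _ LG] by simp
    from shift[OF iH this] show ?case using hG by simp
  next
    case (eng h1 h2)
    have h1: "h1 \<in> H" using eng.hyps by (simp add: H_def)
    have "factors.path L h1 (h1 \<otimes>\<^bsub>G\<^esub> h2)" using shift[OF h1 eng.IH(2)] h1 HG by auto
    then show ?case using eng.IH(1) factors.path_trans by blast
  qed
  then show "\<And>h. h \<in> H \<Longrightarrow> factors.path (H <#>\<^bsub>G\<^esub> P) \<one>\<^bsub>G\<^esub> h" unfolding L_def .
qed

lemma least_power_bound_length:
  fixes hs g
  defines "H \<equiv> generate G (el ` set hs)"
  assumes hs: "set hs \<subseteq> words gens" and g: "g \<in> words gens"
    and n: "0 < n" "el g [^]\<^bsub>G\<^esub> (n::nat) \<in> H" "el g [^]\<^bsub>G\<^esub> n \<noteq> \<one>\<^bsub>G\<^esub>"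
  shows "\<exists>m. 0 < m \<and>
    m \<le> (Suc (sum_list (map (\<lambda>w. Suc (length w)) hs)) + Suc (length g)) *
      (card (carrier (K True)) + card (carrier (K False))) \<and>
    el g [^]\<^bsub>G\<^esub> m \<in> H \<and> el g [^]\<^bsub>G\<^esub> m \<noteq> \<one>\<^bsub>G\<^esub>"
proof -
  define P where "P = insert \<one>\<^bsub>G\<^esub> (el ` (\<Union>w\<in>set hs. (\<lambda>i. take i w) ` {..length w}))"
  have elG: "el ` set hs \<subseteq> carrier G" using hs el_closed by auto
  have H: "subgroup H G" unfolding H_def by (rule amalgam.generate_is_subgroup[OF elG])
  have P: "finite P" "P \<subseteq> carrier G" using subgroup_path(1)[OF hs] by (simp_all add: P_def)
  have conn: "factors.path (H <#>\<^bsub>G\<^esub> P) \<one>\<^bsub>G\<^esub> h" if "h \<in> H" for h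
    using subgroup_path(2)[OF hs] that unfolding P_def H_def .
  have "card P \<le> Suc (card (el ` (\<Union>w\<in>set hs. (\<lambda>i. take i w) ` {..length w})))"
    unfolding P_def by (simp add: card_insert_if)
  also have "\<dots> \<le> Suc (card (\<Union>w\<in>set hs. (\<lambda>i. take i w) ` {..length w}))"
    by (simp add: card_image_le)
  also have "\<dots> \<le> Suc (sum_list (map (\<lambda>w. Suc (length w)) hs))" using card_prefixes by simp
  finally have cP: "card P \<le> Suc (sum_list (map (\<lambda>w. Suc (length w)) hs))" .
  obtain m where m: "0 < m" "m \<le> (card P + Suc (length g)) * (card (B True) + card (B False))"
    "el g [^]\<^bsub>G\<^esub> m \<in> H" "el g [^]\<^bsub>G\<^esub> m \<noteq> \<one>\<^bsub>G\<^esub>"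
    using free_factors.least_power_bound[OF H P conn finite_B factor_prod_el[OF g] n] by blast
  note m(2)
  also have "(card P + Suc (length g)) * (card (B True) + card (B False)) \<le>
    (Suc (sum_list (map (\<lambda>w. Suc (length w)) hs)) + Suc (length g)) *
      (card (carrier (K True)) + card (carrier (K False)))"
    by (intro mult_le_mono add_le_mono card_B_le cP le_refl)
  finally show ?thesis using m by blast
qed

end

section \<open>Finite actions as certificates\<close>

lemma sum_length_le_encode_words:
  "sum_list (map (\<lambda>w. Suc (length w)) hs) \<le> encode_words c hs"
proof (induction hs)
  case (Cons h hs)
  have "length h \<le> encode_word c h"
    using length_le_list_encode[of "map (\<lambda>(x, b). prod_encode (c x, of_bool b)) h"]
    by (simp add: encode_word_def)
  moreover have "n \<le> triangle n" for n by (cases n) simp_all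
  then have "a + b \<le> prod_encode (a, b)" for a b by (simp add: prod_encode_def trans_le_add1)
  from this[of "encode_word c h" "encode_words c hs"]
  have "Suc (encode_word c h + encode_words c hs) \<le> encode_words c (h # hs)"
    by (simp add: encode_words_def)
  ultimately show ?case using Cons by simp
qed simp

locale coded_finite_amalgam = finite_amalgam X S A Y \<phi>
  for X :: "bool \<Rightarrow> 'x set" and S :: "bool \<Rightarrow> 'x word set"
    and A :: "('a, 'm) monoid_scheme" and Y :: "'a set"
    and \<phi> :: "bool \<Rightarrow> 'a \<Rightarrow> 'x word set" +
  fixes c :: "'x \<Rightarrow> nat"
  assumes finite_X: "\<And>i. finite (X i)" and finite_S: "\<And>i. finite (S i)"
    and inj_c: "inj_on c (X True \<union> X False)"
begin

definition letter_code :: "'x \<times> bool \<Rightarrow> nat" where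
  "letter_code l = (case l of (x, b) \<Rightarrow> prod_encode (c x, of_bool b))"

lemma encode_word_eq: "encode_word c u = list_encode (map letter_code u)"
  unfolding encode_word_def by (rule arg_cong[of _ _ list_encode]) (simp add: letter_code_def)

lemma letter_code_inj: "inj_on letter_code (gens \<times> UNIV)"
  using inj_c by (auto simp: inj_on_def letter_code_def gens_def)

lemma finite_letters: "finite (gens \<times> (UNIV :: bool set))"
  using finite_X by (simp add: gens_def)

lemma finite_Y: "finite Y"
proof -
  have "\<phi> True ` carrier A \<subseteq> carrier (K True)" using \<phi>_closed by blast
  then have "finite (carrier A)" using finite_factor \<phi>_inj inj_on_finite by blast
  then show ?thesis using Y_subset finite_subset by blast
qed

text \<open>
  \<^const>\<open>amalgam_relators\<close> is in general infinite; one word for each element of \<open>Y\<close> is enough for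
  the test of a certificate.
\<close>

definition core_rels :: "'x word set" where
  "core_rels = S True \<union> S False \<union> (\<lambda>a. (SOME u. u \<in> \<phi> True a) @ inv_word (SOME v. v \<in> \<phi> False a)) ` Y"

lemma finite_core_rels: "finite core_rels"
  using finite_S finite_Y by (simp add: core_rels_def)

lemma some_rep: "a \<in> Y \<Longrightarrow> (SOME u. u \<in> \<phi> i a) \<in> \<phi> i a"
proof (rule someI_ex)
  assume "a \<in> Y"
  then have "\<phi> i a \<in> carrier (K i)" using Y_subset \<phi>_closed by blast
  then obtain u where "u \<in> words (X i)" "\<phi> i a = cls i u" by (auto simp: carrier_K)
  then show "\<exists>u. u \<in> \<phi> i a" using cls_self by blast
qed

lemma core_rels_subset: "core_rels \<subseteq> rels"
proof -
  have "(SOME u. u \<in> \<phi> True a) @ inv_word (SOME v. v \<in> \<phi> False a) \<in> amalgam_relators Y (\<phi> True) (\<phi> False)"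
    if "a \<in> Y" for a
    unfolding amalgam_relators_def using that some_rep[OF that] by blast
  then show ?thesis unfolding core_rels_def rels_def by blast
qed

text \<open>
  Two representatives of the same element of a factor act in the same way because the relators of the
  factors act trivially.
\<close>

lemma perm_rep_core_rels:
  assumes s: "perm_rep gens core_rels W s"
  shows "perm_rep gens rels W s"
proof -
  have si: "perm_rep (X i) (S i) W s" for i
    using s by (cases i) (auto simp: perm_rep_def gens_def core_rels_def)
  note cl = perm_rep_closed[OF si] and inv_v = perm_rep_inv_word[OF si S_words]
  have same: "fold s u w = fold s v w"
    if "a \<in> Y" "u \<in> \<phi> i a" "v \<in> \<phi> i a" "w \<in> W" for a u v i w
  proof -
    have "\<phi> i a \<in> carrier (K i)" using that(1) Y_subset \<phi>_closed by blast
    from in_cls[OF this that(2)] in_cls[OF this that(3)] have "pres_eq (X i) (S i) u v"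
      using word_class_eq_iff[OF S_words] by metis
    then show ?thesis using perm_rep_pres_eq[OF si S_words] that(4) by blast
  qed
  have rep_words: "u \<in> words (X i)" if "a \<in> Y" "u \<in> \<phi> i a" for a u i
  proof -
    have "\<phi> i a \<in> carrier (K i)" using that(1) Y_subset \<phi>_closed by blast
    then show ?thesis using in_cls(1) that(2) by blast
  qed
  have "fold s (u @ inv_word v) w = w"
    if a: "a \<in> Y" and u: "u \<in> \<phi> True a" and v: "v \<in> \<phi> False a" and w: "w \<in> W" for a u v w
  proof -
    define u0 where "u0 = (SOME u. u \<in> \<phi> True a)"
    define v0 where "v0 = (SOME v. v \<in> \<phi> False a)"
    have u0: "u0 \<in> \<phi> True a" and v0: "v0 \<in> \<phi> False a"
      unfolding u0_def v0_def by (rule some_rep[OF a])+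
    have "u0 @ inv_word v0 \<in> core_rels" using a by (auto simp: core_rels_def u0_def v0_def)
    then have 1: "fold s (inv_word v0) (fold s u0 w) = w" using s w by (auto simp: perm_rep_def)
    have "fold s u0 w \<in> W" using cl rep_words[OF a u0] w by blast
    then have "fold s u0 w = fold s v0 w"
      using inv_v(2)[OF rep_words[OF a v0], of "fold s u0 w"] 1 by simp
    then have "fold s u w = fold s v w"
      using same[OF a u u0 w] same[OF a v v0 w] by simp
    then show ?thesis using inv_v(1)[OF rep_words[OF a v] w] by simp
  qed
  then show ?thesis
    using s by (auto simp: perm_rep_def rels_def core_rels_def amalgam_relators_def)
qed

definition inverse_codes :: "(nat \<times> nat) set" where
  "inverse_codes = (\<lambda>(x, b). (letter_code (x, b), letter_code (x, \<not> b))) ` (gens \<times> UNIV)"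

definition relator_codes :: "nat set" where
  "relator_codes = encode_word c ` core_rels"

lemma finite_inverse_codes: "finite inverse_codes" and finite_relator_codes: "finite relator_codes"
  using finite_letters finite_core_rels by (simp_all add: inverse_codes_def relator_codes_def)

definition code_step :: "nat \<Rightarrow> 'x \<times> bool \<Rightarrow> nat \<Rightarrow> nat" where
  "code_step z l = table_step z (letter_code l)"

lemma table_run_encode_word: "table_run z (encode_word c u) = fold (code_step z) u"
  by (simp add: fun_eq_iff encode_word_eq table_run_list_encode fold_map code_step_def[abs_def] comp_def)

lemma fold_code_step_beyond: "z \<le> w \<Longrightarrow> fold (code_step z) u w = w"
  by (induction u) (simp_all add: code_step_def table_step_beyond)

lemma code_nth_encode_words:
  "i < length hs \<Longrightarrow> code_nth (encode_words c hs) i = encode_word c (hs ! i)"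
  "\<not> i < length hs \<Longrightarrow> code_nth (encode_words c hs) i = encode_word c []"
  by (simp_all add: encode_words_def code_nth_list_encode encode_word_def)

lemma table_cert_iff:
  assumes "set hs \<subseteq> words gens"
  shows "table_cert inverse_codes relator_codes z (encode_words c hs) (encode_word c g) n \<longleftrightarrow>
    perm_rep gens rels UNIV (code_step z) \<and> (\<forall>h\<in>set hs. fold (code_step z) h 0 = 0) \<and>
    fold (code_step z) (concat (replicate n g)) 0 \<noteq> 0"
proof -
  have all: "(\<forall>w\<le>z. f w = w) \<longleftrightarrow> (\<forall>w. f w = w)" if "\<And>w. z \<le> w \<Longrightarrow> f w = w" for f :: "nat \<Rightarrow> nat"
    using that nat_le_linear by blast
  have 1: "(\<forall>w\<le>z. code_step z (x, \<not> b) (code_step z (x, b) w) = w) \<longleftrightarrow>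
      (\<forall>w. code_step z (x, \<not> b) (code_step z (x, b) w) = w)" for x b
    by (rule all) (simp add: code_step_def table_step_beyond)
  have 2: "(\<forall>w\<le>z. fold (code_step z) r w = w) \<longleftrightarrow> (\<forall>w. fold (code_step z) r w = w)" for r
    by (rule all) (simp add: fold_code_step_beyond)
  have "perm_rep gens rels UNIV (code_step z) \<longleftrightarrow> perm_rep gens core_rels UNIV (code_step z)"
  proof
    assume "perm_rep gens rels UNIV (code_step z)"
    then show "perm_rep gens core_rels UNIV (code_step z)" using core_rels_subset by (auto simp: perm_rep_def)
  qed (rule perm_rep_core_rels)
  also have "\<dots> \<longleftrightarrow> (\<forall>p\<in>inverse_codes. \<forall>w\<le>z. table_step z (snd p) (table_step z (fst p) w) = w) \<and>
     (\<forall>r\<in>relator_codes. \<forall>w\<le>z. table_run z r w = w)"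
    unfolding perm_rep_def inverse_codes_def relator_codes_def
    using 1 2 by (auto simp: table_run_encode_word code_step_def[symmetric])
  finally have p: "perm_rep gens rels UNIV (code_step z) \<longleftrightarrow> \<dots>" .
  have h: "(\<forall>i\<le>encode_words c hs. table_run z (code_nth (encode_words c hs) i) 0 = 0) \<longleftrightarrow>
      (\<forall>h\<in>set hs. fold (code_step z) h 0 = 0)"
  proof
    assume L: "\<forall>i\<le>encode_words c hs. table_run z (code_nth (encode_words c hs) i) 0 = 0"
    show "\<forall>h\<in>set hs. fold (code_step z) h 0 = 0"
    proof
      fix h assume "h \<in> set hs"
      then obtain i where i: "i < length hs" "h = hs ! i" by (auto simp: in_set_conv_nth)
      have "length hs \<le> encode_words c hs"
        using length_le_list_encode[of "map (encode_word c) hs"] by (simp add: encode_words_def)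
      then have "i \<le> encode_words c hs" using i by simp
      with L have "table_run z (code_nth (encode_words c hs) i) 0 = 0" by blast
      then show "fold (code_step z) h 0 = 0"
        by (simp add: code_nth_encode_words(1)[OF i(1)] i(2) table_run_encode_word)
    qed
  next
    assume R: "\<forall>h\<in>set hs. fold (code_step z) h 0 = 0"
    show "\<forall>i\<le>encode_words c hs. table_run z (code_nth (encode_words c hs) i) 0 = 0"
    proof (intro allI impI)
      fix i
      show "table_run z (code_nth (encode_words c hs) i) 0 = 0"
        using R by (cases "i < length hs") (simp_all add: code_nth_encode_words table_run_encode_word)
    qed
  qed
  show ?thesis
    unfolding table_cert_def p h table_run_encode_word fold_power by blast
qed

text \<open>
  The stabilizer of a point is a subgroup, so it contains \<open>H\<close> if it contains the generators.
\<close>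

lemma stabilizer_sound:
  assumes s: "perm_rep gens rels UNIV s" and hs: "set hs \<subseteq> words gens"
    and fix_h: "\<And>h. h \<in> set hs \<Longrightarrow> fold s h w0 = w0"
  shows "x \<in> generate G (el ` set hs) \<Longrightarrow> u \<in> words gens \<Longrightarrow> el u = x \<Longrightarrow> fold s u w0 = w0"
proof (induction arbitrary: u rule: generate.induct)
  have same: "fold s u w0 = fold s v w0" if "u \<in> words gens" "v \<in> words gens" "el u = el v" for u v
    using perm_rep_pres_eq[OF s rels_words, of u v w0] word_class_eq_iff[OF rels_words] that by blast
  {
    case one
    then show ?case using same[of u "[]"] by (simp add: one_G)
  next
    case (incl h)
    then obtain w where w: "w \<in> set hs" "h = el w" by blast
    then show ?case using same[of u w] incl.prems fix_h hs by auto
  next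
    case (inv h)
    then obtain w where w: "w \<in> set hs" "h = el w" by blast
    have wX: "w \<in> words gens" using w hs by blast
    have "fold s (inv_word w) w0 = w0"
      using perm_rep_inv_word(1)[OF s rels_words wX, of w0] fix_h[OF w(1)] by simp
    then show ?case using same[of u "inv_word w"] inv.prems wX w by (simp add: el_inv)
  next
    case (eng h1 h2)
    have elG: "el ` set hs \<subseteq> carrier G" using hs el_closed by auto
    obtain u1 u2 where u: "u1 \<in> words gens" "h1 = el u1" "u2 \<in> words gens" "h2 = el u2"
      using eng.hyps amalgam.generate_in_carrier[OF elG] carrier_G by (metis imageE)
    then show ?case
      using same[of u "u1 @ u2"] eng.prems eng.IH(1)[of u1] eng.IH(2)[of u2] by (simp add: el_mult)
  }
qed

end

section \<open>The decision procedure\<close>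

context coded_finite_amalgam
begin

definition max_letter :: nat where
  "max_letter = Max (insert 0 (letter_code ` (gens \<times> UNIV)))"

lemma letter_code_le: "l \<in> gens \<times> UNIV \<Longrightarrow> letter_code l \<le> max_letter"
  unfolding max_letter_def using finite_letters by (intro Max_ge) auto

text \<open>
  The states are numbered with \<open>w0\<close> as \<open>0\<close>, and the table lists all transitions; numbers that belong to no
  state are fixed. The bound is the code of a list of the same length filled with the largest entry.
\<close>

lemma perm_rep_table:
  assumes s: "perm_rep gens rels W s" and fin: "finite W" and w0: "w0 \<in> W" and M: "card W \<le> M"
  shows "\<exists>z \<nu>. z \<le> list_code_bound (Suc (prod_encode (max_letter, M))) (Suc M) \<and>
    inj_on \<nu> W \<and> \<nu> w0 = 0 \<and> perm_rep gens rels UNIV (code_step z) \<and>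
    (\<forall>u\<in>words gens. \<forall>w\<in>W. fold (code_step z) u (\<nu> w) = \<nu> (fold s u w))"
proof -
  obtain f where f: "bij_betw f W {0..<card W}" using ex_bij_betw_finite_nat[OF fin] by blast
  define \<nu> where "\<nu> w = (if w = w0 then 0 else Suc (f w))" for w
  have \<nu>_inj: "inj_on \<nu> W" using f by (auto simp: inj_on_def \<nu>_def bij_betw_def)
  have \<nu>_le: "\<nu> w \<le> M" if "w \<in> W" for w
  proof -
    have "f w < card W" using f that by (auto simp: bij_betw_def)
    then show ?thesis using M by (simp add: \<nu>_def)
  qed
  let ?L = "gens \<times> (UNIV :: bool set)"
  define entry where "entry j = (case prod_decode j of (lc, w) \<Rightarrow>
    if lc \<in> letter_code ` ?L \<and> w \<in> \<nu> ` W
    then Suc (\<nu> (s (inv_into ?L letter_code lc) (inv_into W \<nu> w))) else 0)" for j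
  define len where "len = Suc (prod_encode (max_letter, M))"
  define z where "z = list_encode (map entry [0..<len])"
  have s_closed: "s l w \<in> W" if "l \<in> ?L" "w \<in> W" for l w
    using s that by (auto simp: perm_rep_def)
  have entry_code: "entry (prod_encode (letter_code l, \<nu> w)) = Suc (\<nu> (s l w))"
    if "l \<in> ?L" "w \<in> W" for l w
    using that letter_code_inj \<nu>_inj by (simp add: entry_def)
  have entry_other: "entry (prod_encode (lc, w)) = 0" if "w \<notin> \<nu> ` W" for lc w
    using that by (simp add: entry_def)
  have entry_le: "entry j \<le> Suc M" for j
  proof -
    obtain lc w where j: "prod_decode j = (lc, w)" by force
    show ?thesis
    proof (cases "lc \<in> letter_code ` ?L \<and> w \<in> \<nu> ` W")
      case True
      then have "s (inv_into ?L letter_code lc) (inv_into W \<nu> w) \<in> W"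
        by (intro s_closed) (auto intro: inv_into_into)
      then show ?thesis using \<nu>_le j by (simp add: entry_def)
    next
      case False
      then have "entry j = 0" by (auto simp: entry_def j)
      then show ?thesis by simp
    qed
  qed
  have z_le: "z \<le> list_code_bound len (Suc M)"
    unfolding z_def using entry_le by (intro list_encode_le_bound) auto
  have nth: "code_nth z j = (if j < len then entry j else 0)" for j
    by (simp add: z_def code_nth_list_encode)
  have step: "code_step z l (\<nu> w) = \<nu> (s l w)" if "l \<in> ?L" "w \<in> W" for l w
  proof -
    have "prod_encode (letter_code l, \<nu> w) < len"
      using prod_encode_mono[OF letter_code_le[OF that(1)] \<nu>_le[OF that(2)]] by (simp add: len_def)
    then show ?thesis using entry_code[OF that] by (simp add: code_step_def table_step_def nth)
  qed
  have step_other: "code_step z l w = w" if "w \<notin> \<nu> ` W" for l w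
    using entry_other[OF that] by (simp add: code_step_def table_step_def nth)
  have run: "fold (code_step z) u (\<nu> w) = \<nu> (fold s u w)" if "u \<in> words gens" "w \<in> W" for u w
    using that
  proof (induction u arbitrary: w)
    case (Cons l u)
    then have "l \<in> ?L" "u \<in> words gens" by (cases l; simp)+
    then show ?case using Cons step s_closed by simp
  qed simp
  have run_other: "fold (code_step z) u w = w" if "w \<notin> \<nu> ` W" for u w
    using step_other[OF that] by (induction u) simp_all
  have "perm_rep gens rels UNIV (code_step z)"
    unfolding perm_rep_def
  proof (intro conjI ballI allI)
    fix x b n assume x: "x \<in> gens"
    show "code_step z (x, b) n \<in> UNIV" by simp
    show "code_step z (x, \<not> b) (code_step z (x, b) n) = n"
    proof (cases "n \<in> \<nu> ` W")
      case True
      then obtain w where w: "w \<in> W" "n = \<nu> w" by blast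
      have "s (x, \<not> b) (s (x, b) w) = w" using s x w by (simp add: perm_rep_def)
      then show ?thesis using w x step s_closed by simp
    qed (simp add: step_other)
  next
    fix r n assume r: "r \<in> rels"
    show "fold (code_step z) r n = n"
    proof (cases "n \<in> \<nu> ` W")
      case True
      then obtain w where w: "w \<in> W" "n = \<nu> w" by blast
      moreover have "fold s r w = w" using s r w by (simp add: perm_rep_def)
      ultimately show ?thesis using run[of r w] r rels_words by auto
    qed (simp add: run_other)
  qed
  moreover have "\<nu> w0 = 0" by (simp add: \<nu>_def)
  ultimately show ?thesis using z_le \<nu>_inj run unfolding len_def by blast
qed

text \<open>
  The bound of \<open>finite_separation\<close>, with the lengths of words replaced by their codes, which are
  at least as large.
\<close>

definition size_bound :: "nat \<Rightarrow> nat \<Rightarrow> nat \<Rightarrow> nat" where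
  "size_bound hc gc n = 2 ^ ((Suc (n * gc) + hc) * (card (carrier (K True)) + card (carrier (K False))) *
     (card (carrier (K True)) * card (carrier (K False))))"

definition cert_bound :: "nat \<Rightarrow> nat \<Rightarrow> nat \<Rightarrow> nat" where
  "cert_bound hc gc n = list_code_bound (Suc (prod_encode (max_letter, size_bound hc gc n))) (Suc (size_bound hc gc n))"

definition power_member :: "nat \<Rightarrow> nat \<Rightarrow> nat \<Rightarrow> bool" where
  "power_member hc gc n \<longleftrightarrow> (\<forall>z\<le>cert_bound hc gc n. \<not> table_cert inverse_codes relator_codes z hc gc n)"

lemma length_le_encode_word: "length u \<le> encode_word c u"
  using length_le_list_encode[of "map letter_code u"] by (simp add: encode_word_eq)

theorem power_member_iff:
  assumes hs: "set hs \<subseteq> words gens" and g: "g \<in> words gens"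
  shows "power_member (encode_words c hs) (encode_word c g) n \<longleftrightarrow>
    el g [^]\<^bsub>G\<^esub> n \<in> generate G (el ` set hs)"
proof
  define v where "v = concat (replicate n g)"
  have v: "v \<in> words gens" "el g [^]\<^bsub>G\<^esub> n = el v"
    using g by (simp_all add: v_def words_power el_power)
  {
    assume mem: "el g [^]\<^bsub>G\<^esub> n \<in> generate G (el ` set hs)"
    show "power_member (encode_words c hs) (encode_word c g) n"
      unfolding power_member_def table_cert_iff[OF hs] v_def[symmetric]
    proof (intro allI impI notI, elim conjE)
      fix z
      assume rep: "perm_rep gens rels UNIV (code_step z)" and fix_h: "\<forall>h\<in>set hs. fold (code_step z) h 0 = 0"
        and move: "fold (code_step z) v 0 \<noteq> 0"
      have "fold (code_step z) v 0 = 0"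
        by (rule stabilizer_sound[OF rep hs bspec[OF fix_h] mem v(1) v(2)[symmetric]])
      with move show False by contradiction
    qed
  next
    assume pm: "power_member (encode_words c hs) (encode_word c g) n"
    show "el g [^]\<^bsub>G\<^esub> n \<in> generate G (el ` set hs)"
    proof (rule ccontr)
      assume "el g [^]\<^bsub>G\<^esub> n \<notin> generate G (el ` set hs)"
      then have "el v \<notin> generate G (el ` set hs)" by (simp add: v)
      from finite_separation[OF hs v(1) this]
      obtain W :: "('x word set set \<times> 'x word set \<times> 'x word set) set set" and s w0 N where
        W: "finite W" "card W = 2 ^ N" "perm_rep gens rels W s" "w0 \<in> W"
        and N: "N \<le> (sum_list (map (\<lambda>w. Suc (length w)) (v # hs)) *
          (card (carrier (K True)) + card (carrier (K False)))) *
          (card (carrier (K True)) * card (carrier (K False)))"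
        and fix_h: "\<forall>h\<in>set hs. fold s h w0 = w0" and move: "fold s v w0 \<noteq> w0"
        by (elim exE conjE) (rule that)
      have "length v = n * length g" by (simp add: v_def length_concat sum_list_replicate)
      then have "sum_list (map (\<lambda>w. Suc (length w)) (v # hs)) \<le>
          Suc (n * encode_word c g) + encode_words c hs"
        using sum_length_le_encode_words[of hs c] length_le_encode_word[of g]
        by (simp add: add_le_mono)
      then have "N \<le> (Suc (n * encode_word c g) + encode_words c hs) *
          (card (carrier (K True)) + card (carrier (K False))) *
          (card (carrier (K True)) * card (carrier (K False)))"
        using N by (meson le_trans mult_le_mono1)
      then have M: "card W \<le> size_bound (encode_words c hs) (encode_word c g) n"
        unfolding W(2) size_bound_def by (rule power_increasing) simp
      from perm_rep_table[OF W(3,1,4) M, folded cert_bound_def] obtain z \<nu> where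
        z: "z \<le> cert_bound (encode_words c hs) (encode_word c g) n"
        and \<nu>: "inj_on \<nu> W" "\<nu> w0 = 0" and rep: "perm_rep gens rels UNIV (code_step z)"
        and run: "\<forall>u\<in>words gens. \<forall>w\<in>W. fold (code_step z) u (\<nu> w) = \<nu> (fold s u w)"
        by (elim exE conjE) (rule that)
      have run0: "fold (code_step z) u 0 = \<nu> (fold s u w0)" if "u \<in> words gens" for u
        using run that W(4) \<nu>(2) by metis
      have "fold (code_step z) h 0 = 0" if "h \<in> set hs" for h
        using run0[of h] that hs fix_h \<nu>(2) by auto
      moreover have "fold s v w0 \<in> W" by (rule perm_rep_closed[OF W(3) v(1) W(4)])
      then have "\<nu> (fold s v w0) \<noteq> \<nu> w0" using \<nu>(1) W(4) move by (auto dest: inj_onD)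
      then have "fold (code_step z) v 0 \<noteq> 0" using run0[OF v(1)] \<nu>(2) by simp
      ultimately have "table_cert inverse_codes relator_codes z (encode_words c hs) (encode_word c g) n"
        unfolding table_cert_iff[OF hs] v_def[symmetric] using rep by blast
      then show False using pm z by (simp add: power_member_def)
    qed
  }
qed

lemma decidable_power_member:
  assumes "computable k f" "computable k g" "computable k h"
  shows "decidable k (\<lambda>e. power_member (f e) (g e) (h e))"
proof -
  have "decidable 3 (\<lambda>e. power_member (e 0) (e 1) (e 2))"
    unfolding power_member_def
  proof (rule decidable_ball_le)
    have "decidable (Suc 3) (\<lambda>e. table_cert inverse_codes relator_codes (e 0) (e 1) (e 2) (e 3))"
      using decidable_table_cert[OF finite_inverse_codes finite_relator_codes] by simp
    then show "decidable (Suc 3) (\<lambda>e. \<not> table_cert inverse_codes relator_codes (e 0) (e (Suc 0)) (e (Suc 1)) (e (Suc 2)))"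
      by (intro decidable_not) (simp add: eval_nat_numeral)
    show "computable 3 (\<lambda>e. cert_bound (e 0) (e 1) (e 2))"
      unfolding cert_bound_def size_bound_def
      by (intro computable_list_code_bound computable_prod_encode computable_intros) simp_all
  qed
  then show ?thesis
    unfolding decidable_def
    using computable_3[OF _ assms, of "\<lambda>a b c. of_bool (power_member a b c)"] by blast
qed

definition good_power :: "nat \<Rightarrow> nat \<Rightarrow> nat \<Rightarrow> bool" where
  "good_power hc gc n \<longleftrightarrow> 1 \<le> n \<and> \<not> power_member 0 gc n \<and> power_member hc gc n"

lemma good_power_iff:
  assumes hs: "set hs \<subseteq> words gens" and g: "g \<in> words gens"
  shows "good_power (encode_words c hs) (encode_word c g) n \<longleftrightarrow>
    1 \<le> n \<and> el g [^]\<^bsub>G\<^esub> n \<noteq> \<one>\<^bsub>G\<^esub> \<and> el g [^]\<^bsub>G\<^esub> n \<in> generate G (el ` set hs)"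
  using power_member_iff[OF hs g, of n] power_member_iff[of "[]" g n] g
  by (simp add: good_power_def encode_words_def amalgam.generate_empty)

definition search_bound :: "nat \<Rightarrow> nat \<Rightarrow> nat" where
  "search_bound hc gc = (Suc hc + Suc gc) * (card (carrier (K True)) + card (carrier (K False)))"

text \<open>
  The search stops one step after \<^const>\<open>search_bound\<close> if no power is found.
\<close>

definition least_good :: "nat \<Rightarrow> nat \<Rightarrow> nat" where
  "least_good hc gc = (let m = LEAST n. (if search_bound hc gc < n \<or> good_power hc gc n then 0 else 1) = (0::nat)
     in if m \<le> search_bound hc gc then m else 0)"

lemma least_good_correct:
  assumes bound: "\<And>n. good_power hc gc n \<Longrightarrow> \<exists>m\<le>search_bound hc gc. good_power hc gc m"
  shows "least_good hc gc = (if \<exists>n. good_power hc gc n then LEAST n. good_power hc gc n else 0)"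
proof -
  define b where "b = search_bound hc gc"
  have eq: "((if b < n \<or> good_power hc gc n then 0 else 1) = (0::nat)) \<longleftrightarrow> b < n \<or> good_power hc gc n" for n
    by simp
  show ?thesis
  proof (cases "\<exists>n. good_power hc gc n")
    case True
    define d where "d = (LEAST n. good_power hc gc n)"
    have d: "good_power hc gc d" unfolding d_def using True by (rule LeastI_ex)
    have db: "d \<le> b" using bound[OF d] Least_le[of "good_power hc gc"] unfolding b_def d_def by (meson le_trans)
    have "(LEAST n. b < n \<or> good_power hc gc n) = d"
    proof (rule Least_equality)
      show "b < d \<or> good_power hc gc d" using d by simp
      fix n assume "b < n \<or> good_power hc gc n"
      then show "d \<le> n" using db Least_le[of "good_power hc gc" n] by (auto simp: d_def)
    qed
    then show ?thesis
      using True db unfolding least_good_def b_def[symmetric] eq by (simp add: Let_def d_def)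
  next
    case False
    then have "(LEAST n. b < n \<or> good_power hc gc n) = Suc b"
      by (intro Least_equality) auto
    then show ?thesis
      using False unfolding least_good_def b_def[symmetric] eq by (simp add: Let_def)
  qed
qed

lemma computable_least_good: "computable 2 (\<lambda>e. least_good (e 0) (e 1))"
proof -
  have sb: "computable k (\<lambda>e. search_bound (f e) (g e))" if "computable k f" "computable k g" for k f g
    unfolding search_bound_def by (intro computable_intros that)
  have gp: "decidable k (\<lambda>e. good_power (f e) (g e) (h e))"
    if "computable k f" "computable k g" "computable k h" for k f g h
    unfolding good_power_def by (intro computable_intros decidable_power_member that)
  have lt: "a < b \<longleftrightarrow> \<not> b \<le> a" for a b :: nat by auto
  have L: "computable 2 (\<lambda>e. LEAST n. (if search_bound (e 0) (e 1) < n \<or> good_power (e 0) (e 1) n then 0 else 1) = (0::nat))"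
  proof (rule computable_Least)
    show "computable (Suc 2) (\<lambda>e. if search_bound (e (Suc 0)) (e (Suc 1)) < e 0 \<or>
        good_power (e (Suc 0)) (e (Suc 1)) (e 0) then 0 else 1)"
      unfolding lt by (intro computable_if decidable_disj decidable_not decidable_le sb gp computable_proj
          computable_const) simp_all
    show "\<exists>n. (if search_bound (e 0) (e 1) < n \<or> good_power (e 0) (e 1) n then 0 else 1) = (0::nat)"
      for e :: "nat \<Rightarrow> nat"
      by (rule exI[of _ "Suc (search_bound (e 0) (e 1))"]) simp
  qed
  show ?thesis
    unfolding least_good_def Let_def
    by (intro computable_if decidable_le L sb computable_proj computable_const) simp_all
qed

theorem ex_least_power_program:
  "\<exists>p. \<forall>hs g. set hs \<subseteq> words gens \<and> g \<in> words gens \<longrightarrow>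
    (let good = (\<lambda>n::nat. 1 \<le> n \<and> el g [^]\<^bsub>G\<^esub> n \<noteq> \<one>\<^bsub>G\<^esub> \<and>
                   el g [^]\<^bsub>G\<^esub> n \<in> generate G (el ` set hs))
     in evals p [encode_words c hs, encode_word c g] (if \<exists>n. good n then LEAST n. good n else 0))"
proof -
  obtain p where p: "\<And>e. evals p (map e [0..<2]) (least_good (e 0) (e 1))"
    using computable_least_good unfolding computable_def by blast
  have p': "evals p [a, b] (least_good a b)" for a b
    using p[of "\<lambda>i. if i = 0 then a else b"] by (simp add: upt_rec)
  show ?thesis
    unfolding Let_def
  proof (intro exI[of _ p] allI impI, elim conjE)
    fix hs g assume hs: "set hs \<subseteq> words gens" and g: "g \<in> words gens"
    note good = good_power_iff[OF hs g]
    have "\<exists>m\<le>search_bound (encode_words c hs) (encode_word c g).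
        good_power (encode_words c hs) (encode_word c g) m"
      if "good_power (encode_words c hs) (encode_word c g) n" for n
    proof -
      have n: "0 < n" "el g [^]\<^bsub>G\<^esub> n \<in> generate G (el ` set hs)" "el g [^]\<^bsub>G\<^esub> n \<noteq> \<one>\<^bsub>G\<^esub>"
        using that good by auto
      from least_power_bound_length[OF hs g n] obtain m where m: "0 < m"
        "m \<le> (Suc (sum_list (map (\<lambda>w. Suc (length w)) hs)) + Suc (length g)) *
          (card (carrier (K True)) + card (carrier (K False)))"
        "el g [^]\<^bsub>G\<^esub> m \<in> generate G (el ` set hs)" "el g [^]\<^bsub>G\<^esub> m \<noteq> \<one>\<^bsub>G\<^esub>"
        by (elim exE conjE) (rule that)
      note m(2)
      also have "(Suc (sum_list (map (\<lambda>w. Suc (length w)) hs)) + Suc (length g)) *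
          (card (carrier (K True)) + card (carrier (K False))) \<le> search_bound (encode_words c hs) (encode_word c g)"
        unfolding search_bound_def
        by (intro mult_le_mono1 add_le_mono Suc_le_mono[THEN iffD2] sum_length_le_encode_words length_le_encode_word)
      finally show ?thesis using m good by (intro exI[of _ m]) auto
    qed
    from least_good_correct[OF this]
    have "least_good (encode_words c hs) (encode_word c g) =
      (if \<exists>n. good_power (encode_words c hs) (encode_word c g) n
       then LEAST n. good_power (encode_words c hs) (encode_word c g) n else 0)" .
    with p'[of "encode_words c hs" "encode_word c g"]
    show "evals p [encode_words c hs, encode_word c g]
      (if \<exists>n::nat. 1 \<le> n \<and> el g [^]\<^bsub>G\<^esub> n \<noteq> \<one>\<^bsub>G\<^esub> \<and> el g [^]\<^bsub>G\<^esub> n \<in> generate G (el ` set hs)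
       then LEAST n. 1 \<le> n \<and> el g [^]\<^bsub>G\<^esub> n \<noteq> \<one>\<^bsub>G\<^esub> \<and> el g [^]\<^bsub>G\<^esub> n \<in> generate G (el ` set hs) else 0)"
      unfolding good by simp
  qed
qed

end

theorem corollary8p4:
  fixes X1 X2 :: "'x set" and R1 R2 :: "'x word set"
    and A :: "('a, 'm) monoid_scheme" and Y :: "'a set"
    and \<phi>1 \<phi>2 :: "'a \<Rightarrow> 'x word set"
    and c :: "'x \<Rightarrow> nat"
  defines "R \<equiv> R1 \<union> R2 \<union> amalgam_relators Y \<phi>1 \<phi>2"
  defines "G1 \<equiv> presented_group X1 R1"
    and "G2 \<equiv> presented_group X2 R2"
    and "G \<equiv> presented_group (X1 \<union> X2) R"
    and "el \<equiv> word_class (X1 \<union> X2) R"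
  assumes "finite X1" "finite X2" "X1 \<inter> X2 = {}"
    and "R1 \<subseteq> words X1" "R2 \<subseteq> words X2" "finite R1" "finite R2"
    and "finite (carrier G1)" "finite (carrier G2)"
    and "group A" "Y \<subseteq> carrier A" "generate A Y = carrier A"
    and "\<phi>1 \<in> mon A G1" "\<phi>2 \<in> mon A G2"
    and "inj_on c (X1 \<union> X2)"
  shows "\<exists>p. \<forall>hs g.
    set hs \<subseteq> words (X1 \<union> X2) \<and>
    normal_word X1 X2 R {el u | a u. a \<in> carrier A \<and> u \<in> \<phi>1 a} g \<longrightarrow>
    (let good = (\<lambda>n::nat. 1 \<le> n \<and> el g [^]\<^bsub>G\<^esub> n \<noteq> \<one>\<^bsub>G\<^esub> \<and>
                   el g [^]\<^bsub>G\<^esub> n \<in> generate G (el ` set hs))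
     in evals p [encode_words c hs, encode_word c g]
          (if \<exists>n. good n then LEAST n. good n else 0))"
proof -
  interpret M: coded_finite_amalgam "\<lambda>i. if i then X1 else X2" "\<lambda>i. if i then R1 else R2"
    A Y "\<lambda>i. if i then \<phi>1 else \<phi>2" c
    using assms(6-) unfolding G1_def G2_def
    by (intro coded_finite_amalgam.intro finite_amalgam.intro coded_finite_amalgam_axioms.intro)
      (simp_all split: if_splits)
  have gens: "M.gens = X1 \<union> X2" and rels: "M.rels = R"
    by (simp_all add: M.gens_def M.rels_def R_def)
  have normal: "g \<in> words (X1 \<union> X2)" if "normal_word X1 X2 R B g" for B g
  proof -
    obtain gs where "g = concat gs" "\<forall>h\<in>set gs. h \<in> words X1 \<or> h \<in> words X2"
      using \<open>normal_word X1 X2 R B g\<close> unfolding normal_word_def by blast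
    moreover have "words X1 \<subseteq> words (X1 \<union> X2)" "words X2 \<subseteq> words (X1 \<union> X2)"
      by (auto simp: words_def)
    moreover have "concat gs \<in> words (X1 \<union> X2)" if "\<forall>h\<in>set gs. h \<in> words (X1 \<union> X2)"
      using that by (induction gs) auto
    ultimately show ?thesis by blast
  qed
  show ?thesis
    using M.ex_least_power_program normal unfolding gens rels G_def el_def by meson
qed

end
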